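(* Let $\mathcal{P}\in\{\mathcal{M},\mathcal{H}\}$, where $\mathcal{M}$ is the property of containing a perfect matching and $\mathcal{H}$ the property of containing a Hamiltonian cycle, and let $m^*(n):=m_{\mathcal{P}}(1/2,n)$ in the semi-random graph process. Then: (1) in the semi-random graph process, $m^*$ is a sharp threshold for $\mathcal{P}$; (2) there exists a constant $C_{\mathcal{P}}>0$ such that $m^*=(C_{\mathcal{P}}+o(1))n$.
   Context: Semi-random graph process: start with the empty graph on $[n]$; in each step $t\ge1$ a vertex $u_t$ (square) is drawn independently and uniformly at random from $[n]$, the player adaptively chooses a vertex $v_t$ (circle), and the edge $u_tv_t$ is added (multigraphs allowed). For $n$ odd, a perfect matching means a matching saturating all but one vertex. For a strategy $\mathcal{S}$, $T_{\mathcal{S}}$ is the first step at which the graph satisfies $\mathcal{P}$. For $\theta\in(0,1)$, $m_{\mathcal{P}}(\theta,n)$ is the minimum $t\ge1$ such that some strategy $\mathcal{S}'$ has $\Pr[T_{\mathcal{S}'}\le t]\ge\theta$ and every strategy $\mathcal{S}$ has $\Pr[T_{\mathcal{S}}\le t-1]<\theta$. A function $s(n)$ is a sharp threshold if for every $\epsilon>0$: some strategy $\mathcal{S}'_n$ has $\Pr[T_{\mathcal{S}'_n}\le(1+\epsilon)s]=1-o(1)$, and every strategy $\mathcal{S}_n$ has $\Pr[T_{\mathcal{S}_n}\le(1-\epsilon)s]=o(1)$. *)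

theory Defs
  imports "HOL-Probability.Probability" "HOL-Library.Extended_Nat" "HOL-Library.Multiset"
begin

(* A multigraph on the vertex set {1..n} is given by the multiset of its edges; {u} is a loop. *)
type_synonym multigraph = "nat set multiset"
type_synonym graph_property = "nat \<Rightarrow> multigraph \<Rightarrow> bool"

definition is_matching :: "multigraph \<Rightarrow> nat set set \<Rightarrow> bool" where
  "is_matching E M \<longleftrightarrow>
     M \<subseteq> set_mset E \<and> (\<forall>e\<in>M. card e = 2) \<and> (\<forall>e\<in>M. \<forall>f\<in>M. e \<noteq> f \<longrightarrow> e \<inter> f = {})"

definition has_perfect_matching :: graph_property where
  "has_perfect_matching n E \<longleftrightarrow>
     (\<exists>M. is_matching E M \<and>
        (if even n then \<Union>M = {1..n} else (\<exists>w\<in>{1..n}. \<Union>M = {1..n} - {w})))"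

definition has_hamiltonian_cycle :: graph_property where
  "has_hamiltonian_cycle n E \<longleftrightarrow>
     n \<ge> 3 \<and>
     (\<exists>c. distinct c \<and> set c = {1..n} \<and>
        (\<forall>i<length c. {c ! i, c ! (Suc i mod length c)} \<in># E))"

(* The history after t steps is the list [(u_1,v_1),...,(u_t,v_t)] of (square, circle) pairs.
   A strategy maps the history of the previous steps and the current square u_t to the
   distribution of v_t; a deterministic strategy is one all of whose values are Dirac. *)
type_synonym history = "(nat \<times> nat) list"
type_synonym strategy = "history \<Rightarrow> nat \<Rightarrow> nat pmf"

definition is_strategy :: "nat \<Rightarrow> strategy \<Rightarrow> bool" where
  "is_strategy n S \<longleftrightarrow>
     (\<forall>h u. set h \<subseteq> {1..n} \<times> {1..n} \<longrightarrow> u \<in> {1..n} \<longrightarrow> set_pmf (S h u) \<subseteq> {1..n})"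

primrec process :: "nat \<Rightarrow> strategy \<Rightarrow> nat \<Rightarrow> history pmf" where
  "process n S 0 = return_pmf []"
| "process n S (Suc t) =
     bind_pmf (process n S t) (\<lambda>h.
     bind_pmf (pmf_of_set {1..n}) (\<lambda>u.
     bind_pmf (S h u) (\<lambda>v. return_pmf (h @ [(u, v)]))))"

definition graph_of :: "history \<Rightarrow> multigraph" where
  "graph_of h = mset (map (\<lambda>(u, v). {u, v}) h)"

(* Infinite if the property is not reached within the given history. *)
definition hitting_time :: "graph_property \<Rightarrow> nat \<Rightarrow> history \<Rightarrow> enat" where
  "hitting_time P n h =
     Inf {enat s | s. 1 \<le> s \<and> s \<le> length h \<and> P n (graph_of (take s h))}"

(* Pr[T_S \<le> t]; this event depends only on the first t steps of the process. *)
definition hit_prob :: "graph_property \<Rightarrow> nat \<Rightarrow> strategy \<Rightarrow> nat \<Rightarrow> real" where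
  "hit_prob P n S t =
     measure_pmf.prob (process n S t) {h. hitting_time P n h \<le> enat t}"

(* Unspecified when no such t exists, e.g. for Hamiltonicity and n < 3. *)
definition m_threshold :: "graph_property \<Rightarrow> real \<Rightarrow> nat \<Rightarrow> nat" where
  "m_threshold P \<theta> n =
     (LEAST t. t \<ge> 1 \<and>
        (\<exists>S. is_strategy n S \<and> hit_prob P n S t \<ge> \<theta>) \<and>
        (\<forall>S. is_strategy n S \<longrightarrow> hit_prob P n S (t - 1) < \<theta>))"

(* T is a positive integer or infinite, so T \<le> x iff T \<le> nat \<lfloor>x\<rfloor> for every real x
   (both fail for x < 1).  There is no strategy for n = 0, hence the restriction to n \<ge> 1. *)
definition sharp_threshold :: "graph_property \<Rightarrow> (nat \<Rightarrow> real) \<Rightarrow> bool" where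
  "sharp_threshold P s \<longleftrightarrow>
     (\<forall>\<epsilon>>0.
        (\<exists>S. (\<forall>n\<ge>1. is_strategy n (S n)) \<and>
           (\<lambda>n. hit_prob P n (S n) (nat \<lfloor>(1 + \<epsilon>) * s n\<rfloor>)) \<longlonglongrightarrow> 1) \<and>
        (\<forall>S. (\<forall>n\<ge>1. is_strategy n (S n)) \<longrightarrow>
           (\<lambda>n. hit_prob P n (S n) (nat \<lfloor>(1 - \<epsilon>) * s n\<rfloor>)) \<longlonglongrightarrow> 0))"

end

theory Submission
  imports Defs
begin

text \<open>
  Let \<open>B f E\<close> be the average over the square \<open>u\<close> of the maximum over the circle \<open>v\<close> of \<open>f (E \<union> {uv})\<close>; then
  the optimal probability to have reached the property after \<open>t\<close> steps is the \<open>t\<close>-th iterate of \<open>B\<close> on its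
  indicator, at the empty graph.  Let \<open>D E\<close> be the least number of edges missing from \<open>E\<close> in a target edge set
  (near-perfect matching, Hamiltonian cycle).

  Concentration: a second-moment induction shows that if the property is reached with probability \<open>p\<close> by time
  \<open>t\<close>, then some strategy has expected distance \<open>D\<close> at most \<open>sqrt (t / p)\<close> at time \<open>t\<close>.

  Repair: from any graph the property is reached within \<open>t \<le> n\<close> further steps with probability at least
  \<open>1 - 400 * sqrt (D n) / t\<close>.  In order \<open>sqrt (D n)\<close> steps a constant fraction of the missing edges is repaired:
  first squares \<open>u\<close> belonging to slots \<open>(u, w)\<close> are joined to one end of a gadget, and then squares hitting the
  matching vertices \<open>w\<close> are joined to the other end.

  Together these give a sharp threshold.  For the linear growth, blocks of \<open>N\<close> vertices are played
  independently inside \<open>n\<close> vertices; the distances add up to order \<open>n / sqrt N\<close>, which is repaired in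
  order \<open>n * N powr (-1/4)\<close> steps, so \<open>m\<^sup>*(n) / n\<close> is almost decreasing and converges.
\<close>

section \<open>The optimal step operator\<close>

text \<open>A missing edge is repaired directly only when a square hits one of its endpoints, so the
  last few edges would cost order n steps, as much as the whole process. Through gadgets any of
  order n slots will do: once s squares have marked slots, s further squares hit about s^2 / n
  marks, as in the birthday problem, and this is of order D when s is of order sqrt (D n). That is
  o(n) whenever D is o(n), so one estimate serves both conclusions. The strategy that maximizes the
  winning probability need not be the one that minimizes the distance, so concentration cannot be
  argued along a single process. The second-moment bound is therefore proved for the operator, that
  is, against every strategy. Squaring only the positive part keeps the function nondecreasing, so
  that it commutes with the maximum over the circle. Rates are counted per vertex because a block
  sees the squares of other blocks as idle steps; all blocks and their union then share one
  \<rho>.\<close>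

text \<open>A step of a process on \<open>n\<close> vertices in which each vertex is drawn with probability \<open>\<rho>\<close>, and nothing happens
  with the remaining probability.\<close>
definition lazy_step :: "real \<Rightarrow> nat \<Rightarrow> (nat set set \<Rightarrow> real) \<Rightarrow> nat set set \<Rightarrow> real" where
  "lazy_step \<rho> n f E =
     (1 - \<rho> * real n) * f E + \<rho> * (\<Sum>u\<in>{1..n}. MAX v\<in>{1..n}. f (insert {u, v} E))"

abbreviation opt_step :: "nat \<Rightarrow> (nat set set \<Rightarrow> real) \<Rightarrow> nat set set \<Rightarrow> real" where
  "opt_step n \<equiv> lazy_step (1 / real n) n"

text \<open>Every added edge raises the value by an amount in [0, 1], which bounds the variance of a
  step. The instance in use is minus the edge distance.\<close>

definition slow :: "(nat set set \<Rightarrow> real) \<Rightarrow> bool" where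
  "slow f \<longleftrightarrow> mono f \<and> (\<forall>e E. f (insert e E) \<le> f E + 1)"

lemma opt_step_eq:
  assumes "n \<ge> 1"
  shows "opt_step n f E = (\<Sum>u\<in>{1..n}. MAX v\<in>{1..n}. f (insert {u, v} E)) / real n"
  using assms by (simp add: lazy_step_def)

lemma mono_insert_le: "mono f \<Longrightarrow> f E \<le> f (insert e E)"
  by (auto elim: monoD)

lemma Max_image_le:
  fixes g :: "nat \<Rightarrow> real"
  assumes "n \<ge> 1" "\<And>v. v \<in> {1..n} \<Longrightarrow> g v \<le> c"
  shows "(MAX v\<in>{1..n}. g v) \<le> c"
  using assms by (subst Max_le_iff) auto

lemma Max_image_ge:
  fixes g :: "nat \<Rightarrow> real"
  assumes "v \<in> {1..n}" "c \<le> g v"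
  shows "c \<le> (MAX v\<in>{1..n}. g v)"
  using assms by (meson Max_ge dual_order.trans finite_atLeastAtMost finite_imageI imageI)

context
  fixes \<rho> :: real and n :: nat
  assumes n1: "n \<ge> 1" and rate0: "0 \<le> \<rho>" and rate1: "\<rho> * real n \<le> 1"
begin

lemma lazy_step_mono:
  assumes "\<And>E. f E \<le> g E"
  shows "lazy_step \<rho> n f E \<le> lazy_step \<rho> n g E"
  unfolding lazy_step_def
proof (intro add_mono mult_left_mono sum_mono)
  fix u
  show "(MAX v\<in>{1..n}. f (insert {u, v} E)) \<le> (MAX v\<in>{1..n}. g (insert {u, v} E))"
    by (rule Max_image_le[OF n1], rule Max_image_ge, assumption, rule assms)
qed (use assms rate0 rate1 in auto)

text \<open>One good reply per square suffices, so a concrete strategy enters as the witness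
  \<open>v\<close> for each \<open>u\<close>.\<close>

lemma lazy_step_ge:
  assumes "c \<le> f E" "\<And>u. u \<in> {1..n} \<Longrightarrow> \<exists>v\<in>{1..n}. g u \<le> f (insert {u, v} E)"
  shows "(1 - \<rho> * real n) * c + \<rho> * (\<Sum>u\<in>{1..n}. g u) \<le> lazy_step \<rho> n f E"
  unfolding lazy_step_def
proof (intro add_mono mult_left_mono sum_mono)
  fix u assume "u \<in> {1..n}"
  then show "g u \<le> (MAX v\<in>{1..n}. f (insert {u, v} E))"
    using assms(2) by (meson Max_image_ge)
qed (use assms rate0 rate1 in auto)

lemma lazy_step_le:
  assumes "f E \<le> c" "\<And>u v. u \<in> {1..n} \<Longrightarrow> v \<in> {1..n} \<Longrightarrow> f (insert {u, v} E) \<le> g u"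
  shows "lazy_step \<rho> n f E \<le> (1 - \<rho> * real n) * c + \<rho> * (\<Sum>u\<in>{1..n}. g u)"
  unfolding lazy_step_def
  using assms rate0 rate1 n1
  by (intro add_mono mult_left_mono sum_mono Max_image_le) auto

lemma lazy_step_affine:
  assumes "c \<ge> 0"
  shows "lazy_step \<rho> n (\<lambda>E. c * f E + d) E = c * lazy_step \<rho> n f E + d"
proof -
  have *: "(MAX v\<in>{1..n}. c * f (insert {u, v} E) + d) =
        c * (MAX v\<in>{1..n}. f (insert {u, v} E)) + d" for u
  proof (rule antisym)
    show "(MAX v\<in>{1..n}. c * f (insert {u, v} E) + d) \<le>
        c * (MAX v\<in>{1..n}. f (insert {u, v} E)) + d"
      using n1 assms by (intro Max_image_le add_right_mono mult_left_mono)
          (auto intro: Max_image_ge[OF _ order_refl])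
    have "(MAX v\<in>{1..n}. f (insert {u, v} E)) \<in> (\<lambda>v. f (insert {u, v} E)) ` {1..n}"
      using n1 by (intro Max_in) auto
    then obtain v where v: "v \<in> {1..n}" "(MAX v\<in>{1..n}. f (insert {u, v} E)) = f (insert {u, v} E)"
      by auto
    then show "c * (MAX v\<in>{1..n}. f (insert {u, v} E)) + d \<le>
        (MAX v\<in>{1..n}. c * f (insert {u, v} E) + d)"
      by (intro Max_image_ge[of v]) auto
  qed
  show ?thesis
    unfolding lazy_step_def * by (simp add: algebra_simps sum.distrib sum_distrib_left)
qed

lemma lazy_iter_mono:
  assumes "\<And>E. f E \<le> g E"
  shows "(lazy_step \<rho> n ^^ t) f E \<le> (lazy_step \<rho> n ^^ t) g E"
  by (induction t arbitrary: E) (auto intro: assms lazy_step_mono)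

lemma lazy_iter_affine:
  assumes "c \<ge> 0"
  shows "(lazy_step \<rho> n ^^ t) (\<lambda>E. c * f E + d) E = c * (lazy_step \<rho> n ^^ t) f E + d"
proof (induction t arbitrary: E)
  case (Suc t)
  have "(lazy_step \<rho> n ^^ Suc t) (\<lambda>E. c * f E + d) E
      = lazy_step \<rho> n (\<lambda>E. c * (lazy_step \<rho> n ^^ t) f E + d) E"
    by (simp add: Suc.IH[abs_def])
  then show ?case
    using lazy_step_affine[OF assms] by simp
qed simp

lemma mono_lazy_step:
  assumes "mono f"
  shows "mono (lazy_step \<rho> n f)"
proof (rule monoI)
  fix E E' :: "nat set set" assume "E \<subseteq> E'"
  then have le: "f E \<le> f E'" "f (insert e E) \<le> f (insert e E')" for e
    using assms by (blast intro: monoD insert_mono)+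
  show "lazy_step \<rho> n f E \<le> lazy_step \<rho> n f E'"
    unfolding lazy_step_def[of \<rho> n f E']
  proof (rule lazy_step_le)
    show "f E \<le> f E'" by (rule le(1))
    fix u v assume "v \<in> {1..n}"
    then show "f (insert {u, v} E) \<le> (MAX v\<in>{1..n}. f (insert {u, v} E'))"
      using le(2) by (rule Max_image_ge)
  qed
qed

lemma mono_lazy_iter: "mono f \<Longrightarrow> mono ((lazy_step \<rho> n ^^ t) f)"
  by (induction t) (auto intro: mono_lazy_step)

lemma lazy_step_increasing:
  assumes "mono f"
  shows "f E \<le> lazy_step \<rho> n f E"
proof -
  have "(1 - \<rho> * real n) * f E + \<rho> * (\<Sum>u\<in>{1..n}. f E) \<le> lazy_step \<rho> n f E"
    using n1 by (intro lazy_step_ge) (auto intro!: bexI[of _ 1] mono_insert_le assms)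
  then show ?thesis by (simp add: algebra_simps)
qed

lemma lazy_iter_increasing:
  assumes "mono f" "s \<le> t"
  shows "(lazy_step \<rho> n ^^ s) f E \<le> (lazy_step \<rho> n ^^ t) f E"
  using assms(2)
proof (induction rule: dec_induct)
  case (step m)
  then show ?case
    using lazy_step_increasing[OF mono_lazy_iter[OF assms(1)], of m E] by simp
qed simp

lemma slow_lazy_step:
  assumes "slow f"
  shows "slow (lazy_step \<rho> n f)"
  unfolding slow_def
proof (intro conjI allI)
  show "mono (lazy_step \<rho> n f)"
    using assms by (simp add: slow_def mono_lazy_step)
  fix e E
  have "lazy_step \<rho> n f (insert e E) \<le> lazy_step \<rho> n (\<lambda>E. 1 * f E + 1) E"
    unfolding lazy_step_def[of \<rho> n "\<lambda>E. 1 * f E + 1"]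
  proof (intro lazy_step_le)
    show "f (insert e E) \<le> 1 * f E + 1" using assms by (simp add: slow_def)
    fix u v assume "v \<in> {1..n}"
    moreover have "f (insert {u, v} (insert e E)) \<le> f (insert {u, v} E) + 1"
      using assms by (simp add: slow_def insert_commute)
    ultimately show "f (insert {u, v} (insert e E)) \<le> (MAX v\<in>{1..n}. 1 * f (insert {u, v} E) + 1)"
      by (intro Max_image_ge[of v]) auto
  qed
  then show "lazy_step \<rho> n f (insert e E) \<le> lazy_step \<rho> n f E + 1"
    using lazy_step_affine[of 1 f 1 E] by simp
qed

lemma slow_lazy_iter: "slow f \<Longrightarrow> slow ((lazy_step \<rho> n ^^ t) f)"
  by (induction t) (auto intro: slow_lazy_step)

lemma lazy_step_slow_le:
  assumes "slow f"
  shows "lazy_step \<rho> n f E \<le> f E + 1"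
proof -
  have "lazy_step \<rho> n f E \<le> (1 - \<rho> * real n) * (f E + 1) + \<rho> * (\<Sum>u\<in>{1..n}. f E + 1)"
    using assms by (intro lazy_step_le) (auto simp: slow_def)
  then show ?thesis by (simp add: algebra_simps)
qed

lemma lazy_iter_slow_le:
  assumes "slow f"
  shows "(lazy_step \<rho> n ^^ t) f E \<le> f E + real t"
proof (induction t)
  case (Suc t)
  then show ?case
    using lazy_step_slow_le[OF slow_lazy_iter[OF assms], of t E] by simp
qed simp

end

lemma opt_rate: "n \<ge> 1 \<Longrightarrow> 0 \<le> 1 / real n" "n \<ge> 1 \<Longrightarrow> 1 / real n * real n \<le> 1"
  by auto

section \<open>Second moments under the optimal step\<close>

text \<open>The derivative 2 max 0 x of x -> (max 0 x)^2 is Lipschitz with constant 2; this is the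
  second-order expansion at \<open>a\<close>.\<close>

lemma pos_part_square_le:
  fixes a b :: real
  shows "(max 0 b)\<^sup>2 \<le> (max 0 a)\<^sup>2 + 2 * max 0 a * (b - a) + (b - a)\<^sup>2"
proof (cases "a \<ge> 0")
  case True
  have "(max 0 b)\<^sup>2 \<le> b\<^sup>2" by (auto simp: max_def)
  also have "\<dots> = a\<^sup>2 + 2 * a * (b - a) + (b - a)\<^sup>2" by (simp add: power2_eq_square algebra_simps)
  finally show ?thesis using True by (simp add: max_def)
next
  case False
  then have "(max 0 b)\<^sup>2 \<le> (b - a)\<^sup>2"
    by (cases "b \<ge> 0") (auto simp: max_def intro!: power_mono)
  then show ?thesis using False by (simp add: max_def)
qed

lemma sum_about_mean:
  fixes M :: "nat \<Rightarrow> real"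
  assumes "n \<ge> 1"
  shows "(\<Sum>u\<in>{1..n}. A + K * (M u - sum M {1..n} / real n) + 1) = real n * (A + 1)"
proof -
  define m where "m = sum M {1..n} / real n"
  have "(\<Sum>u\<in>{1..n}. A + K * (M u - m) + 1) = (\<Sum>u\<in>{1..n}. (A + 1 - K * m) + K * M u)"
    by (intro sum.cong refl) (simp add: algebra_simps)
  also have "\<dots> = real n * (A + 1 - K * m) + K * sum M {1..n}"
    unfolding sum.distrib sum_distrib_left[symmetric] by simp
  also have "sum M {1..n} = real n * m" using assms by (simp add: m_def)
  finally show ?thesis unfolding m_def by (simp add: right_diff_distrib)
qed

text \<open>The best values, one per square, all lie in [f E, f E + 1], and so does their mean;
  expanding about the mean cancels the linear term, and the quadratic one is at most 1. Since the
  squared positive part is nondecreasing, a reply that is best for \<open>f\<close> is also best for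
  it.\<close>

lemma opt_step_pos_part_square:
  assumes n1: "n \<ge> 1" and f: "slow f"
  shows "opt_step n (\<lambda>E. (max 0 (f E + c))\<^sup>2) E \<le> (max 0 (opt_step n f E + c))\<^sup>2 + 1"
proof -
  define M where "M u = (MAX v\<in>{1..n}. f (insert {u, v} E))" for u
  define m where "m = opt_step n f E"
  have m: "m = (\<Sum>u\<in>{1..n}. M u) / real n"
    unfolding m_def M_def using n1 by (rule opt_step_eq)
  have M: "f E \<le> M u" "M u \<le> f E + 1" for u
  proof -
    show "f E \<le> M u"
      unfolding M_def using f n1 by (intro Max_image_ge[of 1] mono_insert_le) (auto simp: slow_def)
    show "M u \<le> f E + 1"
      unfolding M_def using f n1 by (intro Max_image_le) (auto simp: slow_def)
  qed
  have mle: "f E \<le> m" "m \<le> f E + 1"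
    unfolding m_def using f lazy_step_increasing[OF n1 opt_rate[OF n1]]
      lazy_step_slow_le[OF n1 opt_rate[OF n1]] by (auto simp: slow_def)
  have "opt_step n (\<lambda>E. (max 0 (f E + c))\<^sup>2) E \<le>
      (1 - 1 / real n * real n) * (max 0 (f E + c))\<^sup>2 + 1 / real n * (\<Sum>u\<in>{1..n}. (max 0 (M u + c))\<^sup>2)"
  proof (intro lazy_step_le[OF n1 opt_rate[OF n1]])
    fix u v assume "v \<in> {1..n}"
    then have "f (insert {u, v} E) \<le> M u" unfolding M_def by (rule Max_image_ge) simp
    then show "(max 0 (f (insert {u, v} E) + c))\<^sup>2 \<le> (max 0 (M u + c))\<^sup>2"
      by (intro power_mono) auto
  qed simp
  also have "\<dots> = 1 / real n * (\<Sum>u\<in>{1..n}. (max 0 (M u + c))\<^sup>2)" using n1 by simp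
  also have "\<dots> \<le> 1 / real n * (\<Sum>u\<in>{1..n}. (max 0 (m + c))\<^sup>2 + 2 * max 0 (m + c) * (M u - m) + 1)"
  proof (intro mult_left_mono sum_mono)
    fix u
    have "\<bar>M u - m\<bar> \<le> 1" using M[of u] mle by linarith
    then have "(M u - m)\<^sup>2 \<le> 1" by (simp add: abs_square_le_1)
    then show "(max 0 (M u + c))\<^sup>2 \<le> (max 0 (m + c))\<^sup>2 + 2 * max 0 (m + c) * (M u - m) + 1"
      using pos_part_square_le[of "M u + c" "m + c"] by simp
  qed simp
  also have "\<dots> = (max 0 (m + c))\<^sup>2 + 1"
  proof -
    have "(\<Sum>u\<in>{1..n}. (max 0 (m + c))\<^sup>2 + 2 * max 0 (m + c) * (M u - m) + 1) =
        real n * ((max 0 (m + c))\<^sup>2 + 1)"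
      unfolding m by (rule sum_about_mean[OF n1])
    then show ?thesis using n1 by (simp only:) (simp only: times_divide_eq_left mult_1 nonzero_mult_div_cancel_left of_nat_eq_0_iff not_one_le_zero)
  qed
  finally show ?thesis unfolding m_def .
qed

text \<open>On the left the player optimizes the second moment itself, while the right side contains
  only the optimal mean. Hence the bound holds for a strategy chosen with any other goal.\<close>

lemma opt_iter_pos_part_square:
  assumes n1: "n \<ge> 1" and f: "slow f"
  shows "(opt_step n ^^ t) (\<lambda>E. (max 0 (f E + c))\<^sup>2) E \<le> (max 0 ((opt_step n ^^ t) f E + c))\<^sup>2 + real t"
proof (induction t arbitrary: E)
  case (Suc t)
  note rate = n1 opt_rate[OF n1]
  let ?g = "(opt_step n ^^ t) f"
  have "(opt_step n ^^ Suc t) (\<lambda>E. (max 0 (f E + c))\<^sup>2) E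
      \<le> opt_step n (\<lambda>E. 1 * (max 0 (?g E + c))\<^sup>2 + real t) E"
    unfolding funpow.simps comp_def
  proof (rule lazy_step_mono[OF rate])
    fix E show "(opt_step n ^^ t) (\<lambda>E. (max 0 (f E + c))\<^sup>2) E \<le> 1 * (max 0 (?g E + c))\<^sup>2 + real t"
      unfolding mult_1 by (rule Suc.IH)
  qed
  also have "\<dots> = opt_step n (\<lambda>E. (max 0 (?g E + c))\<^sup>2) E + real t"
    by (subst lazy_step_affine[OF rate, of 1 "\<lambda>E. (max 0 (?g E + c))\<^sup>2"]) simp_all
  also have "\<dots> \<le> (max 0 (opt_step n ?g E + c))\<^sup>2 + real (Suc t)"
    using opt_step_pos_part_square[OF n1 slow_lazy_iter[OF rate f], of t c E]
    by (simp only: of_nat_Suc)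
  finally show ?case by (simp only: funpow.simps comp_def)
qed simp

text \<open>Comparison of a process of rate \<open>p\<close> run for \<open>t\<close> steps with \<open>m\<close> full steps: \<open>(m - t * p)\<^sup>2 + t * p * (1 - p)\<close> is
  the second moment of \<open>m - X\<close> for a binomial variable \<open>X\<close>.\<close>
lemma lazy_iter_ge_opt_iter:
  assumes n1: "n \<ge> 1" and rate0: "0 \<le> \<rho>" and rate1: "\<rho> * real n \<le> 1" and f: "slow f" and y: "y > 0"
  shows "(opt_step n ^^ m) f E - (((real m - real t * (\<rho> * real n))\<^sup>2
       + real t * (\<rho> * real n) * (1 - \<rho> * real n)) / (2 * y) + y / 2)
    \<le> (lazy_step \<rho> n ^^ t) f E"
proof (induction t arbitrary: m E)
  case 0
  have "(opt_step n ^^ m) f E \<le> f E + real m"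
    by (rule lazy_iter_slow_le[OF n1 opt_rate[OF n1] f])
  moreover have "real m \<le> (real m)\<^sup>2 / (2 * y) + y / 2"
    using y zero_le_power2[of "real m - y"] by (simp add: field_simps power2_eq_square)
  ultimately show ?case by simp
next
  case (Suc t)
  define p where "p = \<rho> * real n"
  have p: "0 \<le> p" "p \<le> 1" using rate0 rate1 by (auto simp: p_def)
  note rate = n1 rate0 rate1
  \<comment> \<open>\<open>G m s\<close> bounds the mean of |m - X|, X binomial with
    \<open>s\<close> trials, by AM-GM through the second moment; conditioning on one trial gives
    \<open>Grec\<close>. Here \<open>m\<close> is real, so \<open>m - 1\<close> is not truncated at
    0.\<close>
  define G where "G m s = ((m - real s * p)\<^sup>2 + real s * p * (1 - p)) / (2 * y) + y / 2" for m s
  have Grec: "G m (Suc s) = (1 - p) * G m s + p * G (m - 1) s" for m s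
  proof -
    define N where "N m s = (m - real s * p)\<^sup>2 + real s * p * (1 - p)" for m s
    have "N m (Suc s) = (1 - p) * N m s + p * N (m - 1) s"
      unfolding N_def by (simp add: algebra_simps power2_eq_square)
    moreover have "a * c + h = (1 - p) * (a' * c + h) + p * (b * c + h)"
      if "a = (1 - p) * a' + p * b" for a a' b c h :: real
      unfolding that by (simp add: algebra_simps)
    moreover have "G m s = N m s * (1 / (2 * y)) + y / 2" for m s by (simp add: G_def N_def)
    ultimately show ?thesis by metis
  qed
  have Gpos: "G m s \<ge> 0" for m s
    unfolding G_def using y p by auto
  have IH: "(opt_step n ^^ m) f E - G (real m) t \<le> (lazy_step \<rho> n ^^ t) f E" for m E
    using Suc.IH[of m E] by (simp add: G_def p_def)
  let ?g = "(lazy_step \<rho> n ^^ t) f"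
  have split: "lazy_step \<rho> n h E = (1 - p) * h E + p * opt_step n h E" for h
    unfolding opt_step_eq[OF n1] using n1 by (simp add: lazy_step_def p_def)
  have "(opt_step n ^^ m) f E - G (real m) (Suc t) \<le> lazy_step \<rho> n ?g E"
  proof (cases m)
    case 0
    have "f E \<le> (lazy_step \<rho> n ^^ Suc t) f E"
      using lazy_iter_increasing[OF rate, of f 0 "Suc t" E] f by (simp add: slow_def)
    then show ?thesis using 0 Gpos[of 0 "Suc t"] by simp
  next
    case (Suc k)
    have "opt_step n (\<lambda>E. 1 * (opt_step n ^^ k) f E + (- G (real k) t)) E \<le> opt_step n ?g E"
    proof (rule lazy_step_mono[OF n1 opt_rate[OF n1]])
      fix E show "1 * (opt_step n ^^ k) f E + (- G (real k) t) \<le> ?g E" using IH[of k E] by simp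
    qed
    then have "(opt_step n ^^ m) f E - G (real k) t \<le> opt_step n ?g E"
      using lazy_step_affine[OF n1 opt_rate[OF n1], of 1 "(opt_step n ^^ k) f" "- G (real k) t" E] Suc
      by simp
    then have "p * ((opt_step n ^^ m) f E - G (real k) t) + (1 - p) * ((opt_step n ^^ m) f E - G (real m) t)
        \<le> p * opt_step n ?g E + (1 - p) * ?g E"
      using p IH[of m E] by (intro add_mono mult_left_mono) auto
    then show ?thesis
      unfolding split Grec using Suc by (simp add: algebra_simps)
  qed
  then show ?case by (simp add: G_def p_def)
qed

section \<open>Repairing a graph\<close>

lemma opt_step_ge:
  assumes n1: "n \<ge> 1" and g: "\<And>u. u \<in> {1..n} \<Longrightarrow> \<exists>v\<in>{1..n}. g u \<le> f (insert {u, v} E)"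
  shows "(\<Sum>u\<in>{1..n}. g u) / real n \<le> opt_step n f E"
  using lazy_step_ge[OF n1 opt_rate[OF n1] order_refl g] n1 by simp

text \<open>\<open>K i\<close> is the set of slots already joined to \<open>x i\<close>; gadget \<open>i\<close> is completed by the first square hitting the second
  component of one of them.\<close>
lemma opt_iter_hits:
  fixes R :: "nat set set \<Rightarrow> real"
  assumes n1: "n \<ge> 1" and R: "mono R" and \<gamma>: "\<gamma> \<ge> 0"
    and y: "\<And>i. i < k \<Longrightarrow> y i \<in> {1..n}"
    and S: "S \<subseteq> {1..n} \<times> {1..n}" "inj_on snd S"
    and K: "\<And>i. i < k \<Longrightarrow> K i \<subseteq> S" "disjoint_family_on K {..<k}"
    and hits: "\<And>I \<sigma>. I \<subseteq> {..<k} \<Longrightarrow> (\<And>i. i \<in> I \<Longrightarrow> \<sigma> i \<in> K i) \<Longrightarrow>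
       A - \<gamma> * (real k - real (card I)) \<le> R (E \<union> (\<lambda>i. {y i, snd (\<sigma> i)}) ` I)"
    and I: "I \<subseteq> {..<k}" "\<And>i. i \<in> I \<Longrightarrow> \<sigma> i \<in> K i"
  shows "A - \<gamma> * (\<Sum>i\<in>{..<k} - I. (1 - real (card (K i)) / real n) ^ r)
    \<le> (opt_step n ^^ r) R (E \<union> (\<lambda>i. {y i, snd (\<sigma> i)}) ` I)"
  using I
proof (induction r arbitrary: I \<sigma>)
  case 0
  have "finite I" using 0(1) finite_subset by blast
  then have "real (card ({..<k} - I)) = real k - real (card I)"
    using 0(1) card_mono[OF _ 0(1)] by (simp add: card_Diff_subset of_nat_diff)
  then show ?case using hits[OF 0] by simp
next
  case (Suc r)
  define f where "f = (opt_step n ^^ r) R"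
  define J where "J = {..<k} - I"
  define q where "q i = 1 - real (card (K i)) / real n" for i
  define G where "G = E \<union> (\<lambda>i. {y i, snd (\<sigma> i)}) ` I"
  \<comment> \<open>The saving due to the square \<open>u\<close>: the chance \<open>q i ^ r\<close>
    that the gadget which it completes would otherwise stay incomplete.\<close>
  define a where "a u = (\<Sum>i\<in>J. if u \<in> snd ` K i then q i ^ r else 0)" for u
  have f: "mono f" unfolding f_def by (rule mono_lazy_iter[OF n1 opt_rate[OF n1] R])
  have finJ: "finite J" by (simp add: J_def)
  have "\<exists>v\<in>{1..n}. A - \<gamma> * (\<Sum>i\<in>J. q i ^ r) + \<gamma> * a u \<le> f (insert {u, v} G)" if "u \<in> {1..n}" for u
  proof (cases "\<exists>i\<in>J. u \<in> snd ` K i")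
    case True
    then obtain i p where i: "i \<in> J" "p \<in> K i" "u = snd p" by auto
    \<comment> \<open>No square serves two gadgets: \<open>snd\<close> is injective on
      \<open>S\<close>, and the sets \<open>K i\<close> are disjoint.\<close>
    have "u \<notin> snd ` K j" if "j \<in> J" "j \<noteq> i" for j
    proof
      assume "u \<in> snd ` K j"
      then obtain p' where p': "p' \<in> K j" "snd p' = snd p" using i(3) by auto
      moreover have "p \<in> S" "p' \<in> S" using i p'(1) K(1) that(1) unfolding J_def by blast+
      ultimately have "p' = p" using S(2) by (auto dest: inj_onD)
      then show False
        using K(2) that i p'(1) unfolding disjoint_family_on_def J_def by blast
    qed
    then have "a u = (\<Sum>j\<in>J. if j = i then q i ^ r else 0)"
      unfolding a_def using i by (intro sum.cong) auto
    then have a: "a u = q i ^ r" using i(1) finJ by simp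
    define \<sigma>' where "\<sigma>' = \<sigma>(i := p)"
    have "i \<notin> I" using i(1) by (simp add: J_def)
    then have img: "(\<lambda>j. {y j, snd (\<sigma>' j)}) ` insert i I = insert {u, y i} ((\<lambda>j. {y j, snd (\<sigma> j)}) ` I)"
      using i(3) by (auto simp: \<sigma>'_def image_iff)
    have "A - \<gamma> * (\<Sum>j\<in>{..<k} - insert i I. q j ^ r) \<le> f (E \<union> (\<lambda>j. {y j, snd (\<sigma>' j)}) ` insert i I)"
      unfolding f_def q_def
      using i Suc.prems by (intro Suc.IH) (auto simp: J_def \<sigma>'_def)
    moreover have "(\<Sum>j\<in>{..<k} - insert i I. q j ^ r) = (\<Sum>j\<in>J. q j ^ r) - q i ^ r"
    proof -
      have "{..<k} - insert i I = J - {i}" by (auto simp: J_def)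
      then show ?thesis using i(1) finJ by (simp add: sum_diff1)
    qed
    ultimately have "A - \<gamma> * (\<Sum>i\<in>J. q i ^ r) + \<gamma> * a u \<le> f (insert {u, y i} G)"
      unfolding img a G_def by (simp add: algebra_simps)
    moreover have "y i \<in> {1..n}" using i(1) y by (simp add: J_def)
    ultimately show ?thesis by blast
  next
    case False
    then have "a u = 0" unfolding a_def by (intro sum.neutral) auto
    moreover have "A - \<gamma> * (\<Sum>i\<in>J. q i ^ r) \<le> f G"
      unfolding f_def q_def J_def G_def by (intro Suc.IH Suc.prems)
    moreover have "f G \<le> f (insert {u, 1} G)" by (rule mono_insert_le[OF f])
    ultimately show ?thesis using n1 by (intro bexI[of _ 1]) auto
  qed
  then have "(\<Sum>u\<in>{1..n}. A - \<gamma> * (\<Sum>i\<in>J. q i ^ r) + \<gamma> * a u) / real n \<le> opt_step n f G"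
    by (rule opt_step_ge[OF n1])
  moreover have "(\<Sum>u\<in>{1..n}. a u) = (\<Sum>i\<in>J. real (card (K i)) * q i ^ r)"
  proof -
    have "(\<Sum>u\<in>{1..n}. a u) = (\<Sum>i\<in>J. \<Sum>u\<in>{1..n}. if u \<in> snd ` K i then q i ^ r else 0)"
      unfolding a_def by (rule sum.swap)
    also have "\<dots> = (\<Sum>i\<in>J. real (card (K i)) * q i ^ r)"
    proof (intro sum.cong refl)
      fix i assume "i \<in> J"
      then have Ki: "K i \<subseteq> S" using K(1) by (simp add: J_def)
      then have "snd ` K i \<subseteq> {1..n}" using S(1) by auto
      then have "(\<Sum>u\<in>{1..n}. if u \<in> snd ` K i then q i ^ r else 0) = real (card (snd ` K i)) * q i ^ r"
        by (simp add: sum.If_cases Int_absorb1)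
      also have "card (snd ` K i) = card (K i)"
        using inj_on_subset[OF S(2) Ki] by (rule card_image)
      finally show "(\<Sum>u\<in>{1..n}. if u \<in> snd ` K i then q i ^ r else 0) = real (card (K i)) * q i ^ r"
        by simp
    qed
    finally show ?thesis .
  qed
  ultimately have "(real n * (A - \<gamma> * (\<Sum>i\<in>J. q i ^ r)) + \<gamma> * (\<Sum>i\<in>J. real (card (K i)) * q i ^ r)) / real n
      \<le> opt_step n f G"
    unfolding sum.distrib sum_distrib_left[symmetric] by simp
  moreover have "(real n * (A - \<gamma> * (\<Sum>i\<in>J. q i ^ r)) + \<gamma> * (\<Sum>i\<in>J. real (card (K i)) * q i ^ r)) / real n
      = A - \<gamma> * (\<Sum>i\<in>J. q i ^ Suc r)"
  proof -
    have "(\<Sum>i\<in>J. q i ^ Suc r) = (\<Sum>i\<in>J. q i ^ r - (real (card (K i)) * q i ^ r) / real n)"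
      by (intro sum.cong refl) (simp add: q_def[symmetric] algebra_simps, simp add: q_def algebra_simps)
    also have "\<dots> = (\<Sum>i\<in>J. q i ^ r) - (\<Sum>i\<in>J. real (card (K i)) * q i ^ r) / real n"
      by (simp add: sum_subtractf sum_divide_distrib)
    finally have eq: "(\<Sum>i\<in>J. q i ^ Suc r) =
      (\<Sum>i\<in>J. q i ^ r) - (\<Sum>i\<in>J. real (card (K i)) * q i ^ r) / real n" .
    show ?thesis unfolding eq using n1 by (simp add: field_simps)
  qed
  ultimately show ?case by (simp add: f_def J_def q_def G_def)
qed

text \<open>A square in an unused slot is joined to the gadget with the largest term of the potential \<open>\<Sum>i<k. q ^ card (K i)\<close>,
  which therefore decreases by at least the fraction \<open>(1 - q) / k\<close>.\<close>
lemma opt_iter_marks: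
  fixes Q :: "nat set set \<Rightarrow> real"
  assumes n1: "n \<ge> 1" and Q: "mono Q" and \<gamma>: "\<gamma> \<ge> 0" and k: "k \<ge> 1"
    and x: "\<And>i. i < k \<Longrightarrow> x i \<in> {1..n}"
    and S: "S \<subseteq> {1..n} \<times> {1..n}" "inj_on fst S" and q: "0 \<le> q" "q \<le> 1"
    and M: "M \<le> card S"
    and marks: "\<And>K. (\<And>i. i < k \<Longrightarrow> K i \<subseteq> S) \<Longrightarrow> disjoint_family_on K {..<k} \<Longrightarrow>
       A - \<gamma> * (\<Sum>i<k. q ^ card (K i)) \<le> Q (E \<union> (\<Union>i<k. (\<lambda>p. {x i, fst p}) ` K i))"
    and K: "\<And>i. i < k \<Longrightarrow> K i \<subseteq> S" "disjoint_family_on K {..<k}" "(\<Sum>i<k. card (K i)) + r \<le> M"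
  shows "A - \<gamma> * ((1 - (1 - q) * (real (card S) - real M) / (real n * real k)) ^ r * (\<Sum>i<k. q ^ card (K i)))
    \<le> (opt_step n ^^ r) Q (E \<union> (\<Union>i<k. (\<lambda>p. {x i, fst p}) ` K i))"
  using K
proof (induction r arbitrary: K)
  case 0
  then show ?case using marks[of K] by simp
next
  case (Suc r)
  define f where "f = (opt_step n ^^ r) Q"
  define \<theta> where "\<theta> = 1 - (1 - q) * (real (card S) - real M) / (real n * real k)"
  define \<Phi> where "\<Phi> = (\<Sum>i<k. q ^ card (K i))"
  define G where "G = E \<union> (\<Union>i<k. (\<lambda>p. {x i, fst p}) ` K i)"
  define T where "T = S - (\<Union>i<k. K i)"
  define c where "c = \<gamma> * \<theta> ^ r * ((1 - q) * \<Phi> / real k)"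
  have finS: "finite S" using S(1) finite_subset by fastforce
  have f: "mono f" unfolding f_def by (rule mono_lazy_iter[OF n1 opt_rate[OF n1] Q])
  have cardS: "card S \<le> n"
    using card_inj_on_le[OF S(2), of "{1..n}"] S(1) by force
  have "(1 - q) * (real (card S) - real M) \<le> 1 * (real n * 1)"
    using q M cardS by (intro mult_mono) auto
  also have "\<dots> \<le> 1 * (real n * real k)" using k by (intro mult_left_mono) auto
  finally have \<theta>: "\<theta> \<ge> 0" unfolding \<theta>_def using n1 k by (simp add: field_simps)
  have \<Phi>: "\<Phi> \<ge> 0" unfolding \<Phi>_def using q by (intro sum_nonneg) auto
  have c: "c \<ge> 0" unfolding c_def using \<gamma> \<theta> \<Phi> q by simp
  \<comment> \<open>At most \<open>M\<close> slots are ever marked, so \<open>card S - M\<close> of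
    them stay available throughout.\<close>
  have cardT: "real (card T) \<ge> real (card S) - real M"
  proof -
    have "card (\<Union>i<k. K i) \<le> (\<Sum>i<k. card (K i))" by (rule card_UN_le) simp
    moreover have "card S - card (\<Union>i<k. K i) \<le> card T"
      unfolding T_def using Suc.prems(1) finS by (intro diff_card_le_card_Diff) (meson finite_UN_I finite_lessThan finite_subset lessThan_iff)
    ultimately show ?thesis using Suc.prems(3) by linarith
  qed
  have base: "A - \<gamma> * (\<theta> ^ r * \<Phi>) \<le> f G"
    unfolding f_def \<theta>_def \<Phi>_def G_def using Suc.prems by (intro Suc.IH) auto
  have "\<exists>v\<in>{1..n}. A - \<gamma> * (\<theta> ^ r * \<Phi>) + (if u \<in> fst ` T then c else 0) \<le> f (insert {u, v} G)"
    if "u \<in> {1..n}" for u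
  proof (cases "u \<in> fst ` T")
    case True
    then obtain p where p: "p \<in> T" "u = fst p" by auto
    \<comment> \<open>Some term is at least the average; since q <= 1, gadgets with few marks are
      favoured.\<close>
    have "\<exists>i<k. \<Phi> / real k \<le> q ^ card (K i)"
    proof (rule ccontr)
      assume "\<not> ?thesis"
      then have False
      proof -
        have "(\<Sum>i<k. q ^ card (K i)) < (\<Sum>i<k. \<Phi> / real k)"
          using k \<open>\<not> _\<close> by (intro sum_strict_mono) (auto simp: not_le lessThan_empty_iff)
        then have "\<Phi> < (\<Sum>i<k. \<Phi> / real k)" unfolding \<Phi>_def[symmetric] .
        then show ?thesis using k by simp
      qed
      then show False .
    qed
    then obtain i where i: "i < k" "\<Phi> / real k \<le> q ^ card (K i)" by auto
    define K' where "K' = K(i := insert p (K i))"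
    have pn: "p \<in> S" "p \<notin> K j" if "j < k" for j using p(1) that by (auto simp: T_def)
    have fin: "finite (K i)" using Suc.prems(1)[OF i(1)] finS finite_subset by blast
    have card': "card (K' j) = card (K j) + (if j = i then 1 else 0)" for j
      using fin pn(2)[OF i(1)] by (simp add: K'_def)
    have "A - \<gamma> * (\<theta> ^ r * (\<Sum>j<k. q ^ card (K' j))) \<le> f (E \<union> (\<Union>j<k. (\<lambda>p. {x j, fst p}) ` K' j))"
      unfolding f_def \<theta>_def
    proof (rule Suc.IH)
      show "K' j \<subseteq> S" if "j < k" for j
        using Suc.prems(1)[OF that] pn(1)[OF that] by (auto simp: K'_def)
      show "disjoint_family_on K' {..<k}"
        using Suc.prems(2) pn(2) unfolding disjoint_family_on_def K'_def by auto
      show "(\<Sum>j<k. card (K' j)) + r \<le> M"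
        using Suc.prems(3) i(1) by (simp add: card' sum.distrib)
    qed
    moreover have "(\<Union>j<k. (\<lambda>p. {x j, fst p}) ` K' j)
        = insert {u, x i} (\<Union>j<k. (\<lambda>p. {x j, fst p}) ` K j)"
    proof -
      have "(\<Union>j<k. (\<lambda>p. {x j, fst p}) ` K' j)
        = (\<Union>j<k. (\<lambda>p. {x j, fst p}) ` K j \<union> (if j = i then {{u, x i}} else {}))"
        using p(2) by (intro SUP_cong refl) (auto simp: K'_def)
      also have "\<dots> = insert {u, x i} (\<Union>j<k. (\<lambda>p. {x j, fst p}) ` K j)"
        using i(1) by (auto split: if_splits)
      finally show ?thesis .
    qed
    moreover have "\<gamma> * \<theta> ^ r * (\<Sum>j<k. q ^ card (K' j)) \<le> \<gamma> * \<theta> ^ r * (\<Phi> - (1 - q) * \<Phi> / real k)"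
    proof (rule mult_left_mono)
      have "(\<Sum>j<k. q ^ card (K' j)) = (\<Sum>j<k. q ^ card (K j) - (if j = i then (1 - q) * q ^ card (K i) else 0))"
        by (intro sum.cong refl) (auto simp: card' algebra_simps)
      also have "\<dots> = \<Phi> - (1 - q) * q ^ card (K i)"
        using i(1) by (simp add: sum_subtractf \<Phi>_def)
      also have "\<dots> \<le> \<Phi> - (1 - q) * (\<Phi> / real k)"
        using i(2) q by (intro diff_left_mono mult_left_mono) auto
      finally show "(\<Sum>j<k. q ^ card (K' j)) \<le> \<Phi> - (1 - q) * \<Phi> / real k" by simp
    qed (use \<gamma> \<theta> in simp)
    ultimately have "A - \<gamma> * (\<theta> ^ r * \<Phi>) + c \<le> f (insert {u, x i} G)"
      by (simp add: c_def G_def algebra_simps)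
    then show ?thesis using True x[OF i(1)] by auto
  next
    case False
    have "f G \<le> f (insert {u, 1} G)" by (rule mono_insert_le[OF f])
    then show ?thesis using False base n1 by (intro bexI[of _ 1]) auto
  qed
  then have le: "(\<Sum>u\<in>{1..n}. A - \<gamma> * (\<theta> ^ r * \<Phi>) + (if u \<in> fst ` T then c else 0)) / real n \<le> opt_step n f G"
    by (rule opt_step_ge[OF n1])
  have "fst ` T \<subseteq> {1..n}" using S(1) by (auto simp: T_def)
  moreover have "card (fst ` T) = card T"
    using inj_on_subset[OF S(2)] by (intro card_image) (auto simp: T_def)
  ultimately have sum: "(\<Sum>u\<in>{1..n}. A - \<gamma> * (\<theta> ^ r * \<Phi>) + (if u \<in> fst ` T then c else 0))
      = real n * (A - \<gamma> * (\<theta> ^ r * \<Phi>)) + real (card T) * c"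
    by (simp add: sum.distrib sum.If_cases Int_absorb1)
  have "A - \<gamma> * (\<theta> ^ Suc r * \<Phi>) = (real n * (A - \<gamma> * (\<theta> ^ r * \<Phi>)) + (real (card S) - real M) * c) / real n"
  proof -
    have eq: "\<theta> ^ Suc r * \<Phi> = \<theta> ^ r * \<Phi> - \<theta> ^ r * \<Phi> * ((1 - q) * (real (card S) - real M) / (real n * real k))"
      by (simp add: \<theta>_def[symmetric], simp add: \<theta>_def algebra_simps)
    show ?thesis unfolding eq c_def using n1 k by (simp add: field_simps)
  qed
  also have "\<dots> \<le> (real n * (A - \<gamma> * (\<theta> ^ r * \<Phi>)) + real (card T) * c) / real n"
    using cardT c by (intro divide_right_mono add_left_mono mult_right_mono) auto
  also have "\<dots> \<le> opt_step n f G" using le unfolding sum .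
  finally show ?case by (simp add: f_def \<theta>_def G_def \<Phi>_def)
qed

section \<open>Distance to a target family, and gadgets\<close>

definition edge_distance :: "nat set set set \<Rightarrow> nat set set \<Rightarrow> nat" where
  "edge_distance \<F> E = (INF H\<in>\<F>. card (H - E))"

definition contains_indicator :: "nat set set set \<Rightarrow> nat set set \<Rightarrow> real" where
  "contains_indicator \<F> E = (if \<exists>H\<in>\<F>. H \<subseteq> E then 1 else 0)"

lemma edge_distance_le: "H \<in> \<F> \<Longrightarrow> edge_distance \<F> E \<le> card (H - E)"
  unfolding edge_distance_def by (intro cInf_lower) auto

lemma edge_distance_attained:
  assumes "\<F> \<noteq> {}"
  obtains H where "H \<in> \<F>" "edge_distance \<F> E = card (H - E)"
proof -
  have "edge_distance \<F> E \<in> (\<lambda>H. card (H - E)) ` \<F>"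
    unfolding edge_distance_def using assms by (intro Inf_nat_def1) auto
  then show thesis using that by auto
qed

lemma contains_indicator_eq:
  assumes "\<F> \<noteq> {}" "\<And>H. H \<in> \<F> \<Longrightarrow> finite H"
  shows "contains_indicator \<F> E = (if edge_distance \<F> E = 0 then 1 else 0)"
proof -
  have "(\<exists>H\<in>\<F>. H \<subseteq> E) \<longleftrightarrow> edge_distance \<F> E = 0"
  proof
    assume "\<exists>H\<in>\<F>. H \<subseteq> E"
    then obtain H where "H \<in> \<F>" "card (H - E) = 0" by (metis Diff_eq_empty_iff card.empty)
    then show "edge_distance \<F> E = 0"
      using edge_distance_le[of H \<F> E] by simp
  next
    assume "edge_distance \<F> E = 0"
    then obtain H where "H \<in> \<F>" "card (H - E) = 0"
      using edge_distance_attained[OF assms(1)] by metis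
    then show "\<exists>H\<in>\<F>. H \<subseteq> E"
      using assms(2) by (intro bexI[of _ H]) auto
  qed
  then show ?thesis by (simp add: contains_indicator_def)
qed

lemma mono_contains_indicator: "mono (contains_indicator \<F>)"
proof (rule monoI)
  fix E E' :: "nat set set" assume "E \<subseteq> E'"
  then show "contains_indicator \<F> E \<le> contains_indicator \<F> E'"
    unfolding contains_indicator_def by auto
qed

lemma contains_indicator_bounds: "0 \<le> contains_indicator \<F> E" "contains_indicator \<F> E \<le> 1"
  by (auto simp: contains_indicator_def)

lemma slow_neg_edge_distance:
  assumes "\<F> \<noteq> {}" "\<And>H. H \<in> \<F> \<Longrightarrow> finite H"
  shows "slow (\<lambda>E. - real (edge_distance \<F> E))"
  unfolding slow_def
proof (intro conjI monoI allI)
  fix E E' :: "nat set set" assume "E \<subseteq> E'"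
  obtain H where H: "H \<in> \<F>" "edge_distance \<F> E = card (H - E)"
    using edge_distance_attained[OF assms(1)] .
  have "card (H - E') \<le> card (H - E)"
    using \<open>E \<subseteq> E'\<close> assms(2)[OF H(1)] by (intro card_mono) auto
  then show "- real (edge_distance \<F> E) \<le> - real (edge_distance \<F> E')"
    using H edge_distance_le[OF H(1), of E'] by simp
next
  fix e E
  obtain H where H: "H \<in> \<F>" "edge_distance \<F> (insert e E) = card (H - insert e E)"
    using edge_distance_attained[OF assms(1)] .
  have "card (H - E) \<le> card (insert e (H - insert e E))"
    using assms(2)[OF H(1)] by (intro card_mono) auto
  also have "\<dots> \<le> Suc (card (H - insert e E))" by (rule card_insert_le_m1[THEN order_trans]) auto
  finally show "- real (edge_distance \<F> (insert e E)) \<le> - real (edge_distance \<F> E) + 1"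
    using H edge_distance_le[OF H(1), of E] by linarith
qed

text \<open>Gadget \<open>i\<close> is used with the slot \<open>(u, w)\<close> by adding the edges from \<open>x i\<close> to \<open>u\<close> and from \<open>y i\<close> to \<open>w\<close>; a family
  of gadgets used with distinct slots reduces the distance by its size.\<close>
definition gadget_family ::
    "nat \<Rightarrow> nat set set set \<Rightarrow> nat set set \<Rightarrow> nat \<Rightarrow> (nat \<Rightarrow> nat) \<Rightarrow> (nat \<Rightarrow> nat) \<Rightarrow> (nat \<times> nat) set \<Rightarrow> bool" where
  "gadget_family n \<F> E k x y S \<longleftrightarrow>
     1 \<le> k \<and> k \<le> edge_distance \<F> E \<and> edge_distance \<F> E \<le> 3 * k \<and>
     (\<forall>i<k. x i \<in> {1..n} \<and> y i \<in> {1..n}) \<and> S \<subseteq> {1..n} \<times> {1..n} \<and>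
     inj_on fst S \<and> inj_on snd S \<and> n \<le> 4 * card S \<and>
     (\<forall>I \<sigma>. I \<subseteq> {..<k} \<longrightarrow> \<sigma> ` I \<subseteq> S \<longrightarrow> inj_on \<sigma> I \<longrightarrow>
        edge_distance \<F> (E \<union> (\<lambda>i. {x i, fst (\<sigma> i)}) ` I \<union> (\<lambda>i. {y i, snd (\<sigma> i)}) ` I) + card I
          \<le> edge_distance \<F> E)"

definition has_gadgets :: "nat \<Rightarrow> nat set set set \<Rightarrow> nat set set \<Rightarrow> bool" where
  "has_gadgets n \<F> E \<longleftrightarrow> (\<exists>k x y S. gadget_family n \<F> E k x y S)"

lemma exp_neg_le: "0 \<le> z \<Longrightarrow> z \<le> 1 \<Longrightarrow> exp (- z) \<le> 1 - z / 2" for z :: real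
proof -
  assume z: "0 \<le> z" "z \<le> 1"
  have "(1 + z) * (1 - z / 2) = 1 + z * (1 - z) / 2" by (simp add: field_simps)
  then have "1 \<le> (1 + z) * (1 - z / 2)" using z by simp
  also have "\<dots> \<le> exp z * (1 - z / 2)"
    using z exp_ge_add_one_self[of z] by (intro mult_right_mono) auto
  finally show ?thesis by (simp add: exp_minus field_simps)
qed

text \<open>In one phase \<open>s\<close> squares mark slots and \<open>s\<close> squares hit marks.
  If at least half of the k >= D/3 gadgets are completed, the distance falls to at most 5/6 of its
  value and \<open>A\<close> applies; otherwise the graph has at least not shrunk and
  \<open>A'\<close> applies. The expected number of incomplete gadgets is at most k/4, so by
  Markov's inequality the first case has probability at least 1/2.\<close>

lemma opt_iter_phase:
  fixes R :: "nat set set \<Rightarrow> real"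
  assumes n1: "n \<ge> 1" and R: "mono R" and gad: "has_gadgets n \<F> E"
    and s: "36 * real (edge_distance \<F> E) * real n \<le> (real s)\<^sup>2" "8 * s \<le> n"
    and A: "A' \<le> A" "A' \<le> R E" "\<And>E'. 6 * edge_distance \<F> E' \<le> 5 * edge_distance \<F> E \<Longrightarrow> A \<le> R E'"
  shows "(A + A') / 2 \<le> (opt_step n ^^ (s + s)) R E"
proof -
  define d where "d = edge_distance \<F> E"
  obtain k x y S where fam: "gadget_family n \<F> E k x y S"
    using gad unfolding has_gadgets_def by blast
  have k: "1 \<le> k" "k \<le> d" "d \<le> 3 * k"
    and xy: "\<And>i. i < k \<Longrightarrow> x i \<in> {1..n}" "\<And>i. i < k \<Longrightarrow> y i \<in> {1..n}"
    and S: "S \<subseteq> {1..n} \<times> {1..n}" "inj_on fst S" "inj_on snd S" "n \<le> 4 * card S"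
    using fam unfolding gadget_family_def d_def by blast+
  have gad: "edge_distance \<F> (E \<union> (\<lambda>i. {x i, fst (\<sigma> i)}) ` I \<union> (\<lambda>i. {y i, snd (\<sigma> i)}) ` I) + card I \<le> d"
    if "I \<subseteq> {..<k}" "\<sigma> ` I \<subseteq> S" "inj_on \<sigma> I" for I \<sigma>
    using fam that unfolding gadget_family_def d_def by blast
  have finS: "finite S" using S(1) finite_subset by fastforce
  have cardS: "card S \<le> n"
    using card_inj_on_le[OF S(3), of "{1..n}"] S(1) by force
  \<comment> \<open>The line A - \<gamma> j meets A' at j = k/2 incomplete gadgets, so it lies below
    the two-valued bound; this is Markov's inequality in linear form.\<close>
  define \<gamma> where "\<gamma> = 2 * (A - A') / real k"
  \<comment> \<open>An upper bound for (1 - 1/n)^s, the chance that a fixed marked slot is not hit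
    in \<open>s\<close> steps.\<close>
  define q where "q = exp (- (real s / real n))"
  define Q where "Q = (opt_step n ^^ s) R"
  have \<gamma>: "\<gamma> \<ge> 0" using A(1) by (simp add: \<gamma>_def)
  have q: "0 \<le> q" "q \<le> 1" by (simp_all add: q_def)
  have mQ: "mono Q" unfolding Q_def by (rule mono_lazy_iter[OF n1 opt_rate[OF n1] R])
  define marks where "marks K = E \<union> (\<Union>i<k. (\<lambda>p. {x i, fst p}) ` K i)" for K :: "nat \<Rightarrow> (nat \<times> nat) set"
  have hits: "A - \<gamma> * (real k - real (card I)) \<le> R (marks K \<union> (\<lambda>i. {y i, snd (\<sigma> i)}) ` I)"
    if K: "\<And>i. i < k \<Longrightarrow> K i \<subseteq> S" "disjoint_family_on K {..<k}" and I: "I \<subseteq> {..<k}"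
      and \<sigma>: "\<And>i. i \<in> I \<Longrightarrow> \<sigma> i \<in> K i" for K I \<sigma>
  proof -
    let ?E = "E \<union> (\<lambda>i. {x i, fst (\<sigma> i)}) ` I \<union> (\<lambda>i. {y i, snd (\<sigma> i)}) ` I"
    have sub: "?E \<subseteq> marks K \<union> (\<lambda>i. {y i, snd (\<sigma> i)}) ` I"
      using I \<sigma> by (fastforce simp: marks_def)
    have inj: "inj_on \<sigma> I"
    proof (rule inj_onI)
      fix i j assume ij: "i \<in> I" "j \<in> I" "\<sigma> i = \<sigma> j"
      then have "\<sigma> i \<in> K i \<inter> K j" using \<sigma>[of i] \<sigma>[of j] by simp
      then show "i = j"
        using K(2) I ij unfolding disjoint_family_on_def by blast
    qed
    have "\<sigma> ` I \<subseteq> S" using \<sigma> K(1) I by blast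
    then have le: "edge_distance \<F> ?E + card I \<le> d" using gad I inj by blast
    have cI: "card I \<le> k" using card_mono[OF _ I] by simp
    show ?thesis
    proof (cases "k \<le> 2 * card I")
      case True
      then have "A \<le> R ?E" using le k by (intro A(3)) (simp add: d_def)
      also have "\<dots> \<le> R (marks K \<union> (\<lambda>i. {y i, snd (\<sigma> i)}) ` I)" using R sub by (rule monoD)
      moreover have "0 \<le> \<gamma> * (real k - real (card I))" using \<gamma> cI by simp
      ultimately show ?thesis by linarith
    next
      case False
      then have "real k / 2 \<le> real k - real (card I)" by linarith
      then have "\<gamma> * (real k / 2) \<le> \<gamma> * (real k - real (card I))" using \<gamma> by (rule mult_left_mono)
      moreover have "\<gamma> * (real k / 2) = A - A'" using k(1) by (simp add: \<gamma>_def)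
      moreover have "R E \<le> R (marks K \<union> (\<lambda>i. {y i, snd (\<sigma> i)}) ` I)"
        using R by (rule monoD) (auto simp: marks_def)
      ultimately show ?thesis using A(2) by linarith
    qed
  qed
  have marks: "A - \<gamma> * (\<Sum>i<k. q ^ card (K i)) \<le> Q (E \<union> (\<Union>i<k. (\<lambda>p. {x i, fst p}) ` K i))"
    if K: "\<And>i. i < k \<Longrightarrow> K i \<subseteq> S" "disjoint_family_on K {..<k}" for K
  proof -
    have "A - \<gamma> * (\<Sum>i\<in>{..<k} - {}. (1 - real (card (K i)) / real n) ^ s)
      \<le> Q (marks K \<union> (\<lambda>i. {y i, snd (undefined :: nat \<times> nat)}) ` {})"
      unfolding Q_def
      by (rule opt_iter_hits[OF n1 R \<gamma> xy(2) S(1,3) K hits[OF K]]) auto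
    moreover have "(\<Sum>i<k. (1 - real (card (K i)) / real n) ^ s) \<le> (\<Sum>i<k. q ^ card (K i))"
    proof (intro sum_mono)
      fix i assume "i \<in> {..<k}"
      then have "card (K i) \<le> n" using K(1) card_mono[OF finS] cardS by (meson lessThan_iff order_trans)
      then have "(1 - real (card (K i)) / real n) ^ s \<le> exp (- (real (card (K i)) / real n)) ^ s"
        using exp_ge_add_one_self[of "- (real (card (K i)) / real n)"] n1
        by (intro power_mono) (auto simp: field_simps)
      also have "\<dots> = q ^ card (K i)"
        by (simp add: q_def exp_of_nat_mult[symmetric])
      finally show "(1 - real (card (K i)) / real n) ^ s \<le> q ^ card (K i)" .
    qed
    then have "\<gamma> * (\<Sum>i<k. (1 - real (card (K i)) / real n) ^ s) \<le> \<gamma> * (\<Sum>i<k. q ^ card (K i))"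
      using \<gamma> by (rule mult_left_mono)
    ultimately show ?thesis by (simp add: marks_def)
  qed
  define \<theta> where "\<theta> = 1 - (1 - q) * (real (card S) - real s) / (real n * real k)"
  have "A - \<gamma> * (\<theta> ^ s * (\<Sum>i<k. q ^ card ({} :: (nat \<times> nat) set)))
    \<le> (opt_step n ^^ s) Q (E \<union> (\<Union>i<k. (\<lambda>p. {x i, fst p}) ` ({} :: (nat \<times> nat) set)))"
    unfolding \<theta>_def
    by (rule opt_iter_marks[OF n1 mQ \<gamma> k(1) xy(1) S(1,2) q _ marks])
       (use S(4) s(2) in \<open>auto simp: disjoint_family_on_def\<close>)
  then have main: "A - \<gamma> * (\<theta> ^ s * real k) \<le> (opt_step n ^^ (s + s)) R E"
    by (simp add: Q_def funpow_add)
  have \<theta>0: "\<theta> \<ge> 0"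
  proof -
    have "(1 - q) * (real (card S) - real s) \<le> 1 * (real n * 1)"
      using q S(4) s(2) cardS by (intro mult_mono) auto
    also have "\<dots> \<le> 1 * (real n * real k)" using k by (intro mult_left_mono) auto
    finally show ?thesis unfolding \<theta>_def using n1 k by (simp add: field_simps)
  qed
  \<comment> \<open>1 - q is at least s/(2n), and card S - s is at least n/4 - n/8.\<close>
  have "\<theta> \<le> 1 - real s / (16 * real n * real k)"
  proof -
    have "q \<le> 1 - real s / real n / 2"
      unfolding q_def using s(2) n1 by (intro exp_neg_le) (auto simp: field_simps)
    then have "(real s / real n / 2) * (real n / 8) \<le> (1 - q) * (real (card S) - real s)"
      using S(4) s(2) q by (intro mult_mono) auto
    then have "(real s / 16) / (real n * real k) \<le> (1 - q) * (real (card S) - real s) / (real n * real k)"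
      using n1 by (intro divide_right_mono) auto
    then show ?thesis by (simp add: \<theta>_def)
  qed
  also have "\<dots> \<le> exp (- (real s / (16 * real n * real k)))"
    using exp_ge_add_one_self[of "- (real s / (16 * real n * real k))"] by simp
  finally have "\<theta> ^ s \<le> exp (- (real s / (16 * real n * real k))) ^ s"
    using \<theta>0 by (rule power_mono)
  also have "\<dots> = exp (- ((real s)\<^sup>2 / (16 * real n * real k)))"
    by (simp add: exp_of_nat_mult[symmetric] power2_eq_square)
  \<comment> \<open>From s^2 >= 36 D n >= 32 k n. As e^2 >= 4, at most k/4 gadgets are expected to
    stay incomplete.\<close>
  also have "\<dots> \<le> exp (- 2)"
  proof -
    have "32 * real k * real n \<le> 36 * real d * real n"
      using k(2) by (intro mult_right_mono) auto
    also have "\<dots> \<le> (real s)\<^sup>2" using s(1) by (simp only: d_def)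
    finally have "32 * real k * real n \<le> (real s)\<^sup>2" .
    then show ?thesis using n1 k(1) by (simp add: field_simps)
  qed
  also have "\<dots> \<le> 1 / 4"
  proof -
    have "(2::real)\<^sup>2 \<le> (exp 1)\<^sup>2"
      using exp_ge_add_one_self[of "1::real"] by (intro power_mono) auto
    then have "4 \<le> exp (2::real)" by (simp add: power2_eq_square flip: exp_add)
    then show ?thesis by (simp add: exp_minus field_simps)
  qed
  finally have "\<gamma> * (\<theta> ^ s * real k) \<le> \<gamma> * (1 / 4 * real k)"
    using \<gamma> by (intro mult_left_mono mult_right_mono) auto
  also have "\<dots> = (A - A') / 2" using k(1) by (simp add: \<gamma>_def)
  finally show ?thesis using main by (simp add: field_simps)
qed

text \<open>Put w = sqrt (D n). A phase takes 2s <= 14 w steps and, with weight 1/2, scales w by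
  sqrt (5/6); a failed phase loses only its steps. The mean factor 0.9565 outweighs the time spent:
  for t > 400 w the phase costs at most 14/400, that is 3.5 percent of \<open>t\<close>, against a
  gain of 4.35 percent.\<close>

lemma opt_iter_repair:
  assumes n1: "n \<ge> 1" and \<F>: "\<F> \<noteq> {}" "\<And>H. H \<in> \<F> \<Longrightarrow> finite H"
    and gad: "\<And>E. 1 \<le> edge_distance \<F> E \<Longrightarrow> 100 * edge_distance \<F> E \<le> n \<Longrightarrow> has_gadgets n \<F> E"
    and t: "1 \<le> t" "t \<le> n"
  shows "1 - 400 * sqrt (real (edge_distance \<F> E) * real n) / real t
    \<le> (opt_step n ^^ t) (contains_indicator \<F>) E"
  using t
proof (induction t arbitrary: E rule: less_induct)
  case (less t)
  note rate = n1 opt_rate[OF n1]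
  define d where "d = edge_distance \<F> E"
  define w where "w = sqrt (real d * real n)"
  have ge: "contains_indicator \<F> E \<le> (opt_step n ^^ t) (contains_indicator \<F>) E"
    using lazy_iter_increasing[OF rate mono_contains_indicator, of 0 t] by simp
  consider "d = 0" | "real t \<le> 400 * w" | "d \<ge> 1" "real t > 400 * w" by linarith
  then show ?case
  proof cases
    case 1
    then show ?thesis
      using ge contains_indicator_eq[OF \<F>, of E] by (simp add: d_def)
  next
    case 2
    then have "1 \<le> 400 * w / real t" using less.prems by (simp add: field_simps)
    then show ?thesis
      using ge contains_indicator_bounds(1)[of \<F> E] unfolding w_def d_def by linarith
  next
    case 3
    have dn: "real d * real n \<ge> 1" using 3(1) n1 mult_mono[of 1 "real d" 1 "real n"] by simp
    then have w: "w \<ge> 1" unfolding w_def by simp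
    have w2: "w\<^sup>2 = real d * real n" unfolding w_def by simp
    define s where "s = nat \<lceil>6 * w\<rceil>"
    have s: "6 * w \<le> real s" "real s \<le> 7 * w" "s \<ge> 1"
      using w unfolding s_def by linarith+
    have tn: "real t \<le> real n" using less.prems by simp
    \<comment> \<open>From 400 w < t <= n and w^2 = d n: gadgets are available whenever the claimed
      bound is positive.\<close>
    have "100 * real d \<le> real n"
    proof -
      have "w * w \<le> (real n / 400) * (real n / 400)"
        using w 3(2) tn by (intro mult_mono) auto
      then have "real d * real n \<le> real n / 160000 * real n"
        using w2 by (simp add: power2_eq_square)
      then show ?thesis using n1 by simp
    qed
    then have g: "has_gadgets n \<F> E" using 3(1) by (intro gad) (simp_all add: d_def)
    define t' where "t' = t - (s + s)"
    have t's: "t = (s + s) + t'" "1 \<le> t'" "t' < t" "t' \<le> n"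
      using s 3(2) less.prems w unfolding t'_def by linarith+
    \<comment> \<open>\<open>sqrt (5 / 6) < 0.913\<close>, and \<open>0.9565\<close> is the mean of \<open>0.913\<close> and \<open>1\<close>.\<close>
    have t'r: "real t' \<ge> 0.9565 * real t"
  proof -
    have "real t = real s + real s + real t'" by (subst t's(1)) simp
    then show ?thesis using s(2) 3(2) by simp
  qed
    define R where "R = (opt_step n ^^ t') (contains_indicator \<F>)"
    have IH: "1 - 400 * sqrt (real (edge_distance \<F> E') * real n) / real t' \<le> R E'" for E'
      unfolding R_def using t's by (intro less.IH) auto
    have "(1 - 400 * (0.913 * w) / real t' + (1 - 400 * w / real t')) / 2 \<le> (opt_step n ^^ (s + s)) R E"
    proof (rule opt_iter_phase[OF n1 _ g])
      show "mono R" unfolding R_def by (rule mono_lazy_iter[OF rate mono_contains_indicator])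
      have "(6 * w)\<^sup>2 \<le> (real s)\<^sup>2" using s w by (intro power_mono) auto
      then show "36 * real (edge_distance \<F> E) * real n \<le> (real s)\<^sup>2"
        using w2 by (simp add: power_mult_distrib d_def)
      show "8 * s \<le> n" using s(2) 3(2) tn w by linarith
      show "1 - 400 * w / real t' \<le> R E" using IH[of E] by (simp add: w_def d_def)
      show "1 - 400 * w / real t' \<le> 1 - 400 * (0.913 * w) / real t'"
        using w t's by (intro diff_left_mono divide_right_mono) auto
      fix E' assume "6 * edge_distance \<F> E' \<le> 5 * edge_distance \<F> E"
      then have "real (edge_distance \<F> E') \<le> 0.913\<^sup>2 * real d"
      proof -
        have "6 * real (edge_distance \<F> E') \<le> 5 * real d"
          using \<open>6 * edge_distance \<F> E' \<le> _\<close> unfolding d_def by linarith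
        then show ?thesis by (simp add: power2_eq_square)
      qed
      then have "real (edge_distance \<F> E') * real n \<le> 0.913\<^sup>2 * real d * real n"
        by (rule mult_right_mono) simp
      also have "\<dots> = (0.913 * w)\<^sup>2" unfolding power_mult_distrib w2 by simp
      finally have "sqrt (real (edge_distance \<F> E') * real n) \<le> 0.913 * w"
        by (rule real_le_lsqrt[rotated]) (use w in simp)
      then have "1 - 400 * (0.913 * w) / real t' \<le> 1 - 400 * sqrt (real (edge_distance \<F> E') * real n) / real t'"
        by (intro diff_left_mono divide_right_mono mult_left_mono) auto
      then show "1 - 400 * (0.913 * w) / real t' \<le> R E'" using IH[of E'] by linarith
    qed
    also have "(1 - 400 * (0.913 * w) / real t' + (1 - 400 * w / real t')) / 2 = 1 - 400 * w * (0.9565 / real t')"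
      by (simp add: field_simps)
    finally have "1 - 400 * w * (0.9565 / real t') \<le> (opt_step n ^^ t) (contains_indicator \<F>) E"
      unfolding t's(1) by (simp add: R_def funpow_add)
    moreover have "400 * w * (0.9565 / real t') \<le> 400 * w * (1 / real t)"
    proof (rule mult_left_mono)
      show "0.9565 / real t' \<le> 1 / real t"
        using t'r t's(2) less.prems(1) by (simp add: divide_simps)
    qed (use w in simp)
    ultimately show ?thesis by (simp add: w_def d_def)
  qed
qed

section \<open>Sharpness and linear growth\<close>

abbreviation neg_distance :: "nat set set set \<Rightarrow> nat set set \<Rightarrow> real" where
  "neg_distance \<F> E \<equiv> - real (edge_distance \<F> E)"

text \<open>The interface between the probabilistic argument and the two properties. By
  \<open>spread\<close> a random square hits a missing edge with probability at least D/n,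
  \<open>size\<close> forces a linear number of steps, \<open>glue\<close> joins solutions on
  consecutive blocks of vertices, and \<open>gadgets\<close> feeds the repair lemma. The bound 3 is
  where Hamiltonian cycles begin.\<close>

locale target_family =
  fixes F :: "nat \<Rightarrow> nat set set set"
  assumes nonempty: "n \<ge> 3 \<Longrightarrow> F n \<noteq> {}"
    and edges: "H \<in> F n \<Longrightarrow> e \<in> H \<Longrightarrow> e \<subseteq> {1..n} \<and> card e = 2"
    and spread: "H \<in> F n \<Longrightarrow> M \<subseteq> H \<Longrightarrow> card M \<le> card (\<Union>M)"
    and size: "H \<in> F n \<Longrightarrow> n \<le> 2 * card H + 1"
    and glue: "n\<^sub>1 \<ge> 3 \<Longrightarrow> n\<^sub>2 \<ge> 3 \<Longrightarrow> H\<^sub>1 \<in> F n\<^sub>1 \<Longrightarrow> H\<^sub>2 \<in> F n\<^sub>2 \<Longrightarrow>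
      \<exists>H\<in>F (n\<^sub>1 + n\<^sub>2). card (H - (E\<^sub>1 \<union> (`) ((+) n\<^sub>1) ` E\<^sub>2)) \<le> card (H\<^sub>1 - E\<^sub>1) + card (H\<^sub>2 - E\<^sub>2) + 2"
    and gadgets: "n \<ge> 3 \<Longrightarrow> 1 \<le> edge_distance (F n) E \<Longrightarrow> 100 * edge_distance (F n) E \<le> n \<Longrightarrow>
      has_gadgets n (F n) E"
begin

definition win :: "nat \<Rightarrow> nat \<Rightarrow> real" where
  "win n t = (opt_step n ^^ t) (contains_indicator (F n)) {}"

text \<open>The least expected distance at time \<open>t\<close>; the two signs turn the maximum in
  the step into a minimum.\<close>

definition deficit :: "nat \<Rightarrow> nat \<Rightarrow> real" where
  "deficit n t = - (opt_step n ^^ t) (neg_distance (F n)) {}"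

lemma finite_target: "H \<in> F n \<Longrightarrow> finite H"
  using edges[of H n] by (intro finite_subset[of H "Pow {1..n}"]) auto

lemma slow_neg_distance: "n \<ge> 3 \<Longrightarrow> slow (neg_distance (F n))"
  using slow_neg_edge_distance[OF nonempty finite_target] .

lemma edge_distance_le_size: "n \<ge> 3 \<Longrightarrow> edge_distance (F n) E \<le> n"
proof -
  assume n: "n \<ge> 3"
  obtain H where H: "H \<in> F n" "edge_distance (F n) E = card (H - E)"
    using edge_distance_attained[OF nonempty[OF n]] .
  have "card (H - E) \<le> card (\<Union>(H - E))" using spread[OF H(1)] by simp
  also have "\<dots> \<le> card {1..n}" using edges[OF H(1)] by (intro card_mono) auto
  finally show ?thesis using H by simp
qed

lemma edge_distance_empty: "n \<ge> 3 \<Longrightarrow> n \<le> 2 * edge_distance (F n) {} + 1"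
  using edge_distance_attained[OF nonempty, of n "{}"] size by (metis Diff_empty)

context
  fixes n :: nat
  assumes n3: "n \<ge> 3"
begin

lemma n_pos: "n \<ge> 1"
  using n3 by simp

lemmas rate = n_pos opt_rate[OF n_pos]

lemma win_mono: "s \<le> t \<Longrightarrow> win n s \<le> win n t"
  unfolding win_def by (rule lazy_iter_increasing[OF rate mono_contains_indicator])

lemma opt_iter_const: "(opt_step n ^^ t) (\<lambda>E. c) E = c"
  using lazy_iter_affine[OF rate, of 0 t "\<lambda>E. 0" c E] by simp

lemma win_nonneg: "win n t \<ge> 0"
  using win_mono[of 0 t] contains_indicator_bounds(1)[of "F n" "{}"] by (simp add: win_def)

lemma win_le_1: "win n t \<le> 1"
proof -
  have "win n t \<le> (opt_step n ^^ t) (\<lambda>E. 1) {}"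
    unfolding win_def by (rule lazy_iter_mono[OF rate contains_indicator_bounds(2)])
  then show ?thesis by (simp add: opt_iter_const)
qed

lemma deficit_nonneg: "deficit n t \<ge> 0"
proof -
  have "(opt_step n ^^ t) (neg_distance (F n)) {} \<le> (opt_step n ^^ t) (\<lambda>E. 0) {}"
    by (rule lazy_iter_mono[OF rate]) simp
  then show ?thesis by (simp add: deficit_def opt_iter_const)
qed

text \<open>The second moment is centred at the optimal mean, which reduces the right side of the
  general bound to \<open>t\<close>. On the winning event the distance is 0, and the squared
  positive part equals the squared deficit.\<close>

lemma win_deficit_le: "win n t * (deficit n t)\<^sup>2 \<le> real t"
proof -
  let ?X = "neg_distance (F n)" and ?v = "deficit n t"
  have "win n t * ?v\<^sup>2 = (opt_step n ^^ t) (\<lambda>E. ?v\<^sup>2 * contains_indicator (F n) E + 0) {}"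
    by (subst lazy_iter_affine[OF rate]) (auto simp: win_def)
  also have "\<dots> \<le> (opt_step n ^^ t) (\<lambda>E. (max 0 (?X E + ?v))\<^sup>2) {}"
  proof (rule lazy_iter_mono[OF rate])
    fix E
    show "?v\<^sup>2 * contains_indicator (F n) E + 0 \<le> (max 0 (?X E + ?v))\<^sup>2"
      using deficit_nonneg[of t]
      by (simp add: contains_indicator_eq[OF nonempty[OF n3] finite_target])
  qed
  also have "\<dots> \<le> (max 0 ((opt_step n ^^ t) ?X {} + ?v))\<^sup>2 + real t"
    by (rule opt_iter_pos_part_square[OF n_pos slow_neg_distance[OF n3]])
  also have "\<dots> = real t" by (simp add: deficit_def)
  finally show ?thesis .
qed

lemma deficit_le_sqrt:
  assumes "\<delta> > 0" "win n t \<ge> \<delta>"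
  shows "deficit n t \<le> sqrt (real t / \<delta>)"
proof (rule real_le_rsqrt)
  have "\<delta> * (deficit n t)\<^sup>2 \<le> real t"
    using win_deficit_le[of t] assms(2) mult_right_mono[of \<delta> "win n t" "(deficit n t)\<^sup>2"] by simp
  then show "(deficit n t)\<^sup>2 \<le> real t / \<delta>" using assms(1) by (simp add: field_simps)
qed

text \<open>The bound of the repair lemma is made affine in the distance by AM-GM, so that it can be averaged.\<close>
lemma win_after_repair:
  assumes b: "b > 0" "deficit n s \<le> b" and t: "1 \<le> t" "t \<le> n"
  shows "1 - 400 * sqrt (real n * b) / real t \<le> win n (s + t)"
proof -
  \<comment> \<open>From the tangent of the square root at D = b: the loss 400 sqrt (D n) / t is at
    most c (D/b + 1), with equality at D = b.\<close>
  define c where "c = 400 * sqrt (real n * b) / (2 * real t)"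
  have c: "c \<ge> 0" using b by (simp add: c_def)
  have le: "c / b * neg_distance (F n) E + (1 - c) \<le> (opt_step n ^^ t) (contains_indicator (F n)) E" for E
  proof -
    define D where "D = real (edge_distance (F n) E)"
    have amgm: "sqrt z \<le> (z + 1) / 2" if "z \<ge> 0" for z :: real
      using that arith_geo_mean_sqrt[of z 1] by simp
    have "sqrt (D * real n) = sqrt (real n * b) * sqrt (D / b)"
      using b by (simp flip: real_sqrt_mult)
    also have "\<dots> \<le> sqrt (real n * b) * ((D / b + 1) / 2)"
      using b by (intro mult_left_mono amgm) (auto simp: D_def)
    finally have "400 * sqrt (D * real n) / real t \<le> 400 * (sqrt (real n * b) * ((D / b + 1) / 2)) / real t"
      by (intro divide_right_mono mult_left_mono) auto
    also have "\<dots> = c * (D / b + 1)" by (simp add: c_def)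
    finally have "1 - c * (D / b + 1) \<le> 1 - 400 * sqrt (D * real n) / real t" by simp
    also have "\<dots> \<le> (opt_step n ^^ t) (contains_indicator (F n)) E"
      unfolding D_def using opt_iter_repair[OF n_pos nonempty[OF n3] finite_target gadgets[OF n3] t] by simp
    finally show ?thesis by (simp add: D_def algebra_simps)
  qed
  have "1 - 400 * sqrt (real n * b) / real t = c / b * (- b) + (1 - c)"
    using b t by (simp add: c_def field_simps)
  also have "\<dots> \<le> c / b * (opt_step n ^^ s) (neg_distance (F n)) {} + (1 - c)"
    using b c by (intro add_right_mono mult_left_mono) (auto simp: deficit_def)
  also have "\<dots> = (opt_step n ^^ s) (\<lambda>E. c / b * neg_distance (F n) E + (1 - c)) {}"
    using b c by (subst lazy_iter_affine[OF rate]) auto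
  also have "\<dots> \<le> (opt_step n ^^ s) ((opt_step n ^^ t) (contains_indicator (F n))) {}"
    by (rule lazy_iter_mono[OF rate le])
  finally show ?thesis by (simp add: win_def funpow_add)
qed

text \<open>One edge lowers the distance by at most 1, and by \<open>size\<close> the empty graph is
  at distance at least (n - 1)/2.\<close>

lemma win_pos_imp: "win n t > 0 \<Longrightarrow> n \<le> 2 * t + 1"
proof -
  have "(opt_step n ^^ t) (contains_indicator (F n)) E \<le> (if edge_distance (F n) E \<le> t then 1 else 0)" for E
  proof (induction t arbitrary: E)
    case 0
    then show ?case by (simp add: contains_indicator_eq[OF nonempty[OF n3] finite_target])
  next
    case (Suc t)
    define c :: real where "c = (if edge_distance (F n) E \<le> Suc t then 1 else 0)"
    have step: "edge_distance (F n) E \<le> Suc (edge_distance (F n) (insert e E))" for e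
    proof -
      have "neg_distance (F n) (insert e E) \<le> neg_distance (F n) E + 1"
        using slow_neg_distance[OF n3] unfolding slow_def by blast
      then show ?thesis by linarith
    qed
    have "opt_step n ((opt_step n ^^ t) (contains_indicator (F n))) E
        \<le> (1 - 1 / real n * real n) * c + 1 / real n * (\<Sum>u\<in>{1..n}. c)"
    proof (rule lazy_step_le[OF rate])
      show "(opt_step n ^^ t) (contains_indicator (F n)) E \<le> c"
        using Suc.IH[of E] by (auto simp: c_def split: if_splits)
      show "(opt_step n ^^ t) (contains_indicator (F n)) (insert {u, v} E) \<le> c" for u v
        using Suc.IH[of "insert {u, v} E"] step[of "{u, v}"] by (auto simp: c_def split: if_splits)
    qed
    also have "\<dots> = c" using n3 by simp
    finally show ?case by (simp add: c_def)
  qed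
  then have "win n t \<le> (if edge_distance (F n) {} \<le> t then 1 else 0)" by (simp add: win_def)
  moreover assume "win n t > 0"
  ultimately show "n \<le> 2 * t + 1"
    using edge_distance_empty[OF n3] by (auto split: if_splits)
qed

text \<open>Fix a closest target. By \<open>spread\<close> its D missing edges have at least D
  endpoints, and a square at such an endpoint is answered by the other end of a missing edge. So D
  drops by 1 with probability at least D/n.\<close>

lemma opt_step_neg_distance_ge:
  "(1 - 1 / real n) * neg_distance (F n) E \<le> opt_step n (neg_distance (F n)) E"
proof -
  define D where "D = edge_distance (F n) E"
  obtain H where H: "H \<in> F n" "D = card (H - E)"
    using edge_distance_attained[OF nonempty[OF n3]] unfolding D_def .
  define U where "U = \<Union>(H - E)"
  have U: "U \<subseteq> {1..n}" using edges[OF H(1)] by (auto simp: U_def)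
  have "\<exists>v\<in>{1..n}. - real D + (if u \<in> U then 1 else 0) \<le> neg_distance (F n) (insert {u, v} E)"
    if "u \<in> {1..n}" for u
  proof (cases "u \<in> U")
    case True
    then obtain e where e: "e \<in> H - E" "u \<in> e" by (auto simp: U_def)
    then obtain v where v: "e = {u, v}" using edges[OF H(1), of e] by (auto simp: card_2_iff)
    have "H - insert {u, v} E = (H - E) - {e}" using v by auto
    then have "card (H - insert {u, v} E) = D - 1"
      using e H finite_target by simp
    moreover have "D \<ge> 1" using e H finite_target[OF H(1)] card_gt_0_iff[of "H - E"] by fastforce
    ultimately have "real (edge_distance (F n) (insert {u, v} E)) \<le> real D - 1"
      using edge_distance_le[OF H(1), of "insert {u, v} E"] by linarith
    moreover have "v \<in> {1..n}" using edges[OF H(1), of e] e v by auto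
    ultimately show ?thesis using True by (intro bexI[of _ v]) auto
  next
    case False
    have "mono (neg_distance (F n))" using slow_neg_distance[OF n3] by (simp add: slow_def)
    then have "neg_distance (F n) E \<le> neg_distance (F n) (insert {u, 1} E)" by (rule mono_insert_le)
    then show ?thesis using False n3 by (intro bexI[of _ 1]) (auto simp: D_def)
  qed
  then have "(\<Sum>u\<in>{1..n}. - real D + (if u \<in> U then 1 else 0)) / real n \<le> opt_step n (neg_distance (F n)) E"
    by (rule opt_step_ge[OF n_pos])
  moreover have "(\<Sum>u\<in>{1..n}. - real D + (if u \<in> U then 1 else 0)) = - real n * real D + real (card U)"
    unfolding sum.distrib using U by (simp add: sum.If_cases Int_absorb1)
  moreover have "real D \<le> real (card U)" using spread[OF H(1), of "H - E"] H(2) by (simp add: U_def)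
  then have "(- real n * real D + real D) / real n \<le> (- real n * real D + real (card U)) / real n"
    by (intro divide_right_mono) auto
  moreover have "(- real n * real D + real D) / real n = (1 - 1 / real n) * (- real D)"
    using n3 by (simp add: field_simps)
  ultimately show ?thesis by (simp add: D_def)
qed

lemma deficit_le_exp: "deficit n t \<le> real n * exp (- (real t / real n))"
proof -
  define q where "q = 1 - 1 / real n"
  have q: "0 \<le> q" using n3 by (simp add: q_def)
  have "q ^ t * neg_distance (F n) E \<le> (opt_step n ^^ t) (neg_distance (F n)) E" for E
  proof (induction t arbitrary: E)
    case (Suc t)
    have "q ^ Suc t * neg_distance (F n) E \<le> q ^ t * opt_step n (neg_distance (F n)) E"
      using mult_left_mono[OF opt_step_neg_distance_ge, of "q ^ t" E] q by (simp add: q_def mult_ac)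
    also have "\<dots> = opt_step n (\<lambda>E. q ^ t * neg_distance (F n) E + 0) E"
      using q by (subst lazy_step_affine[OF rate]) auto
    also have "\<dots> \<le> opt_step n ((opt_step n ^^ t) (neg_distance (F n))) E"
      using Suc.IH by (intro lazy_step_mono[OF rate]) simp
    finally show ?case by simp
  qed simp
  then have "deficit n t \<le> q ^ t * real (edge_distance (F n) {})"
    by (simp add: deficit_def minus_le_iff)
  also have "\<dots> \<le> exp (- (1 / real n)) ^ t * real n"
    using q edge_distance_le_size[OF n3] exp_ge_add_one_self[of "- (1 / real n)"]
    by (intro mult_mono power_mono) (auto simp: q_def)
  also have "\<dots> = real n * exp (- (real t / real n))"
    by (simp add: exp_of_nat_mult[symmetric])
  finally show ?thesis .
qed

text \<open>20 n steps bring the expected distance down to n e^(-20), and n further steps repair it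
  with failure probability at most 400 e^(-10) <= 1/2. This makes the threshold well defined and at
  most linear.\<close>

lemma win_linear: "win n (21 * n) \<ge> 1 / 2"
proof -
  define b where "b = real n * exp (- 20)"
  have b: "b > 0" "deficit n (20 * n) \<le> b"
    using n3 deficit_le_exp[of "20 * n"] by (auto simp: b_def)
  have "real n * b = (real n * exp (- 10))\<^sup>2"
    by (simp add: b_def power2_eq_square flip: exp_add)
  then have "sqrt (real n * b) = real n * exp (- 10)" by simp
  then have "1 - 400 * exp (- 10) \<le> win n (20 * n + n)"
    using win_after_repair[OF b, of n] n3 by simp
  moreover have "exp (- 10) \<le> (1 / 800 :: real)"
  proof -
    have "(2::real) ^ 10 \<le> exp 1 ^ 10"
      using exp_ge_add_one_self[of "1::real"] by (intro power_mono) auto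
    also have "\<dots> = exp 10" by (simp flip: exp_of_nat_mult)
    finally show ?thesis by (simp add: exp_minus field_simps)
  qed
  ultimately show ?thesis by simp
qed

end

section \<open>The threshold time and its window\<close>

definition thr :: "nat \<Rightarrow> nat" where
  "thr n = (LEAST t. win n t \<ge> 1 / 2)"

lemma thr_le: "win n t \<ge> 1 / 2 \<Longrightarrow> thr n \<le> t"
  unfolding thr_def by (rule Least_le)

context
  fixes n :: nat
  assumes n3: "n \<ge> 3"
begin

lemma win_thr: "win n (thr n) \<ge> 1 / 2"
  unfolding thr_def by (rule LeastI[of _ "21 * n"]) (rule win_linear[OF n3])

lemma thr_upper: "thr n \<le> 21 * n"
  by (rule thr_le[OF win_linear[OF n3]])

lemma thr_lower: "n \<le> 3 * thr n"
  using win_pos_imp[OF n3, of "thr n"] win_thr n3 by linarith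

end

lemma win_less_imp: "win n t < 1 / 2" if "t < thr n"
  using thr_le[of n t] that by linarith

text \<open>Winning probability \<delta> at a time s <= 21 n bounds the deficit by sqrt (21 n /
  \<delta>) = o(n), which a repair of \<eta> n steps removes.\<close>

lemma win_sharp:
  assumes \<delta>: "0 < \<delta>" and \<eta>: "0 < \<eta>" "\<eta> \<le> 1"
  shows "\<forall>\<^sub>F n in sequentially. \<forall>s\<le>21 * n. win n s \<ge> \<delta> \<longrightarrow> win n (s + nat \<lfloor>\<eta> * real n\<rfloor>) \<ge> 1 - \<delta>"
proof -
  \<comment> \<open>Chosen so that 400 sqrt \<kappa> n, divided by t >= \<eta> n / 2, is at most
    \<delta>.\<close>
  define \<kappa> where "\<kappa> = (\<delta> * \<eta> / 800)\<^sup>2"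
  have \<kappa>: "\<kappa> > 0" using \<delta> \<eta> by (simp add: \<kappa>_def)
  \<comment> \<open>The first bound gives sqrt (21 n / \<delta>) <= \<kappa> n; the second keeps the
    floor of \<eta> n at least \<eta> n / 2.\<close>
  define C where "C = max (21 / (\<delta> * \<kappa>\<^sup>2)) (2 / \<eta>)"
  have "\<forall>\<^sub>F n in sequentially. real n \<ge> C"
    by (rule eventually_sequentiallyI[of "nat \<lceil>C\<rceil>"]) linarith
  moreover have "\<forall>\<^sub>F n in sequentially. n \<ge> (3::nat)" by (rule eventually_ge_at_top)
  ultimately show ?thesis
  proof eventually_elim
    case (elim n)
    have C: "real n \<ge> 21 / (\<delta> * \<kappa>\<^sup>2)" "real n \<ge> 2 / \<eta>" using elim(1) by (auto simp: C_def)
    define t where "t = nat \<lfloor>\<eta> * real n\<rfloor>"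
    have \<eta>n: "\<eta> * real n \<ge> 2" using C(2) \<eta> by (simp add: field_simps)
    have "\<eta> * real n \<le> real n" using \<eta> mult_right_mono[of \<eta> 1 "real n"] by simp
    then have t: "1 \<le> t" "t \<le> n" "real t \<ge> \<eta> * real n / 2"
      using \<eta>n unfolding t_def by linarith+
    show ?case unfolding t_def[symmetric]
    proof (intro allI impI)
      fix s assume s: "s \<le> 21 * n" "\<delta> \<le> win n s"
      have "deficit n s \<le> sqrt (real s / \<delta>)" by (rule deficit_le_sqrt[OF elim(2) \<delta> s(2)])
      also have "\<dots> \<le> \<kappa> * real n"
      proof (rule real_le_lsqrt)
        have "real s / \<delta> \<le> 21 * real n / \<delta>" using s(1) \<delta> by (intro divide_right_mono) auto
        also have "\<dots> = (21 / (\<delta> * \<kappa>\<^sup>2)) * real n * \<kappa>\<^sup>2" using \<kappa> by simp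
        also have "\<dots> \<le> real n * real n * \<kappa>\<^sup>2" using C(1) by (intro mult_right_mono) auto
        also have "\<dots> = (\<kappa> * real n)\<^sup>2" by (simp add: power2_eq_square)
        finally show "real s / \<delta> \<le> (\<kappa> * real n)\<^sup>2" .
      qed (use \<kappa> \<delta> in auto)
      finally have "1 - 400 * sqrt (real n * (\<kappa> * real n)) / real t \<le> win n (s + t)"
        using \<kappa> elim(2) t by (intro win_after_repair) auto
      moreover have "real n * (\<kappa> * real n) = (\<delta> * \<eta> / 800 * real n)\<^sup>2"
        by (simp add: \<kappa>_def power2_eq_square)
      then have "sqrt (real n * (\<kappa> * real n)) = \<delta> * \<eta> / 800 * real n"
        using \<delta> \<eta> by (simp add: real_sqrt_unique)
      moreover have "400 * (\<delta> * \<eta> / 800 * real n) / real t \<le> \<delta>"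
      proof -
        have "\<delta> * (\<eta> * real n / 2) \<le> \<delta> * real t" using t(3) \<delta> by (intro mult_left_mono) auto
        then show ?thesis using t(1) by (simp add: field_simps)
      qed
      ultimately show "1 - \<delta> \<le> win n (s + t)" by simp
    qed
  qed
qed

lemma win_above_thr:
  assumes "\<epsilon> > 0"
  shows "(\<lambda>n. win n (nat \<lfloor>(1 + \<epsilon>) * real (thr n)\<rfloor>)) \<longlonglongrightarrow> 1"
proof (rule LIMSEQ_I)
  fix r :: real assume r: "r > 0"
  define \<delta> where "\<delta> = min (1 / 2) (r / 2)"
  \<comment> \<open>As n <= 3 thr n, a window of \<epsilon> n / 3 steps fits into \<epsilon> thr
    n.\<close>
  define \<eta> where "\<eta> = min 1 (\<epsilon> / 3)"
  have \<delta>: "0 < \<delta>" "\<delta> \<le> 1 / 2" "\<delta> < r" and \<eta>: "0 < \<eta>" "\<eta> \<le> 1" "\<eta> \<le> \<epsilon> / 3"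
    using r assms by (auto simp: \<delta>_def \<eta>_def)
  have "\<forall>\<^sub>F n in sequentially. n \<ge> (3::nat)" by (rule eventually_ge_at_top)
  with win_sharp[OF \<delta>(1) \<eta>(1,2)]
  have "\<forall>\<^sub>F n in sequentially. norm (win n (nat \<lfloor>(1 + \<epsilon>) * real (thr n)\<rfloor>) - 1) < r"
  proof eventually_elim
    case (elim n)
    have "1 - \<delta> \<le> win n (thr n + nat \<lfloor>\<eta> * real n\<rfloor>)"
      using elim win_thr[OF elim(2)] thr_upper[OF elim(2)] \<delta>(2) by auto
    also have "\<dots> \<le> win n (nat \<lfloor>(1 + \<epsilon>) * real (thr n)\<rfloor>)"
    proof (rule win_mono[OF elim(2)])
      have "\<eta> * real n \<le> \<epsilon> / 3 * (3 * real (thr n))"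
        using \<eta> thr_lower[OF elim(2)] assms by (intro mult_mono) auto
      moreover have "(1 + \<epsilon>) * real (thr n) = real (thr n) + \<epsilon> * real (thr n)"
        by (simp add: algebra_simps)
      ultimately have "real (thr n) + \<eta> * real n \<le> (1 + \<epsilon>) * real (thr n)" by simp
      moreover have "0 \<le> \<eta> * real n" using \<eta> by simp
      ultimately show "thr n + nat \<lfloor>\<eta> * real n\<rfloor> \<le> nat \<lfloor>(1 + \<epsilon>) * real (thr n)\<rfloor>" by linarith
    qed
    finally show ?case using win_le_1[OF elim(2), of "nat \<lfloor>(1 + \<epsilon>) * real (thr n)\<rfloor>"] \<delta> by (simp add: abs_if)
  qed
  then show "\<exists>no. \<forall>n\<ge>no. norm (win n (nat \<lfloor>(1 + \<epsilon>) * real (thr n)\<rfloor>) - 1) < r"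
    by (simp add: eventually_sequentially)
qed

text \<open>Otherwise a winning probability of at least \<delta> at the earlier time would exceed
  1/2 one window later, still before the threshold.\<close>

lemma win_below_thr:
  assumes "\<epsilon> > 0"
  shows "(\<lambda>n. win n (nat \<lfloor>(1 - \<epsilon>) * real (thr n)\<rfloor>)) \<longlonglongrightarrow> 0"
proof (rule LIMSEQ_I)
  fix r :: real assume r: "r > 0"
  define \<delta> where "\<delta> = min (1 / 3) r"
  \<comment> \<open>Of \<epsilon> thr n >= \<epsilon> n / 3, one half pays for the window; the other
    half is at least 1 for n >= 6 / \<epsilon> and gives strictness.\<close>
  define \<eta> where "\<eta> = min 1 (\<epsilon> / 6)"
  have \<delta>: "0 < \<delta>" "\<delta> < 1 / 2" "\<delta> \<le> r" and \<eta>: "0 < \<eta>" "\<eta> \<le> 1" "\<eta> \<le> \<epsilon> / 6"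
    using r assms by (auto simp: \<delta>_def \<eta>_def)
  have "\<forall>\<^sub>F n in sequentially. real n \<ge> 6 / \<epsilon>"
    by (rule eventually_sequentiallyI[of "nat \<lceil>6 / \<epsilon>\<rceil>"]) linarith
  moreover have "\<forall>\<^sub>F n in sequentially. n \<ge> (3::nat)" by (rule eventually_ge_at_top)
  ultimately have "\<forall>\<^sub>F n in sequentially. norm (win n (nat \<lfloor>(1 - \<epsilon>) * real (thr n)\<rfloor>) - 0) < r"
    using win_sharp[OF \<delta>(1) \<eta>(1,2)]
  proof eventually_elim
    case (elim n)
    define s where "s = nat \<lfloor>(1 - \<epsilon>) * real (thr n)\<rfloor>"
    have lower: "real n \<le> 3 * real (thr n)" using thr_lower[OF elim(2)] by linarith
    have \<epsilon>n: "6 \<le> \<epsilon> * real n" using elim(1) assms by (simp add: field_simps)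
    have "\<epsilon> * real n \<le> \<epsilon> * (3 * real (thr n))" using lower assms by (intro mult_left_mono) auto
    moreover have "\<eta> * real n \<le> \<epsilon> / 6 * real n" using \<eta> by (intro mult_right_mono) auto
    ultimately have *: "\<eta> * real n \<le> \<epsilon> * real (thr n) - 1" using \<epsilon>n by simp
    have exp: "(1 - \<epsilon>) * real (thr n) = real (thr n) - \<epsilon> * real (thr n)" by (simp add: algebra_simps)
    have \<eta>0: "0 \<le> \<eta> * real n" using \<eta> by simp
    have thr1: "thr n \<ge> 1" using lower elim(2) by linarith
    have "win n s < \<delta>"
    proof (rule ccontr)
      assume "\<not> win n s < \<delta>"
      then have ws: "\<delta> \<le> win n s" by simp
      \<comment> \<open>This excludes s = 0, the value that \<open>nat\<close> gives to a negative
        product when \<epsilon> > 1.\<close>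
      then have "n \<le> 2 * s + 1" using \<delta> by (intro win_pos_imp[OF elim(2)]) simp
      then have "s \<ge> 1" using elim(2) by linarith
      then have "real s \<le> real (thr n) - \<epsilon> * real (thr n)" unfolding s_def exp by linarith
      then have "s + nat \<lfloor>\<eta> * real n\<rfloor> < thr n" "s \<le> thr n" using * \<eta>0 by linarith+
      then have "win n (s + nat \<lfloor>\<eta> * real n\<rfloor>) < 1 / 2" "s \<le> 21 * n"
        using win_less_imp thr_upper[OF elim(2)] by auto
      then show False using elim(3) ws \<delta> by fastforce
    qed
    then show ?case using win_nonneg[OF elim(2), of s] \<delta> by (simp add: s_def)
  qed
  then show "\<exists>no. \<forall>n\<ge>no. norm (win n (nat \<lfloor>(1 - \<epsilon>) * real (thr n)\<rfloor>) - 0) < r"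
    by (simp add: eventually_sequentially)
qed

end

section \<open>Independent blocks and linear growth\<close>

context target_family
begin

text \<open>For a block of \<open>n\<close> vertices among N, taken at \<rho> = 1 / N: the least
  expected distance of the block after \<open>t\<close> steps of the whole process, including those
  that miss it.\<close>

definition lazy_deficit :: "real \<Rightarrow> nat \<Rightarrow> nat \<Rightarrow> real" where
  "lazy_deficit \<rho> n t = - (lazy_step \<rho> n ^^ t) (neg_distance (F n)) {}"

text \<open>Each square is answered inside its own block by that block's optimal strategy and is an
  idle step for the other block; the common rate per vertex makes the two recursions add up. The 2
  edges of \<open>glue\<close> are lost only once, at the final graph, which is the base case
  here.\<close>

lemma lazy_iter_glue:
  assumes n: "n\<^sub>1 \<ge> 3" "n\<^sub>2 \<ge> 3" and \<rho>: "\<rho> \<ge> 0" "\<rho> * real (n\<^sub>1 + n\<^sub>2) \<le> 1"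
  shows "(lazy_step \<rho> n\<^sub>1 ^^ t) (neg_distance (F n\<^sub>1)) E\<^sub>1 + (lazy_step \<rho> n\<^sub>2 ^^ t) (neg_distance (F n\<^sub>2)) E\<^sub>2 - 2
    \<le> (lazy_step \<rho> (n\<^sub>1 + n\<^sub>2) ^^ t) (neg_distance (F (n\<^sub>1 + n\<^sub>2))) (E\<^sub>1 \<union> (`) ((+) n\<^sub>1) ` E\<^sub>2)"
proof (induction t arbitrary: E\<^sub>1 E\<^sub>2)
  case 0
  obtain H\<^sub>1 where H\<^sub>1: "H\<^sub>1 \<in> F n\<^sub>1" "edge_distance (F n\<^sub>1) E\<^sub>1 = card (H\<^sub>1 - E\<^sub>1)"
    using edge_distance_attained[OF nonempty[OF n(1)]] .
  obtain H\<^sub>2 where H\<^sub>2: "H\<^sub>2 \<in> F n\<^sub>2" "edge_distance (F n\<^sub>2) E\<^sub>2 = card (H\<^sub>2 - E\<^sub>2)"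
    using edge_distance_attained[OF nonempty[OF n(2)]] .
  obtain H where H: "H \<in> F (n\<^sub>1 + n\<^sub>2)"
    "card (H - (E\<^sub>1 \<union> (`) ((+) n\<^sub>1) ` E\<^sub>2)) \<le> card (H\<^sub>1 - E\<^sub>1) + card (H\<^sub>2 - E\<^sub>2) + 2"
    using glue[OF n H\<^sub>1(1) H\<^sub>2(1)] by blast
  show ?case
    using edge_distance_le[OF H(1), of "E\<^sub>1 \<union> (`) ((+) n\<^sub>1) ` E\<^sub>2"] H(2) H\<^sub>1(2) H\<^sub>2(2) by simp
next
  case (Suc t)
  let ?N = "n\<^sub>1 + n\<^sub>2"
  define f\<^sub>1 where "f\<^sub>1 = (lazy_step \<rho> n\<^sub>1 ^^ t) (neg_distance (F n\<^sub>1))"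
  define f\<^sub>2 where "f\<^sub>2 = (lazy_step \<rho> n\<^sub>2 ^^ t) (neg_distance (F n\<^sub>2))"
  define f where "f = (lazy_step \<rho> ?N ^^ t) (neg_distance (F ?N))"
  define glued where "glued E\<^sub>1 E\<^sub>2 = E\<^sub>1 \<union> (`) ((+) n\<^sub>1) ` E\<^sub>2" for E\<^sub>1 E\<^sub>2 :: "nat set set"
  have IH: "f\<^sub>1 E\<^sub>1 + f\<^sub>2 E\<^sub>2 - 2 \<le> f (glued E\<^sub>1 E\<^sub>2)" for E\<^sub>1 E\<^sub>2
    unfolding f\<^sub>1_def f\<^sub>2_def f_def glued_def by (rule Suc.IH)
  define M\<^sub>1 where "M\<^sub>1 u = (MAX v\<in>{1..n\<^sub>1}. f\<^sub>1 (insert {u, v} E\<^sub>1))" for u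
  define M\<^sub>2 where "M\<^sub>2 u = (MAX v\<in>{1..n\<^sub>2}. f\<^sub>2 (insert {u, v} E\<^sub>2))" for u
  define g where "g u = (if u \<le> n\<^sub>1 then M\<^sub>1 u + f\<^sub>2 E\<^sub>2 - 2 else f\<^sub>1 E\<^sub>1 + M\<^sub>2 (u - n\<^sub>1) - 2)" for u
  have ex: "\<exists>v\<in>{1..m}. Max (h ` {1..m}) = h v" if "m \<ge> 3" for m and h :: "nat \<Rightarrow> real"
  proof -
    have "Max (h ` {1..m}) \<in> h ` {1..m}" using that by (intro Max_in) auto
    then show ?thesis by blast
  qed
  have "(1 - \<rho> * real ?N) * (f\<^sub>1 E\<^sub>1 + f\<^sub>2 E\<^sub>2 - 2) + \<rho> * (\<Sum>u\<in>{1..?N}. g u) \<le> lazy_step \<rho> ?N f (glued E\<^sub>1 E\<^sub>2)"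
  proof (rule lazy_step_ge)
    fix u assume u: "u \<in> {1..?N}"
    show "\<exists>v\<in>{1..?N}. g u \<le> f (insert {u, v} (glued E\<^sub>1 E\<^sub>2))"
    proof (cases "u \<le> n\<^sub>1")
      case True
      obtain v where v: "v \<in> {1..n\<^sub>1}" "M\<^sub>1 u = f\<^sub>1 (insert {u, v} E\<^sub>1)"
        using ex[OF n(1)] unfolding M\<^sub>1_def by blast
      have "insert {u, v} (glued E\<^sub>1 E\<^sub>2) = glued (insert {u, v} E\<^sub>1) E\<^sub>2" by (simp add: glued_def)
      then show ?thesis
        using True v IH[of "insert {u, v} E\<^sub>1" E\<^sub>2] by (intro bexI[of _ v]) (auto simp: g_def)
    next
      case False
      obtain v where v: "v \<in> {1..n\<^sub>2}" "M\<^sub>2 (u - n\<^sub>1) = f\<^sub>2 (insert {u - n\<^sub>1, v} E\<^sub>2)"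
        using ex[OF n(2)] unfolding M\<^sub>2_def by blast
      have "insert {u, n\<^sub>1 + v} (glued E\<^sub>1 E\<^sub>2) = glued E\<^sub>1 (insert {u - n\<^sub>1, v} E\<^sub>2)"
        using False by (simp add: glued_def)
      then show ?thesis
        using False v IH[of E\<^sub>1 "insert {u - n\<^sub>1, v} E\<^sub>2"] by (intro bexI[of _ "n\<^sub>1 + v"]) (auto simp: g_def)
    qed
  qed (use n \<rho> IH in auto)
  moreover have "(\<Sum>u\<in>{1..?N}. g u) = (\<Sum>u\<in>{1..n\<^sub>1}. M\<^sub>1 u + (f\<^sub>2 E\<^sub>2 - 2)) + (\<Sum>u\<in>{1..n\<^sub>2}. M\<^sub>2 u + (f\<^sub>1 E\<^sub>1 - 2))"
  proof -
    have "(\<Sum>u\<in>{1..?N}. g u) = (\<Sum>u\<in>{1..n\<^sub>1}. g u) + (\<Sum>u\<in>{n\<^sub>1 + 1..n\<^sub>1 + n\<^sub>2}. g u)"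
      by (rule sum.ub_add_nat) simp
    also have "(\<Sum>u\<in>{n\<^sub>1 + 1..n\<^sub>1 + n\<^sub>2}. g u) = (\<Sum>u\<in>{1..n\<^sub>2}. g (u + n\<^sub>1))"
      using sum.shift_bounds_cl_nat_ivl[of g 1 n\<^sub>1 n\<^sub>2] by (simp add: add.commute)
    also have "\<dots> = (\<Sum>u\<in>{1..n\<^sub>2}. M\<^sub>2 u + (f\<^sub>1 E\<^sub>1 - 2))" by (intro sum.cong) (auto simp: g_def)
    also have "(\<Sum>u\<in>{1..n\<^sub>1}. g u) = (\<Sum>u\<in>{1..n\<^sub>1}. M\<^sub>1 u + (f\<^sub>2 E\<^sub>2 - 2))" by (intro sum.cong) (auto simp: g_def)
    finally show ?thesis .
  qed
  moreover have "(1 - \<rho> * real ?N) * (f\<^sub>1 E\<^sub>1 + f\<^sub>2 E\<^sub>2 - 2) +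
      \<rho> * ((\<Sum>u\<in>{1..n\<^sub>1}. M\<^sub>1 u + (f\<^sub>2 E\<^sub>2 - 2)) + (\<Sum>u\<in>{1..n\<^sub>2}. M\<^sub>2 u + (f\<^sub>1 E\<^sub>1 - 2)))
    = lazy_step \<rho> n\<^sub>1 f\<^sub>1 E\<^sub>1 + lazy_step \<rho> n\<^sub>2 f\<^sub>2 E\<^sub>2 - 2"
    unfolding lazy_step_def M\<^sub>1_def[symmetric] M\<^sub>2_def[symmetric] sum.distrib by (simp add: algebra_simps)
  ultimately show ?case by (simp add: f\<^sub>1_def f\<^sub>2_def f_def glued_def)
qed

lemma lazy_deficit_blocks:
  assumes N: "N \<ge> 3" "r \<ge> 3" and \<rho>: "\<rho> \<ge> 0" "\<rho> * real (q * N + r) \<le> 1"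
  shows "lazy_deficit \<rho> (q * N + r) t \<le> real q * (lazy_deficit \<rho> N t + 2) + real r"
  using \<rho>(2)
proof (induction q)
  case 0
  have "neg_distance (F r) {} \<le> (lazy_step \<rho> r ^^ t) (neg_distance (F r)) {}"
    using lazy_iter_increasing[of r \<rho> "neg_distance (F r)" 0 t] slow_neg_distance[of r] N \<rho>(1) 0
    by (simp add: slow_def)
  then show ?case
    using edge_distance_le_size[OF N(2), of "{}"] by (simp add: lazy_deficit_def)
next
  case (Suc q)
  have "\<rho> * real (q * N + r) \<le> \<rho> * real (Suc q * N + r)" using \<rho>(1) by (intro mult_left_mono) auto
  then have IH: "lazy_deficit \<rho> (q * N + r) t \<le> real q * (lazy_deficit \<rho> N t + 2) + real r"
    using Suc.prems by (intro Suc.IH) linarith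
  have "lazy_deficit \<rho> (Suc q * N + r) t \<le> lazy_deficit \<rho> N t + lazy_deficit \<rho> (q * N + r) t + 2"
    using lazy_iter_glue[OF N(1), of "q * N + r" \<rho> t "{}" "{}"] N Suc.prems \<rho>(1)
    by (simp add: lazy_deficit_def add.assoc)
  then show ?case using IH by (simp add: algebra_simps)
qed

lemma lazy_deficit_le_deficit:
  assumes "N \<ge> 3" "\<rho> \<ge> 0" "\<rho> * real N \<le> 1" "y > 0"
  shows "lazy_deficit \<rho> N t \<le> deficit N m +
     (((real m - real t * (\<rho> * real N))\<^sup>2 + real t * (\<rho> * real N) * (1 - \<rho> * real N)) / (2 * y) + y / 2)"
  using lazy_iter_ge_opt_iter[of N \<rho> "neg_distance (F N)" y m "{}" t] assms slow_neg_distance[of N]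
  by (simp add: lazy_deficit_def deficit_def)

text \<open>At this time a block has received about thr N squares. Its deficit and the loss from
  fluctuations of that number are both O(sqrt N), and about n/N blocks add up to n / sqrt N. The
  condition N^2 <= n makes the leftover vertices fit into the same bound.\<close>

lemma deficit_blocks:
  assumes N: "N \<ge> 3" and n: "N ^ 2 \<le> n" and t: "t = nat \<lceil>real (thr N) * real n / real N\<rceil>"
  shows "deficit n t \<le> 32 * real n / sqrt (real N)"
proof -
  define m where "m = thr N"
  \<comment> \<open>One block fewer than fits, so that the remainder has between N and 2N vertices,
    hence at least 3.\<close>
  define q where "q = n div N - 1"
  define r where "r = n - q * N"
  have Nn: "N \<le> n" using n N self_le_power[of N 2] by simp
  have "n div N \<ge> 1" using Nn N by (simp add: div_greater_zero_iff Suc_leI)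
  then have nq: "n = (q + 1) * N + n mod N" unfolding q_def by simp
  have r: "n = q * N + r" "N \<le> r" "r \<le> 2 * N"
  proof -
    have "n mod N < N" using N by simp
    moreover have "n = q * N + (N + n mod N)" using nq by simp
    ultimately show "n = q * N + r" "N \<le> r" "r \<le> 2 * N" unfolding r_def by linarith+
  qed
  define \<rho> where "\<rho> = 1 / real n"
  have \<rho>: "\<rho> \<ge> 0" "\<rho> * real n = 1" "\<rho> * real N \<le> 1" using N Nn by (auto simp: \<rho>_def)
  have m1: "m \<ge> 1" using thr_lower[OF N] N by (simp add: m_def)
  \<comment> \<open>Balances the two AM-GM terms, as the variance of the number of squares in the
    block is at most about m.\<close>
  define y where "y = sqrt (real m)"
  have y: "y \<ge> 1" "y\<^sup>2 = real m" using m1 by (auto simp: y_def)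
  \<comment> \<open>The mean number of squares in the block; rounding \<open>t\<close> up adds at
    most 1.\<close>
  define z where "z = real t * (\<rho> * real N)"
  have z: "real m \<le> z" "z \<le> real m + 1"
  proof -
    define c where "c = real m * real n / real N"
    have c: "c \<ge> 0" "c * (\<rho> * real N) = real m" using N Nn by (auto simp: c_def \<rho>_def)
    have tc: "c \<le> real t" "real t \<le> c + 1"
      using c(1) unfolding t m_def[symmetric] c_def[symmetric] by linarith+
    have \<rho>N: "0 \<le> \<rho> * real N" using \<rho> by simp
    show "real m \<le> z" using mult_right_mono[OF tc(1) \<rho>N] c(2) by (simp add: z_def)
    show "z \<le> real m + 1"
      using mult_right_mono[OF tc(2) \<rho>N] c(2) \<rho>(3) by (simp add: z_def distrib_right)
  qed
  have "lazy_deficit \<rho> N t \<le> deficit N m + (((real m - z)\<^sup>2 + z * (1 - \<rho> * real N)) / (2 * y) + y / 2)"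
    unfolding z_def using N \<rho> y by (intro lazy_deficit_le_deficit) auto
  also have "deficit N m \<le> 3 / 2 * y"
  proof -
    have "deficit N m \<le> sqrt (real m / (1 / 2))"
      using win_thr[OF N] by (intro deficit_le_sqrt[OF N]) (auto simp: m_def)
    also have "\<dots> \<le> 3 / 2 * y" using y by (intro real_le_lsqrt) (auto simp: power_mult_distrib power_divide)
    finally show ?thesis .
  qed
  also have "((real m - z)\<^sup>2 + z * (1 - \<rho> * real N)) / (2 * y) \<le> (y\<^sup>2 + 2) / (2 * y)"
  proof (rule divide_right_mono)
    have "(real m - z)\<^sup>2 \<le> 1" using z by (simp add: abs_square_le_1)
    moreover have "z * (1 - \<rho> * real N) \<le> z * 1" using z \<rho> N by (intro mult_left_mono) auto
    ultimately show "(real m - z)\<^sup>2 + z * (1 - \<rho> * real N) \<le> y\<^sup>2 + 2" using z y by simp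
  qed (use y in simp)
  also have "(y\<^sup>2 + 2) / (2 * y) \<le> y / 2 + 1" using y by (simp add: field_simps power2_eq_square)
  \<comment> \<open>The terms add up to 5/2 y + 3, and y >= 1.\<close>
  finally have "lazy_deficit \<rho> N t + 2 \<le> 11 / 2 * y" using y by simp
  also have "11 / 2 * y \<le> 30 * sqrt (real N)"
  proof -
    have "y \<le> sqrt (21 * real N)"
      unfolding y_def m_def using thr_upper[OF N] by simp
    also have "\<dots> \<le> sqrt (5\<^sup>2 * real N)" by (intro real_sqrt_le_mono mult_right_mono) auto
    also have "\<dots> = 5 * sqrt (real N)" unfolding real_sqrt_mult by simp
    moreover have "0 \<le> sqrt (real N)" by simp
    ultimately show ?thesis by linarith
  qed
  finally have "real q * (lazy_deficit \<rho> N t + 2) \<le> real q * (30 * sqrt (real N))"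
    by (rule mult_left_mono) simp
  moreover have "lazy_deficit \<rho> n t \<le> real q * (lazy_deficit \<rho> N t + 2) + real r"
    unfolding r(1) using N r \<rho> by (intro lazy_deficit_blocks) (auto simp flip: r(1))
  moreover have "real q * (30 * sqrt (real N)) \<le> 30 * (real n / sqrt (real N))"
  proof -
    have "real q * real N \<le> real n" using r(1) by (metis le_add1 of_nat_le_iff of_nat_mult)
    then have "real q * real N / sqrt (real N) \<le> real n / sqrt (real N)"
      by (rule divide_right_mono) simp
    moreover have "real N / sqrt (real N) = sqrt (real N)" by (simp add: real_div_sqrt)
    ultimately show ?thesis by (simp flip: times_divide_eq_right)
  qed
  moreover have "real r \<le> 2 * (real n / sqrt (real N))"
  proof -
    have sN: "sqrt (real N) \<le> real N" using N by (intro real_le_lsqrt) (auto simp: power2_eq_square)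
    have "real N * sqrt (real N) \<le> real N * real N" using sN by (intro mult_left_mono) auto
    also have "\<dots> \<le> real n" using n by (simp add: power2_eq_square flip: of_nat_mult)
    finally have "real N \<le> real n / sqrt (real N)" using N by (simp add: field_simps)
    then show ?thesis using r(3) by linarith
  qed
  ultimately show ?thesis by (simp add: deficit_def lazy_deficit_def \<rho>_def)
qed

text \<open>The block threshold is scaled up by n/N, and a repair of \<epsilon> n steps follows. The
  second \<epsilon> absorbs the rounding, as 1 <= \<epsilon> n.\<close>

lemma thr_ratio_le:
  assumes \<epsilon>: "0 < \<epsilon>" "\<epsilon> \<le> 1" and N: "N \<ge> 3" "sqrt (real N) \<ge> 32 * (2000 / \<epsilon>)\<^sup>2" and n: "N ^ 2 \<le> n"
    and n': "real n \<ge> 1 / \<epsilon>"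
  shows "real (thr n) / real n \<le> real (thr N) / real N + 2 * \<epsilon>"
proof -
  have Nn: "N \<le> n" using n N self_le_power[of N 2] by simp
  have n3: "n \<ge> 3" using Nn N by simp
  define t where "t = nat \<lceil>real (thr N) * real n / real N\<rceil>"
  \<comment> \<open>Then 400 sqrt (n b) / s = (\<epsilon> n / 5) / s <= 2/5 for s >= \<epsilon> n /
    2, below the allowed loss 1/2.\<close>
  define b where "b = (\<epsilon> / 2000)\<^sup>2 * real n"
  define s where "s = nat \<lfloor>\<epsilon> * real n\<rfloor>"
  have b0: "b > 0" using \<epsilon> n3 by (simp add: b_def)
  have sN: "sqrt (real N) > 0" using N by simp
  have "deficit n t \<le> 32 * real n / sqrt (real N)"
    by (rule deficit_blocks[OF N(1) n t_def])
  also have "\<dots> \<le> b"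
  proof -
    have "32 * (2000 / \<epsilon>)\<^sup>2 * (\<epsilon> / 2000)\<^sup>2 \<le> sqrt (real N) * (\<epsilon> / 2000)\<^sup>2"
      using N(2) by (rule mult_right_mono) simp
    moreover have "32 * (2000 / \<epsilon>)\<^sup>2 * (\<epsilon> / 2000)\<^sup>2 = 32"
      using \<epsilon> by (simp add: power_divide)
    ultimately have "32 * real n \<le> (sqrt (real N) * (\<epsilon> / 2000)\<^sup>2) * real n"
      by (intro mult_right_mono) auto
    then show ?thesis using sN by (simp add: b_def divide_le_eq mult_ac)
  qed
  finally have b: "deficit n t \<le> b" .
  have en: "\<epsilon> * real n \<ge> 1" using n' \<epsilon> by (simp add: field_simps)
  have "\<epsilon> * real n \<le> 1 * real n" using \<epsilon> by (intro mult_right_mono) auto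
  then have s: "1 \<le> s" "s \<le> n" "real s \<ge> \<epsilon> * real n / 2" "real s \<le> \<epsilon> * real n"
  proof -
    have "\<lfloor>\<epsilon> * real n\<rfloor> \<ge> 1" using en by simp
    then have "real s = of_int \<lfloor>\<epsilon> * real n\<rfloor>" "real s \<ge> 1" unfolding s_def by auto
    with \<open>\<epsilon> * real n \<le> 1 * real n\<close> show "1 \<le> s" "s \<le> n" "real s \<ge> \<epsilon> * real n / 2" "real s \<le> \<epsilon> * real n"
      using floor_correct[of "\<epsilon> * real n"] by linarith+
  qed
  have "real n * b = (\<epsilon> / 2000 * real n)\<^sup>2" by (simp add: b_def power2_eq_square)
  then have sqrt: "sqrt (real n * b) = \<epsilon> / 2000 * real n" using \<epsilon> by (simp add: real_sqrt_unique)
  have "1 - 400 * (\<epsilon> / 2000 * real n) / real s \<le> win n (t + s)"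
    using win_after_repair[OF n3 b0 b s(1,2)] unfolding sqrt .
  moreover have "400 * (\<epsilon> / 2000 * real n) / real s \<le> 1 / 2"
    using s(1,3) by (simp add: divide_le_eq)
  ultimately have "thr n \<le> t + s" by (intro thr_le) simp
  then have "real (thr n) \<le> real t + real s" by linarith
  also have "real t \<le> real (thr N) * real n / real N + 1"
  proof -
    have "0 \<le> real (thr N) * real n / real N" by simp
    then show ?thesis unfolding t_def by linarith
  qed
  finally have "real (thr n) \<le> real (thr N) * real n / real N + 2 * \<epsilon> * real n" using s(4) en by simp
  then have "real (thr n) / real n \<le> (real (thr N) * real n / real N + 2 * \<epsilon> * real n) / real n"
    by (rule divide_right_mono) simp
  then show ?thesis using n3 by (simp add: add_divide_distrib)
qed

end

text \<open>The limit is the infimum of the eventual upper bounds, that is, the limit superior. For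
  large N each x N + \<epsilon> is such a bound, so x N cannot fall more than \<epsilon> below it.
  The filters are nested because how large \<open>n\<close> must be depends on
  \<open>N\<close>.\<close>

lemma convergent_if_almost_decreasing:
  fixes x :: "nat \<Rightarrow> real"
  assumes lower: "\<forall>\<^sub>F n in sequentially. c \<le> x n"
    and decr: "\<And>\<epsilon>. \<epsilon> > 0 \<Longrightarrow> \<forall>\<^sub>F N in sequentially. \<forall>\<^sub>F n in sequentially. x n \<le> x N + \<epsilon>"
  shows "\<exists>l\<ge>c. x \<longlonglongrightarrow> l"
proof -
  define A where "A = {a. \<forall>\<^sub>F n in sequentially. x n \<le> a}"
  have Ac: "c \<le> a" if "a \<in> A" for a
  proof -
    have "\<forall>\<^sub>F n in sequentially. c \<le> a"
      using lower that unfolding A_def mem_Collect_eq by eventually_elim linarith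
    then show ?thesis by simp
  qed
  have "\<exists>N. \<forall>\<^sub>F n in sequentially. x n \<le> x N + 1"
    using eventually_happens'[OF sequentially_bot decr[of 1]] by simp
  then have ne: "A \<noteq> {}" unfolding A_def by blast
  have bdd: "bdd_below A" using Ac by (intro bdd_belowI)
  define l where "l = Inf A"
  have "c \<le> l" unfolding l_def using ne Ac by (rule cInf_greatest)
  moreover have "x \<longlonglongrightarrow> l"
  proof (rule tendstoI)
    fix e :: real assume e: "e > 0"
    obtain a where a: "a \<in> A" "a < l + e"
      using cInf_lessD[OF ne, of "l + e"] e unfolding l_def by auto
    have "\<forall>\<^sub>F n in sequentially. x n \<le> a" using a(1) by (simp add: A_def)
    moreover have "\<forall>\<^sub>F N in sequentially. l - e / 2 \<le> x N"
    proof -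
      have "\<forall>\<^sub>F N in sequentially. \<forall>\<^sub>F n in sequentially. x n \<le> x N + e / 2"
        using e by (intro decr) simp
      then show ?thesis
      proof eventually_elim
        case (elim N)
        then have "x N + e / 2 \<in> A" by (simp add: A_def)
        then have "l \<le> x N + e / 2" unfolding l_def using bdd by (rule cInf_lower)
        then show ?case by simp
      qed
    qed
    ultimately show "\<forall>\<^sub>F n in sequentially. dist (x n) l < e"
      by eventually_elim (use a(2) e in \<open>auto simp: dist_real_def abs_if\<close>)
  qed
  ultimately show ?thesis by blast
qed

lemma (in target_family) thr_linear: "\<exists>C>0. (\<lambda>n. real (thr n) / real n) \<longlonglongrightarrow> C"
proof -
  have "\<exists>l\<ge>1/3. (\<lambda>n. real (thr n) / real n) \<longlonglongrightarrow> l"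
  proof (rule convergent_if_almost_decreasing)
    have "\<forall>\<^sub>F n in sequentially. n \<ge> (3::nat)" by (rule eventually_ge_at_top)
    then show "\<forall>\<^sub>F n in sequentially. 1 / 3 \<le> real (thr n) / real n"
    proof eventually_elim
      case (elim n)
      then have "real n \<le> 3 * real (thr n)" using thr_lower[OF elim] by linarith
      then show ?case using elim by (simp add: field_simps)
    qed
    fix \<epsilon> :: real assume "\<epsilon> > 0"
    define \<delta> where "\<delta> = min 1 (\<epsilon> / 2)"
    have \<delta>: "0 < \<delta>" "\<delta> \<le> 1" "2 * \<delta> \<le> \<epsilon>" using \<open>\<epsilon> > 0\<close> by (auto simp: \<delta>_def)
    have "filterlim (\<lambda>N. sqrt (real N)) at_top sequentially"
      by (rule filterlim_compose[OF sqrt_at_top filterlim_real_sequentially])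
    then have "\<forall>\<^sub>F N in sequentially. sqrt (real N) \<ge> 32 * (2000 / \<delta>)\<^sup>2"
      by (simp add: filterlim_at_top)
    moreover have "\<forall>\<^sub>F N in sequentially. N \<ge> (3::nat)" by (rule eventually_ge_at_top)
    ultimately show "\<forall>\<^sub>F N in sequentially. \<forall>\<^sub>F n in sequentially.
        real (thr n) / real n \<le> real (thr N) / real N + \<epsilon>"
    proof eventually_elim
      case (elim N)
      have "\<forall>\<^sub>F n in sequentially. N ^ 2 \<le> n" by (rule eventually_ge_at_top)
      moreover have "\<forall>\<^sub>F n in sequentially. real n \<ge> 1 / \<delta>"
        by (rule eventually_sequentiallyI[of "nat \<lceil>1 / \<delta>\<rceil>"]) linarith
      ultimately show ?case
      proof eventually_elim
        case n: (elim n)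
        show ?case using thr_ratio_le[OF \<delta>(1,2) elim(2,1) n] \<delta>(3) by linarith
      qed
    qed
  qed
  then obtain l where "l \<ge> 1 / 3" "(\<lambda>n. real (thr n) / real n) \<longlonglongrightarrow> l" by blast
  then show ?thesis by (intro exI[of _ l]) auto
qed

section \<open>Strategies\<close>

text \<open>Forgets multiplicities, on which neither property depends.\<close>

definition edge_set :: "history \<Rightarrow> nat set set" where
  "edge_set h = set_mset (graph_of h)"

lemma edge_set_Nil [simp]: "edge_set [] = {}"
  by (simp add: edge_set_def graph_of_def)

lemma edge_set_snoc [simp]: "edge_set (h @ [(u, v)]) = insert {u, v} (edge_set h)"
  by (simp add: edge_set_def graph_of_def)

lemma edge_set_take: "edge_set (take s h) \<subseteq> edge_set h"
  unfolding edge_set_def graph_of_def by (auto dest: in_set_takeD)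

lemma set_pmf_process:
  assumes "n \<ge> 1" "is_strategy n S" "h \<in> set_pmf (process n S t)"
  shows "length h = t \<and> set h \<subseteq> {1..n} \<times> {1..n}"
  using assms(3)
proof (induction t arbitrary: h)
  case (Suc t)
  then obtain h' u v where h': "h' \<in> set_pmf (process n S t)" "u \<in> {1..n}" "v \<in> set_pmf (S h' u)" "h = h' @ [(u, v)]"
    using assms(1) by (auto simp: set_pmf_of_set)
  moreover have "v \<in> {1..n}"
    using Suc.IH[OF h'(1)] h'(2,3) assms(2) unfolding is_strategy_def by blast
  ultimately show ?case using Suc.IH[OF h'(1)] by auto
qed simp

lemma nn_integral_uniform:
  assumes n1: "n \<ge> 1" and g: "\<And>u. u \<in> {1..n} \<Longrightarrow> 0 \<le> g u"
  shows "(\<integral>\<^sup>+u. ennreal (g u) \<partial>pmf_of_set {1..n}) = ennreal ((\<Sum>u\<in>{1..n}. g u) / real n)"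
proof -
  have "(\<integral>\<^sup>+u. ennreal (g u) \<partial>pmf_of_set {1..n}) = (\<Sum>u\<in>{1..n}. ennreal (g u)) / of_nat n"
    using n1 by (subst nn_integral_pmf_of_set) auto
  also have "(\<Sum>u\<in>{1..n}. ennreal (g u)) = ennreal (\<Sum>u\<in>{1..n}. g u)"
    using g by (rule sum_ennreal)
  also have "of_nat n = ennreal (real n)" by (simp add: ennreal_of_nat_eq_real_of_nat)
  also have "ennreal (\<Sum>u\<in>{1..n}. g u) / ennreal (real n) = ennreal ((\<Sum>u\<in>{1..n}. g u) / real n)"
    using n1 g by (intro divide_ennreal sum_nonneg) auto
  finally show ?thesis .
qed

lemma opt_step_nonneg:
  assumes "n \<ge> 1" "\<And>E. 0 \<le> f E"
  shows "0 \<le> opt_step n f E"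
  unfolding opt_step_eq[OF assms(1)] using assms
  by (intro divide_nonneg_nonneg sum_nonneg Max_image_ge[of 1]) auto

text \<open>The induction peels off the last step and replaces \<open>f\<close> by one optimal step
  of \<open>f\<close>. Randomized and history-dependent replies are covered: given history and
  square, the mean over the circle is at most the maximum.\<close>

lemma strategy_le_opt_iter:
  assumes n1: "n \<ge> 1" and S: "is_strategy n S" and f: "\<And>E. 0 \<le> f E"
  shows "(\<integral>\<^sup>+h. ennreal (f (edge_set h)) \<partial>process n S t) \<le> ennreal ((opt_step n ^^ t) f {})"
  using f
proof (induction t arbitrary: f)
  case (Suc t)
  have "(\<integral>\<^sup>+h. ennreal (f (edge_set h)) \<partial>process n S (Suc t))
      \<le> (\<integral>\<^sup>+h. ennreal (opt_step n f (edge_set h)) \<partial>process n S t)"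
    unfolding process.simps nn_integral_bind_pmf
  proof (intro nn_integral_mono_AE AE_pmfI)
    fix h assume h: "h \<in> set_pmf (process n S t)"
    define M where "M u = (MAX v\<in>{1..n}. f (insert {u, v} (edge_set h)))" for u
    have M: "0 \<le> M u" for u
      unfolding M_def using n1 Suc.prems by (intro Max_image_ge[of 1]) auto
    have "(\<integral>\<^sup>+u. \<integral>\<^sup>+v. \<integral>\<^sup>+h'. ennreal (f (edge_set h')) \<partial>return_pmf (h @ [(u, v)]) \<partial>S h u \<partial>pmf_of_set {1..n})
        \<le> (\<integral>\<^sup>+u. ennreal (M u) \<partial>pmf_of_set {1..n})"
    proof (intro nn_integral_mono_AE AE_pmfI)
      fix u assume "u \<in> set_pmf (pmf_of_set {1..n})"
      then have u: "u \<in> {1..n}" using n1 by (simp add: set_pmf_of_set)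
      have "(\<integral>\<^sup>+v. \<integral>\<^sup>+h'. ennreal (f (edge_set h')) \<partial>return_pmf (h @ [(u, v)]) \<partial>S h u)
          \<le> (\<integral>\<^sup>+v. ennreal (M u) \<partial>S h u)"
      proof (intro nn_integral_mono_AE AE_pmfI)
        fix v assume "v \<in> set_pmf (S h u)"
        then have "v \<in> {1..n}"
          using set_pmf_process[OF n1 S h] u S unfolding is_strategy_def by blast
        then have "f (insert {u, v} (edge_set h)) \<le> M u"
          unfolding M_def by (intro Max_image_ge[of v]) auto
        then show "(\<integral>\<^sup>+h'. ennreal (f (edge_set h')) \<partial>return_pmf (h @ [(u, v)])) \<le> ennreal (M u)"
          by (simp add: ennreal_leI)
      qed
      then show "(\<integral>\<^sup>+v. \<integral>\<^sup>+h'. ennreal (f (edge_set h')) \<partial>return_pmf (h @ [(u, v)]) \<partial>S h u) \<le> ennreal (M u)"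
        by simp
    qed
    also have "\<dots> = ennreal (opt_step n f (edge_set h))"
      unfolding opt_step_eq[OF n1] M_def[symmetric] using M by (rule nn_integral_uniform[OF n1])
    finally show "(\<integral>\<^sup>+u. \<integral>\<^sup>+v. \<integral>\<^sup>+h'. ennreal (f (edge_set h')) \<partial>return_pmf (h @ [(u, v)]) \<partial>S h u \<partial>pmf_of_set {1..n})
        \<le> ennreal (opt_step n f (edge_set h))" .
  qed
  also have "\<dots> \<le> ennreal ((opt_step n ^^ t) (opt_step n f) {})"
    using Suc.prems by (intro Suc.IH opt_step_nonneg[OF n1])
  finally show ?case by (simp add: funpow_swap1)
qed simp

definition best_circle :: "nat \<Rightarrow> (nat set set \<Rightarrow> real) \<Rightarrow> nat set set \<Rightarrow> nat \<Rightarrow> nat" where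
  "best_circle n f E u = (SOME v. v \<in> {1..n} \<and> f (insert {u, v} E) = (MAX v\<in>{1..n}. f (insert {u, v} E)))"

lemma best_circle:
  assumes "n \<ge> 1"
  shows "best_circle n f E u \<in> {1..n}"
    "f (insert {u, best_circle n f E u} E) = (MAX v\<in>{1..n}. f (insert {u, v} E))"
proof -
  have "(MAX v\<in>{1..n}. f (insert {u, v} E)) \<in> (\<lambda>v. f (insert {u, v} E)) ` {1..n}"
    using assms by (intro Max_in) auto
  then have "\<exists>v. v \<in> {1..n} \<and> f (insert {u, v} E) = (MAX v\<in>{1..n}. f (insert {u, v} E))" by force
  from someI_ex[OF this] show "best_circle n f E u \<in> {1..n}"
    "f (insert {u, best_circle n f E u} E) = (MAX v\<in>{1..n}. f (insert {u, v} E))"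
    unfolding best_circle_def by blast+
qed

text \<open>The horizon \<open>t\<close> is built in: after this move
  \<open>t - Suc (length h)\<close> steps remain, and the reply maximizes the value function for
  that many steps.\<close>

definition opt_strategy :: "nat \<Rightarrow> (nat set set \<Rightarrow> real) \<Rightarrow> nat \<Rightarrow> strategy" where
  "opt_strategy n f t h u =
     return_pmf (best_circle n ((opt_step n ^^ (t - Suc (length h))) f) (edge_set h) u)"

lemma is_strategy_opt_strategy: "n \<ge> 1 \<Longrightarrow> is_strategy n (opt_strategy n f t)"
  unfolding is_strategy_def opt_strategy_def using best_circle(1) by simp

lemma opt_iter_eq_opt_strategy:
  assumes n1: "n \<ge> 1" and f: "\<And>E. 0 \<le> f E"
  shows "ennreal ((opt_step n ^^ t) f {}) = (\<integral>\<^sup>+h. ennreal (f (edge_set h)) \<partial>process n (opt_strategy n f t) t)"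
proof -
  let ?S = "opt_strategy n f t"
  have nonneg: "0 \<le> (opt_step n ^^ k) f E" for k E
    by (induction k arbitrary: E) (auto intro: f opt_step_nonneg[OF n1])
  \<comment> \<open>The value with t - j steps to go has constant mean along the optimal process; j
    = 0 gives the iterate, j = t the expectation of \<open>f\<close>.\<close>
  have "(\<integral>\<^sup>+h. ennreal ((opt_step n ^^ (t - j)) f (edge_set h)) \<partial>process n ?S j) = ennreal ((opt_step n ^^ t) f {})"
    if "j \<le> t" for j
    using that
  proof (induction j)
    case (Suc j)
    let ?g = "(opt_step n ^^ (t - Suc j)) f"
    have "(\<integral>\<^sup>+h. ennreal (?g (edge_set h)) \<partial>process n ?S (Suc j))
      = (\<integral>\<^sup>+h. ennreal ((opt_step n ^^ (t - j)) f (edge_set h)) \<partial>process n ?S j)"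
      unfolding process.simps nn_integral_bind_pmf
    proof (intro nn_integral_cong_AE AE_pmfI)
      fix h assume "h \<in> set_pmf (process n ?S j)"
      then have h: "length h = j" using set_pmf_process[OF n1 is_strategy_opt_strategy[OF n1]] by blast
      have "(\<integral>\<^sup>+u. \<integral>\<^sup>+v. \<integral>\<^sup>+h'. ennreal (?g (edge_set h')) \<partial>return_pmf (h @ [(u, v)]) \<partial>?S h u \<partial>pmf_of_set {1..n})
        = (\<integral>\<^sup>+u. ennreal (MAX v\<in>{1..n}. ?g (insert {u, v} (edge_set h))) \<partial>pmf_of_set {1..n})"
        by (simp add: opt_strategy_def h best_circle(2)[OF n1])
      also have "\<dots> = ennreal (opt_step n ?g (edge_set h))"
        unfolding opt_step_eq[OF n1, of ?g] using n1 nonneg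
        by (intro nn_integral_uniform Max_image_ge[of 1]) auto
      also have "opt_step n ?g = (opt_step n ^^ (t - j)) f"
      proof -
        have "t - j = Suc (t - Suc j)" using Suc.prems by simp
        then show ?thesis by simp
      qed
      finally show "(\<integral>\<^sup>+u. \<integral>\<^sup>+v. \<integral>\<^sup>+h'. ennreal (?g (edge_set h')) \<partial>return_pmf (h @ [(u, v)]) \<partial>?S h u \<partial>pmf_of_set {1..n})
        = ennreal ((opt_step n ^^ (t - j)) f (edge_set h))" .
    qed
    then show ?case using Suc by simp
  qed simp
  from this[of t] show ?thesis by simp
qed

section \<open>Hitting probabilities and the median threshold\<close>

lemma hitting_time_le_iff:
  "hitting_time P n h \<le> enat t \<longleftrightarrow> (\<exists>s. 1 \<le> s \<and> s \<le> length h \<and> s \<le> t \<and> P n (graph_of (take s h)))"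
proof -
  define A where "A = {enat s | s. 1 \<le> s \<and> s \<le> length h \<and> P n (graph_of (take s h))}"
  have "Inf A \<le> enat t \<longleftrightarrow> (\<exists>a\<in>A. a \<le> enat t)"
  proof
    assume le: "Inf A \<le> enat t"
    then have "A \<noteq> {}" by (auto simp: Inf_enat_def)
    then have "Inf A \<in> A" unfolding Inf_enat_def by (auto intro: LeastI)
    then show "\<exists>a\<in>A. a \<le> enat t" using le by blast
  next
    assume "\<exists>a\<in>A. a \<le> enat t"
    then show "Inf A \<le> enat t" by (meson Inf_lower order_trans)
  qed
  also have "\<dots> \<longleftrightarrow> (\<exists>s. 1 \<le> s \<and> s \<le> length h \<and> s \<le> t \<and> P n (graph_of (take s h)))"
  proof
    assume "\<exists>a\<in>A. a \<le> enat t"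
    then obtain s where "enat s \<le> enat t" "1 \<le> s" "s \<le> length h" "P n (graph_of (take s h))"
      unfolding A_def by blast
    then show "\<exists>s. 1 \<le> s \<and> s \<le> length h \<and> s \<le> t \<and> P n (graph_of (take s h))"
      by (intro exI[of _ s]) simp
  next
    assume "\<exists>s. 1 \<le> s \<and> s \<le> length h \<and> s \<le> t \<and> P n (graph_of (take s h))"
    then obtain s where "enat s \<in> A" "s \<le> t" unfolding A_def by blast
    then show "\<exists>a\<in>A. a \<le> enat t" by (intro bexI[of _ "enat s"]) simp_all
  qed
  finally show ?thesis unfolding hitting_time_def A_def .
qed

locale target_property = target_family +
  fixes P :: graph_property
  assumes property_iff: "n \<ge> 3 \<Longrightarrow> P n G \<longleftrightarrow> (\<exists>H\<in>F n. H \<subseteq> set_mset G)"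
begin

text \<open>Containing a target is monotone in the edge set, so only the graph at time
  \<open>t\<close> matters.\<close>

lemma hit_prob_eq:
  assumes n3: "n \<ge> 3" and S: "is_strategy n S"
  shows "ennreal (hit_prob P n S t) = (\<integral>\<^sup>+h. ennreal (contains_indicator (F n) (edge_set h)) \<partial>process n S t)"
proof -
  have "ennreal (hit_prob P n S t) = emeasure (process n S t) {h. hitting_time P n h \<le> enat t}"
    by (simp add: hit_prob_def measure_pmf.emeasure_eq_measure)
  also have "\<dots> = (\<integral>\<^sup>+h. indicator {h. hitting_time P n h \<le> enat t} h \<partial>process n S t)"
    by simp
  also have "\<dots> = (\<integral>\<^sup>+h. ennreal (contains_indicator (F n) (edge_set h)) \<partial>process n S t)"
  proof (intro nn_integral_cong_AE AE_pmfI)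
    fix h assume "h \<in> set_pmf (process n S t)"
    then have h: "length h = t" using set_pmf_process[OF _ S] n3 by simp
    have P: "P n (graph_of h) \<longleftrightarrow> (\<exists>H\<in>F n. H \<subseteq> edge_set h)" for h
      using property_iff[OF n3] by (simp add: edge_set_def)
    have "hitting_time P n h \<le> enat t \<longleftrightarrow> (\<exists>H\<in>F n. H \<subseteq> edge_set h)"
    proof
      assume "hitting_time P n h \<le> enat t"
      then obtain s where "P n (graph_of (take s h))" unfolding hitting_time_le_iff by blast
      then obtain H where "H \<in> F n" "H \<subseteq> edge_set (take s h)" unfolding P by blast
      then show "\<exists>H\<in>F n. H \<subseteq> edge_set h" using edge_set_take[of s h] by (intro bexI[of _ H]) auto
    next
      assume H: "\<exists>H\<in>F n. H \<subseteq> edge_set h"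
      \<comment> \<open>Hitting times start at 1, so a target contained in the empty graph must be
        excluded; \<open>size\<close> does this.\<close>
      have "h \<noteq> []"
      proof
        assume "h = []"
        then have "{} \<in> F n" using H by auto
        then show False using size[of "{}" n] n3 by simp
      qed
      then show "hitting_time P n h \<le> enat t"
      proof -
        have "P n (graph_of (take t h))" using H P[of h] h by simp
        moreover have "1 \<le> t" using h \<open>h \<noteq> []\<close> by (cases h) auto
        ultimately show ?thesis unfolding hitting_time_le_iff using h by (intro exI[of _ t]) simp
      qed
    qed
    then show "indicator {h. hitting_time P n h \<le> enat t} h = ennreal (contains_indicator (F n) (edge_set h))"
      by (auto simp: contains_indicator_def indicator_def)
  qed
  finally show ?thesis .
qed

lemma hit_prob_nonneg: "0 \<le> hit_prob P n S t"
  by (simp add: hit_prob_def)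

lemma hit_prob_le_win:
  assumes "n \<ge> 3" "is_strategy n S"
  shows "hit_prob P n S t \<le> win n t"
proof -
  have "ennreal (hit_prob P n S t) \<le> ennreal (win n t)"
    unfolding hit_prob_eq[OF assms] win_def
    using assms by (intro strategy_le_opt_iter contains_indicator_bounds(1)) auto
  then show ?thesis using win_nonneg[OF assms(1)] by (simp add: ennreal_le_iff)
qed

lemma hit_prob_opt_strategy:
  assumes "n \<ge> 3"
  shows "hit_prob P n (opt_strategy n (contains_indicator (F n)) t) t = win n t"
proof -
  have "ennreal (hit_prob P n (opt_strategy n (contains_indicator (F n)) t) t) = ennreal (win n t)"
    using assms unfolding win_def
    by (subst hit_prob_eq) (auto intro!: is_strategy_opt_strategy opt_iter_eq_opt_strategy[symmetric]
        contains_indicator_bounds(1))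
  then show ?thesis using win_nonneg[OF assms] hit_prob_nonneg by simp
qed

text \<open>Optimal strategies attain \<open>win\<close>, so the first clause of
  \<open>m_threshold\<close> says that \<open>win\<close> is at least 1/2 and gives minimality; the
  second holds at \<open>thr n\<close> because \<open>win\<close> is below 1/2 one step
  earlier.\<close>

lemma m_threshold_eq_thr:
  assumes n3: "n \<ge> 3"
  shows "m_threshold P (1 / 2) n = thr n"
proof -
  have thr1: "thr n \<ge> 1" using thr_lower[OF n3] n3 by linarith
  have ex: "(\<exists>S. is_strategy n S \<and> hit_prob P n S t \<ge> 1 / 2) \<longleftrightarrow> win n t \<ge> 1 / 2" for t
  proof
    assume "\<exists>S. is_strategy n S \<and> hit_prob P n S t \<ge> 1 / 2"
    then show "win n t \<ge> 1 / 2" using hit_prob_le_win[OF n3] order_trans by blast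
  next
    assume "win n t \<ge> 1 / 2"
    then show "\<exists>S. is_strategy n S \<and> hit_prob P n S t \<ge> 1 / 2"
      using hit_prob_opt_strategy[OF n3, of t] is_strategy_opt_strategy[of n] n3
      by (intro exI[of _ "opt_strategy n (contains_indicator (F n)) t"]) simp
  qed
  show ?thesis
    unfolding m_threshold_def ex
  proof (rule Least_equality)
    have "hit_prob P n S (thr n - 1) < 1 / 2" if "is_strategy n S" for S
      using hit_prob_le_win[OF n3 that, of "thr n - 1"] win_less_imp[of "thr n - 1" n] thr1 by simp
    then show "thr n \<ge> 1 \<and> win n (thr n) \<ge> 1 / 2 \<and> (\<forall>S. is_strategy n S \<longrightarrow> hit_prob P n S (thr n - 1) < 1 / 2)"
      using thr1 win_thr[OF n3] by blast
  qed (use thr_le in blast)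
qed

lemma sharp_threshold_m_threshold: "sharp_threshold P (\<lambda>n. real (m_threshold P (1 / 2) n))"
  unfolding sharp_threshold_def
proof (intro allI impI conjI)
  fix \<epsilon> :: real assume \<epsilon>: "\<epsilon> > 0"
  have ev3: "\<forall>\<^sub>F n in sequentially. n \<ge> (3::nat)" by (rule eventually_ge_at_top)
  let ?t = "\<lambda>n. nat \<lfloor>(1 + \<epsilon>) * real (m_threshold P (1 / 2) n)\<rfloor>"
  show "\<exists>S. (\<forall>n\<ge>1. is_strategy n (S n)) \<and> (\<lambda>n. hit_prob P n (S n) (?t n)) \<longlonglongrightarrow> 1"
  proof (intro exI conjI allI impI)
    show "is_strategy n (opt_strategy n (contains_indicator (F n)) (?t n))" if "n \<ge> 1" for n
      using that by (rule is_strategy_opt_strategy)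
    show "(\<lambda>n. hit_prob P n (opt_strategy n (contains_indicator (F n)) (?t n)) (?t n)) \<longlonglongrightarrow> 1"
    proof (rule Lim_transform_eventually[OF win_above_thr[OF \<epsilon>]])
      show "\<forall>\<^sub>F n in sequentially. win n (nat \<lfloor>(1 + \<epsilon>) * real (thr n)\<rfloor>) =
          hit_prob P n (opt_strategy n (contains_indicator (F n)) (?t n)) (?t n)"
        using ev3 by eventually_elim (simp add: hit_prob_opt_strategy m_threshold_eq_thr)
    qed
  qed
  fix S assume S: "\<forall>n\<ge>1. is_strategy n (S n)"
  show "(\<lambda>n. hit_prob P n (S n) (nat \<lfloor>(1 - \<epsilon>) * real (m_threshold P (1 / 2) n)\<rfloor>)) \<longlonglongrightarrow> 0"
  proof (rule tendsto_sandwich[OF _ _ tendsto_const win_below_thr[OF \<epsilon>]])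
    show "\<forall>\<^sub>F n in sequentially. hit_prob P n (S n) (nat \<lfloor>(1 - \<epsilon>) * real (m_threshold P (1 / 2) n)\<rfloor>)
        \<le> win n (nat \<lfloor>(1 - \<epsilon>) * real (thr n)\<rfloor>)"
      using ev3 by eventually_elim (use S in \<open>simp add: hit_prob_le_win m_threshold_eq_thr\<close>)
  qed (simp add: hit_prob_nonneg)
qed

lemma m_threshold_linear: "\<exists>C>0. (\<lambda>n. real (m_threshold P (1 / 2) n) / real n) \<longlonglongrightarrow> C"
proof -
  obtain C where C: "C > 0" "(\<lambda>n. real (thr n) / real n) \<longlonglongrightarrow> C" using thr_linear by blast
  have "\<forall>\<^sub>F n in sequentially. n \<ge> (3::nat)" by (rule eventually_ge_at_top)
  then have "\<forall>\<^sub>F n in sequentially. real (thr n) / real n = real (m_threshold P (1 / 2) n) / real n"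
    by eventually_elim (simp add: m_threshold_eq_thr)
  with C(2) have "(\<lambda>n. real (m_threshold P (1 / 2) n) / real n) \<longlonglongrightarrow> C"
    by (rule Lim_transform_eventually)
  with C(1) show ?thesis by blast
qed

end

section \<open>Perfect matchings\<close>

text \<open>One inequality covers both parities: a matching covers an even number of vertices, so it
  is perfect for even \<open>n\<close> and misses exactly one vertex for odd
  \<open>n\<close>.\<close>

definition near_perfect_matchings :: "nat \<Rightarrow> nat set set set" where
  "near_perfect_matchings n =
     {M. (\<forall>e\<in>M. card e = 2) \<and> pairwise disjnt M \<and> \<Union>M \<subseteq> {1..n} \<and> n \<le> 2 * card M + 1}"

lemma near_perfect_matchingsD:
  assumes "M \<in> near_perfect_matchings n"
  shows "\<And>e. e \<in> M \<Longrightarrow> card e = 2" "pairwise disjnt M" "\<Union>M \<subseteq> {1..n}" "n \<le> 2 * card M + 1" "finite M"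
proof -
  show *: "\<And>e. e \<in> M \<Longrightarrow> card e = 2" "pairwise disjnt M" "\<Union>M \<subseteq> {1..n}" "n \<le> 2 * card M + 1"
    using assms by (auto simp: near_perfect_matchings_def)
  show "finite M" using *(3) by (intro finite_subset[of M "Pow {1..n}"]) auto
qed

lemma card_Union_matching:
  assumes "\<And>e. e \<in> M \<Longrightarrow> card e = 2" "pairwise disjnt M"
  shows "card (\<Union>M) = 2 * card M"
proof -
  have "card (\<Union>M) = sum card M"
    using assms by (intro card_Union_disjoint) (auto intro: card_ge_0_finite)
  then show ?thesis using assms(1) by simp
qed

lemma has_perfect_matching_iff:
  "has_perfect_matching n G \<longleftrightarrow> (\<exists>M\<in>near_perfect_matchings n. M \<subseteq> set_mset G)"
proof
  assume "has_perfect_matching n G"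
  then obtain M where M: "is_matching G M"
    and cover: "if even n then \<Union>M = {1..n} else (\<exists>w\<in>{1..n}. \<Union>M = {1..n} - {w})"
    unfolding has_perfect_matching_def by blast
  have e: "card e = 2" if "e \<in> M" for e using M that by (simp add: is_matching_def)
  have d: "pairwise disjnt M" using M by (auto simp: is_matching_def pairwise_def disjnt_def)
  have "\<Union>M \<subseteq> {1..n}" "n \<le> card (\<Union>M) + 1"
    using cover by (auto split: if_splits)
  then have "M \<in> near_perfect_matchings n"
    using e d card_Union_matching[OF e d] by (simp add: near_perfect_matchings_def)
  then show "\<exists>M\<in>near_perfect_matchings n. M \<subseteq> set_mset G"
    using M by (auto simp: is_matching_def)
next
  assume "\<exists>M\<in>near_perfect_matchings n. M \<subseteq> set_mset G"
  then obtain M where M: "M \<in> near_perfect_matchings n" "M \<subseteq> set_mset G" by blast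
  note D = near_perfect_matchingsD[OF M(1)]
  have card: "card (\<Union>M) = 2 * card M" by (rule card_Union_matching[OF D(1,2)])
  have le: "card (\<Union>M) \<le> n" using card_mono[OF _ D(3)] by simp
  have "if even n then \<Union>M = {1..n} else (\<exists>w\<in>{1..n}. \<Union>M = {1..n} - {w})"
  proof (cases "even n")
    case True
    then have "card (\<Union>M) = n" using card le D(4) by presburger
    then have "\<Union>M = {1..n}" using D(3) by (intro card_subset_eq) auto
    then show ?thesis using True by simp
  next
    case False
    then have "card (\<Union>M) + 1 = n" using card le D(4) by presburger
    moreover have "card ({1..n} - \<Union>M) = n - card (\<Union>M)"
      using D(3) by (subst card_Diff_subset) (auto intro: finite_subset)
    ultimately have "card ({1..n} - \<Union>M) = 1" by simp
    then obtain w where "{1..n} - \<Union>M = {w}" using card_1_singletonE by blast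
    then have "w \<in> {1..n}" "\<Union>M = {1..n} - {w}" using D(3) by auto
    then show ?thesis using False by auto
  qed
  moreover have "is_matching G M"
    using M(2) D(1,2) by (auto simp: is_matching_def pairwise_def disjnt_def)
  ultimately show "has_perfect_matching n G" unfolding has_perfect_matching_def by blast
qed

lemma near_perfect_matchings_nonempty: "near_perfect_matchings n \<noteq> {}"
proof -
  define M :: "nat set set" where "M = (\<lambda>i. {2 * i + 1, 2 * i + 2}) ` {..<n div 2}"
  have "inj_on (\<lambda>i. {2 * i + 1, 2 * i + 2 :: nat}) {..<n div 2}"
    by (rule inj_onI) (auto simp: doubleton_eq_iff)
  then have "card M = n div 2" by (simp add: M_def card_image)
  moreover have "pairwise disjnt M"
    unfolding M_def pairwise_def disjnt_def by (auto, presburger+)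
  moreover have "\<Union>M \<subseteq> {1..n}" by (auto simp: M_def)
  ultimately have "M \<in> near_perfect_matchings n"
    by (auto simp: near_perfect_matchings_def M_def)
  then show ?thesis by blast
qed

text \<open>If both matchings miss a vertex, their shifted union misses two, which are joined by one
  new edge; otherwise the union is large enough.\<close>

lemma near_perfect_matchings_glue:
  assumes M\<^sub>1: "M\<^sub>1 \<in> near_perfect_matchings n\<^sub>1" and M\<^sub>2: "M\<^sub>2 \<in> near_perfect_matchings n\<^sub>2"
  shows "\<exists>M\<in>near_perfect_matchings (n\<^sub>1 + n\<^sub>2).
    card (M - (E\<^sub>1 \<union> (`) ((+) n\<^sub>1) ` E\<^sub>2)) \<le> card (M\<^sub>1 - E\<^sub>1) + card (M\<^sub>2 - E\<^sub>2) + 2"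
proof -
  note D\<^sub>1 = near_perfect_matchingsD[OF M\<^sub>1] and D\<^sub>2 = near_perfect_matchingsD[OF M\<^sub>2]
  define S where "S = (`) ((+) n\<^sub>1) ` M\<^sub>2"
  have inj: "inj_on ((`) ((+) n\<^sub>1)) A" for A :: "nat set set"
    by (rule inj_onI) (simp add: inj_image_eq_iff)
  have cS: "card S = card M\<^sub>2" unfolding S_def using inj by (rule card_image)
  have finS: "finite S" using D\<^sub>2(5) by (simp add: S_def)
  have S2: "card e = 2" if "e \<in> S" for e
    using that D\<^sub>2(1) by (auto simp: S_def card_image)
  have Sd: "pairwise disjnt S"
  proof (rule pairwiseI)
    fix e f assume "e \<in> S" "f \<in> S" "e \<noteq> f"
    then obtain e' f' where ef: "e' \<in> M\<^sub>2" "f' \<in> M\<^sub>2" "e = (+) n\<^sub>1 ` e'" "f = (+) n\<^sub>1 ` f'" "e' \<noteq> f'"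
      by (auto simp: S_def)
    have "disjnt e' f'" using D\<^sub>2(2) ef(1,2,5) by (rule pairwiseD)
    then show "disjnt e f" using ef(3,4) by (auto simp: disjnt_def)
  qed
  have SU: "\<Union>S \<subseteq> {n\<^sub>1 + 1..n\<^sub>1 + n\<^sub>2}" using D\<^sub>2(3) by (fastforce simp: S_def)
  have ne: "e \<noteq> {}" if "card e = 2" for e :: "nat set" using that by auto
  have disj: "disjnt e f" if "e \<in> M\<^sub>1" "f \<in> S" for e f
    using that D\<^sub>1(3) SU unfolding disjnt_def by fastforce
  have int: "M\<^sub>1 \<inter> S = {}"
    using disj S2 by (force simp: disjnt_def)
  have card_US: "card (M\<^sub>1 \<union> S) = card M\<^sub>1 + card M\<^sub>2"
    using D\<^sub>1(5) finS int cS by (simp add: card_Un_disjoint)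
  have pw: "pairwise disjnt (M\<^sub>1 \<union> S)"
    using D\<^sub>1(2) Sd disj unfolding pairwise_def by (metis Un_iff disjnt_sym)
  have U: "\<Union>(M\<^sub>1 \<union> S) \<subseteq> {1..n\<^sub>1 + n\<^sub>2}" using D\<^sub>1(3) SU by fastforce
  have diff: "card (M - (E\<^sub>1 \<union> (`) ((+) n\<^sub>1) ` E\<^sub>2)) \<le> card (M\<^sub>1 - E\<^sub>1) + card (M\<^sub>2 - E\<^sub>2) + 2"
    if "M \<subseteq> insert e (M\<^sub>1 \<union> S)" for M e
  proof -
    have "M - (E\<^sub>1 \<union> (`) ((+) n\<^sub>1) ` E\<^sub>2) \<subseteq> insert e ((M\<^sub>1 - E\<^sub>1) \<union> (`) ((+) n\<^sub>1) ` (M\<^sub>2 - E\<^sub>2))"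
      using that by (auto simp: S_def)
    then have "card (M - (E\<^sub>1 \<union> (`) ((+) n\<^sub>1) ` E\<^sub>2)) \<le> card (insert e ((M\<^sub>1 - E\<^sub>1) \<union> (`) ((+) n\<^sub>1) ` (M\<^sub>2 - E\<^sub>2)))"
      using D\<^sub>1(5) D\<^sub>2(5) by (intro card_mono) auto
    also have "\<dots> \<le> Suc (card ((M\<^sub>1 - E\<^sub>1) \<union> (`) ((+) n\<^sub>1) ` (M\<^sub>2 - E\<^sub>2)))"
      using D\<^sub>1(5) D\<^sub>2(5) by (simp add: card_insert_if)
    also have "card ((M\<^sub>1 - E\<^sub>1) \<union> (`) ((+) n\<^sub>1) ` (M\<^sub>2 - E\<^sub>2)) \<le> card (M\<^sub>1 - E\<^sub>1) + card (M\<^sub>2 - E\<^sub>2)"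
      using card_Un_le[of "M\<^sub>1 - E\<^sub>1" "(`) ((+) n\<^sub>1) ` (M\<^sub>2 - E\<^sub>2)"] card_image[OF inj, of "M\<^sub>2 - E\<^sub>2"] by simp
    finally show ?thesis by simp
  qed
  show ?thesis
  proof (cases "n\<^sub>1 + n\<^sub>2 \<le> 2 * (card M\<^sub>1 + card M\<^sub>2) + 1")
    case True
    then have "M\<^sub>1 \<union> S \<in> near_perfect_matchings (n\<^sub>1 + n\<^sub>2)"
      using D\<^sub>1(1) S2 pw U card_US by (auto simp: near_perfect_matchings_def)
    moreover have "M\<^sub>1 \<union> S \<subseteq> insert {} (M\<^sub>1 \<union> S)" by auto
    ultimately show ?thesis using diff by blast
  next
    case False
    then have n: "n\<^sub>1 = 2 * card M\<^sub>1 + 1" "n\<^sub>2 = 2 * card M\<^sub>2 + 1" using D\<^sub>1(4) D\<^sub>2(4) by simp_all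
    have "\<Union>M\<^sub>1 \<noteq> {1..n\<^sub>1}" "\<Union>M\<^sub>2 \<noteq> {1..n\<^sub>2}"
      using card_Union_matching[OF D\<^sub>1(1,2)] card_Union_matching[OF D\<^sub>2(1,2)] n by auto
    then obtain a b where ab: "a \<in> {1..n\<^sub>1}" "a \<notin> \<Union>M\<^sub>1" "b \<in> {1..n\<^sub>2}" "b \<notin> \<Union>M\<^sub>2"
      using D\<^sub>1(3) D\<^sub>2(3) by blast
    define e where "e = {a, n\<^sub>1 + b}"
    have ce: "card e = 2" using ab by (auto simp: e_def card_2_iff)
    have de: "disjnt e f" if "f \<in> M\<^sub>1 \<union> S" for f
    proof -
      have "a \<notin> f" using that ab SU by fastforce
      moreover have "n\<^sub>1 + b \<notin> f"
      proof (cases "f \<in> M\<^sub>1")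
        case True
        then show ?thesis using ab D\<^sub>1(3) by fastforce
      next
        case False
        then show ?thesis using that ab by (auto simp: S_def)
      qed
      ultimately show ?thesis by (simp add: e_def disjnt_def)
    qed
    have "e \<notin> M\<^sub>1 \<union> S" using de[of e] by (auto simp: e_def disjnt_def)
    then have "card (insert e (M\<^sub>1 \<union> S)) = card M\<^sub>1 + card M\<^sub>2 + 1"
      using card_US D\<^sub>1(5) finS by simp
    moreover have "pairwise disjnt (insert e (M\<^sub>1 \<union> S))"
      using pw de by (auto simp: pairwise_insert disjnt_sym)
    moreover have "e \<subseteq> {1..n\<^sub>1 + n\<^sub>2}" using ab by (auto simp: e_def)
    ultimately have "insert e (M\<^sub>1 \<union> S) \<in> near_perfect_matchings (n\<^sub>1 + n\<^sub>2)"
      using D\<^sub>1(1) S2 U ce n by (auto simp: near_perfect_matchings_def)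
    then show ?thesis using diff by blast
  qed
qed

text \<open>The same four vertices are covered by as many edges. With \<open>{x, y}\<close> missing
  and \<open>{u, w}\<close> present, this exchange is the gadget for matchings.\<close>

lemma near_perfect_matchings_swap:
  assumes M: "M \<in> near_perfect_matchings n" and xy: "{x, y} \<in> M" and uw: "{u, w} \<in> M" and ne: "{x, y} \<noteq> {u, w}"
  shows "insert {x, u} (insert {y, w} (M - {{x, y}, {u, w}})) \<in> near_perfect_matchings n"
proof -
  note D = near_perfect_matchingsD[OF M]
  have dist: "x \<noteq> y" "u \<noteq> w" using D(1)[OF xy] D(1)[OF uw] by auto
  have "disjnt {x, y} {u, w}" using D(2) xy uw ne by (rule pairwiseD)
  then have dist': "x \<noteq> u" "x \<noteq> w" "y \<noteq> u" "y \<noteq> w" by (auto simp: disjnt_def)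
  define R where "R = M - {{x, y}, {u, w}}"
  have notin: "x \<notin> e" "y \<notin> e" "u \<notin> e" "w \<notin> e" if "e \<in> R" for e
  proof -
    have "disjnt {x, y} e" "disjnt {u, w} e"
      using that by (auto simp: R_def intro!: pairwiseD[OF D(2) xy] pairwiseD[OF D(2) uw] simp del: disjnt_insert1)
    then show "x \<notin> e" "y \<notin> e" "u \<notin> e" "w \<notin> e" by (auto simp: disjnt_def)
  qed
  have cR: "card R + 2 = card M"
  proof -
    have "card R = card M - card {{x, y}, {u, w}}"
      unfolding R_def using xy uw by (intro card_Diff_subset) auto
    moreover have "card {{x, y}, {u, w}} \<le> card M" using xy uw D(5) by (intro card_mono) auto
    ultimately show ?thesis using ne by simp
  qed
  have pR: "pairwise disjnt R" using D(2) by (rule pairwise_subset) (auto simp: R_def)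
  have "{y, w} \<notin> R" "{x, u} \<notin> insert {y, w} R"
    using notin(1,2) dist dist' by (auto simp: doubleton_eq_iff)
  then have "card (insert {x, u} (insert {y, w} R)) = card M"
    using cR D(5) by (simp add: R_def)
  moreover have "pairwise disjnt (insert {x, u} (insert {y, w} R))"
    using pR notin dist dist' by (auto simp: pairwise_insert disjnt_def)
  moreover have "\<Union>(insert {x, u} (insert {y, w} R)) \<subseteq> {1..n}"
    using D(3) xy uw by (auto simp: R_def)
  ultimately show ?thesis
    using D(1,4) dist' unfolding R_def[symmetric] near_perfect_matchings_def by (auto simp: R_def)
qed

lemma doubleton_Min_Max:
  fixes e :: "nat set"
  assumes "card e = 2"
  shows "e = {Min e, Max e}"
proof -
  obtain a b where "e = {a, b}" "a \<noteq> b" using assms by (auto simp: card_2_iff)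
  then show ?thesis by (auto simp: min_def max_def)
qed

text \<open>Gadgets are the missing edges of a closest matching, slots its present edges, ordered by
  \<open>Min\<close> and \<open>Max\<close>. Using a gadget is a swap that trades the missing edge
  for two edges added by the player; distinct slots keep the swaps from interfering.\<close>

lemma near_perfect_matchings_gadgets:
  assumes d: "1 \<le> edge_distance (near_perfect_matchings n) E" "100 * edge_distance (near_perfect_matchings n) E \<le> n"
  shows "has_gadgets n (near_perfect_matchings n) E"
proof -
  let ?F = "near_perfect_matchings n"
  define k where "k = edge_distance ?F E"
  obtain H where H: "H \<in> ?F" "k = card (H - E)"
    using edge_distance_attained[OF near_perfect_matchings_nonempty] unfolding k_def .
  note D = near_perfect_matchingsD[OF H(1)]
  obtain h where h: "bij_betw h {..<k} (H - E)"
    using ex_bij_betw_nat_finite[of "H - E"] D(5) H(2) by (auto simp: atLeast0LessThan)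
  have hH: "h i \<in> H" "h i \<notin> E" if "i < k" for i using h that by (auto simp: bij_betw_def)
  define x where "x i = Min (h i)" for i
  define y where "y i = Max (h i)" for i
  have hxy: "h i = {x i, y i}" if "i < k" for i
    unfolding x_def y_def using D(1) hH(1)[OF that] by (intro doubleton_Min_Max) auto
  define S where "S = (\<lambda>e. (Min e, Max e)) ` (H \<inter> E)"
  have SE: "{fst p, snd p} \<in> H \<inter> E" if "p \<in> S" for p
    using that D(1) doubleton_Min_Max by (auto simp: S_def)
  have edge_eq: "e = f" if "e \<in> H" "f \<in> H" "v \<in> e" "v \<in> f" for e f v
    using D(2) that unfolding pairwise_def disjnt_def by blast
  have p_eq: "p = q" if "p \<in> S" "q \<in> S" "{fst p, snd p} = {fst q, snd q}" for p q
  proof -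
    obtain e f where "e \<in> H" "p = (Min e, Max e)" "f \<in> H" "q = (Min f, Max f)"
      using \<open>p \<in> S\<close> \<open>q \<in> S\<close> by (auto simp: S_def)
    moreover have "e = {Min e, Max e}" "f = {Min f, Max f}" using D(1) calculation by (auto intro!: doubleton_Min_Max)
    ultimately show ?thesis using that(3) by simp
  qed
  have inj: "inj_on fst S" "inj_on snd S"
  proof -
    show "inj_on fst S"
    proof (rule inj_onI)
      fix p q assume "p \<in> S" "q \<in> S" "fst p = fst q"
      then show "p = q" using edge_eq[of "{fst p, snd p}" "{fst q, snd q}" "fst p"] SE[of p] SE[of q] by (intro p_eq) auto
    qed
    show "inj_on snd S"
    proof (rule inj_onI)
      fix p q assume "p \<in> S" "q \<in> S" "snd p = snd q"
      then show "p = q" using edge_eq[of "{fst p, snd p}" "{fst q, snd q}" "snd p"] SE[of p] SE[of q] by (intro p_eq) auto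
    qed
  qed
  have cardS: "card S = card H - k"
  proof -
    have "inj_on (\<lambda>e. (Min e, Max e)) (H \<inter> E)"
      using doubleton_Min_Max D(1) by (intro inj_onI) (metis IntD1 prod.inject)
    then have "card S = card (H \<inter> E)" unfolding S_def by (rule card_image)
    also have "\<dots> = card H - k" using card_Diff_subset_Int[of H E] D(5) H(2) card_mono[OF D(5), of "H \<inter> E"]
      by (simp add: Int_commute)
    finally show ?thesis .
  qed
  have gad: "\<exists>M\<in>?F. h ` ({..<k} - I) \<subseteq> M \<and> (\<forall>p\<in>S - \<sigma> ` I. {fst p, snd p} \<in> M) \<and>
      M \<subseteq> E \<union> (\<lambda>i. {x i, fst (\<sigma> i)}) ` I \<union> (\<lambda>i. {y i, snd (\<sigma> i)}) ` I \<union> h ` ({..<k} - I)"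
    if "finite I" "I \<subseteq> {..<k}" "\<sigma> ` I \<subseteq> S" "inj_on \<sigma> I" for I \<sigma>
    using that
  proof (induction I rule: finite_induct)
    case empty
    have "H \<subseteq> E \<union> h ` {..<k}" using h by (auto simp: bij_betw_def)
    then show ?case using H(1) hH SE by (intro bexI[of _ H]) auto
  next
    case (insert i I)
    then obtain M where M: "M \<in> ?F" "h ` ({..<k} - I) \<subseteq> M" "\<forall>p\<in>S - \<sigma> ` I. {fst p, snd p} \<in> M"
      "M \<subseteq> E \<union> (\<lambda>i. {x i, fst (\<sigma> i)}) ` I \<union> (\<lambda>i. {y i, snd (\<sigma> i)}) ` I \<union> h ` ({..<k} - I)"
      by auto
    define p where "p = \<sigma> i"
    have i: "i < k" "i \<notin> I" and p: "p \<in> S" "p \<notin> \<sigma> ` I" using insert by (auto simp: p_def)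
    have hiM: "{x i, y i} \<in> M" using M(2) i hxy[OF i(1)] by auto
    have pM: "{fst p, snd p} \<in> M" using M(3) p by blast
    have hS: "h j \<noteq> {fst q, snd q}" if "j < k" "q \<in> S" for j q
      using hH(2)[OF that(1)] SE[OF that(2)] by auto
    have ne: "{x i, y i} \<noteq> {fst p, snd p}" using hS[OF i(1) p(1)] hxy[OF i(1)] by simp
    define M' where "M' = insert {x i, fst p} (insert {y i, snd p} (M - {{x i, y i}, {fst p, snd p}}))"
    have "M' \<in> ?F" unfolding M'_def by (rule near_perfect_matchings_swap[OF M(1) hiM pM ne])
    moreover have "h ` ({..<k} - insert i I) \<subseteq> M'"
    proof
      fix e assume "e \<in> h ` ({..<k} - insert i I)"
      then obtain j where j: "e = h j" "j < k" "j \<noteq> i" "j \<notin> I" by auto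
      then have "h j \<noteq> h i" using h i(1) by (auto simp: bij_betw_def inj_on_def)
      then show "e \<in> M'" using j M(2) hS[OF j(2) p(1)] hxy[OF i(1)] by (auto simp: M'_def)
    qed
    moreover have "\<forall>q\<in>S - \<sigma> ` insert i I. {fst q, snd q} \<in> M'"
    proof
      fix q assume q: "q \<in> S - \<sigma> ` insert i I"
      then have "{fst q, snd q} \<noteq> {fst p, snd p}" using p_eq[of q p] p(1) by (auto simp: p_def)
      moreover have "{fst q, snd q} \<noteq> {x i, y i}" using hS[of i q] q i(1) hxy[OF i(1)] by auto
      ultimately show "{fst q, snd q} \<in> M'" using M(3) q by (auto simp: M'_def)
    qed
    moreover have "M' \<subseteq> E \<union> (\<lambda>i. {x i, fst (\<sigma> i)}) ` insert i I \<union> (\<lambda>i. {y i, snd (\<sigma> i)}) ` insert i I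
        \<union> h ` ({..<k} - insert i I)"
    proof
      fix e assume "e \<in> M'"
      then consider "e = {x i, fst p}" | "e = {y i, snd p}" | "e \<in> M" "e \<noteq> h i"
        unfolding M'_def hxy[OF i(1)] by blast
      then show "e \<in> E \<union> (\<lambda>i. {x i, fst (\<sigma> i)}) ` insert i I \<union> (\<lambda>i. {y i, snd (\<sigma> i)}) ` insert i I
          \<union> h ` ({..<k} - insert i I)"
      proof cases
        case 3
        then show ?thesis using M(4) by blast
      qed (simp_all add: p_def)
    qed
    ultimately show ?case by (intro bexI[of _ M']) auto
  qed
  have "gadget_family n ?F E k x y S"
    unfolding gadget_family_def k_def[symmetric]
  proof (intro conjI allI impI)
    show "1 \<le> k" "k \<le> k" "k \<le> 3 * k" using d(1) by (auto simp: k_def)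
    show "x i \<in> {1..n}" "y i \<in> {1..n}" if "i < k" for i
      using hxy[OF that] hH(1)[OF that] D(3) by auto
    have "fst p \<in> {1..n} \<and> snd p \<in> {1..n}" if "p \<in> S" for p using SE[OF that] D(3) by auto
    then show "S \<subseteq> {1..n} \<times> {1..n}" by (auto simp: mem_Times_iff)
    show "inj_on fst S" "inj_on snd S" by fact+
    \<comment> \<open>card S = card H - k, with card H >= (n - 1)/2 and k <= n/100.\<close>
    show "n \<le> 4 * card S" using cardS D(4) d by (simp add: k_def)
    fix I \<sigma> assume I: "I \<subseteq> {..<k}" "\<sigma> ` I \<subseteq> S" "inj_on \<sigma> I"
    let ?E = "E \<union> (\<lambda>i. {x i, fst (\<sigma> i)}) ` I \<union> (\<lambda>i. {y i, snd (\<sigma> i)}) ` I"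
    have fin: "finite I" using I(1) finite_subset by blast
    obtain M where M: "M \<in> ?F" "M \<subseteq> ?E \<union> h ` ({..<k} - I)" using gad[OF fin I] by blast
    have "edge_distance ?F ?E \<le> card (M - ?E)" by (rule edge_distance_le[OF M(1)])
    also have "\<dots> \<le> card (h ` ({..<k} - I))" using M(2) by (intro card_mono) auto
    also have "\<dots> \<le> card ({..<k} - I)" by (rule card_image_le) simp
    also have "\<dots> = k - card I" using I(1) fin by (simp add: card_Diff_subset)
    finally show "edge_distance ?F ?E + card I \<le> k" using card_mono[OF _ I(1)] by simp
  qed
  then show ?thesis unfolding has_gadgets_def by blast
qed

interpretation perfect_matching: target_property near_perfect_matchings has_perfect_matching
proof
  fix n H e M
  assume H: "H \<in> near_perfect_matchings n"
  note D = near_perfect_matchingsD[OF H]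
  show "e \<subseteq> {1..n} \<and> card e = 2" if "e \<in> H" using D that by auto
  show "n \<le> 2 * card H + 1" by (rule D(4))
  assume "M \<subseteq> H"
  then have "card (\<Union>M) = 2 * card M"
    using D(1) pairwise_subset[OF D(2)] by (intro card_Union_matching) auto
  then show "card M \<le> card (\<Union>M)" by simp
qed (rule near_perfect_matchings_nonempty near_perfect_matchings_glue near_perfect_matchings_gadgets
    has_perfect_matching_iff; assumption)+

section \<open>Hamiltonian cycles\<close>

fun path_edges :: "nat list \<Rightarrow> nat set set" where
  "path_edges (a # b # xs) = insert {a, b} (path_edges (b # xs))"
| "path_edges _ = {}"

definition cycle_edges :: "nat list \<Rightarrow> nat set set" where
  "cycle_edges c = insert {last c, hd c} (path_edges c)"

definition hamiltonian_cycles :: "nat \<Rightarrow> nat set set set" where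
  "hamiltonian_cycles n = {cycle_edges c | c. n \<ge> 3 \<and> distinct c \<and> set c = {1..n}}"

lemma path_edges_Cons: "xs \<noteq> [] \<Longrightarrow> path_edges (a # xs) = insert {a, hd xs} (path_edges xs)"
  by (cases xs) auto

lemma path_edges_append:
  "xs \<noteq> [] \<Longrightarrow> ys \<noteq> [] \<Longrightarrow>
     path_edges (xs @ ys) = path_edges xs \<union> path_edges ys \<union> {{last xs, hd ys}}"
  by (induction xs rule: path_edges.induct) (auto simp: path_edges_Cons)

lemma path_edges_rev: "path_edges (rev xs) = path_edges xs"
proof (induction xs)
  case (Cons a xs)
  then show ?case
    by (cases "xs = []") (auto simp: path_edges_append path_edges_Cons last_rev insert_commute)
qed simp

lemma path_edges_map: "path_edges (map f xs) = (`) f ` path_edges xs"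
  by (induction xs rule: path_edges.induct) auto

lemma finite_path_edges: "finite (path_edges xs)"
  by (induction xs rule: path_edges.induct) auto

lemma path_edges_subset: "e \<in> path_edges xs \<Longrightarrow> e \<subseteq> set xs"
  by (induction xs rule: path_edges.induct) auto

lemma card_path_edge: "distinct xs \<Longrightarrow> e \<in> path_edges xs \<Longrightarrow> card e = 2"
  by (induction xs rule: path_edges.induct) (auto simp: card_2_iff)

lemma path_edges_eq_nth: "path_edges xs = {{xs ! i, xs ! Suc i} | i. Suc i < length xs}"
proof (induction xs rule: path_edges.induct)
  case (1 a b xs)
  have "{{(a # b # xs) ! i, (a # b # xs) ! Suc i} | i. Suc i < length (a # b # xs)}
      = insert {a, b} {{(b # xs) ! i, (b # xs) ! Suc i} | i. Suc i < length (b # xs)}"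
    (is "?L = ?R")
  proof
    show "?L \<subseteq> ?R"
    proof
      fix e assume "e \<in> ?L"
      then obtain i where i: "e = {(a # b # xs) ! i, (a # b # xs) ! Suc i}" "Suc i < length (a # b # xs)" by blast
      show "e \<in> ?R"
      proof (cases i)
        case (Suc j)
        then have "e = {(b # xs) ! j, (b # xs) ! Suc j}" "Suc j < length (b # xs)" using i by auto
        then show ?thesis by blast
      qed (use i in simp)
    qed
    show "?R \<subseteq> ?L"
    proof
      fix e assume "e \<in> ?R"
      then consider "e = {a, b}" | j where "e = {(b # xs) ! j, (b # xs) ! Suc j}" "Suc j < length (b # xs)" by blast
      then show "e \<in> ?L"
      proof cases
        case 1
        then show ?thesis by (intro CollectI exI[of _ 0]) auto
      next
        case (2 j)
        then show ?thesis by (intro CollectI exI[of _ "Suc j"]) auto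
      qed
    qed
  qed
  then show ?case using 1 by simp
qed auto

text \<open>Matches the list form with the modular indexing in
  \<open>has_hamiltonian_cycle\<close>.\<close>

lemma cycle_edges_eq_nth:
  assumes "c \<noteq> []"
  shows "cycle_edges c = (\<lambda>i. {c ! i, c ! (Suc i mod length c)}) ` {..<length c}" (is "_ = ?f ` _")
proof -
  have "{..<length c} = insert (length c - 1) {i. Suc i < length c}" using assms by (cases c) auto
  then have "?f ` {..<length c} = insert (?f (length c - 1)) (?f ` {i. Suc i < length c})" by simp
  also have "?f (length c - 1) = {last c, hd c}" using assms by (simp add: last_conv_nth hd_conv_nth)
  also have "?f ` {i. Suc i < length c} = path_edges c"
    unfolding path_edges_eq_nth by (auto simp: image_iff)
  finally show ?thesis by (simp add: cycle_edges_def)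
qed

lemma cycle_edges_rotate:
  assumes "xs \<noteq> []" "ys \<noteq> []"
  shows "cycle_edges (xs @ ys) = cycle_edges (ys @ xs)"
  using assms by (auto simp: cycle_edges_def path_edges_append)

lemma hamiltonian_cyclesD:
  assumes "H \<in> hamiltonian_cycles n"
  obtains c where "n \<ge> 3" "distinct c" "set c = {1..n}" "length c = n" "c \<noteq> []" "H = cycle_edges c"
proof -
  obtain c where c: "n \<ge> 3" "distinct c" "set c = {1..n}" "H = cycle_edges c"
    using assms by (auto simp: hamiltonian_cycles_def)
  moreover have "length c = n" using distinct_card[OF c(2)] c(3) by simp
  ultimately show thesis using that by force
qed

lemma has_hamiltonian_cycle_iff:
  "n \<ge> 3 \<Longrightarrow> has_hamiltonian_cycle n G \<longleftrightarrow> (\<exists>H\<in>hamiltonian_cycles n. H \<subseteq> set_mset G)"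
proof -
  assume n: "n \<ge> 3"
  have "(\<forall>i<length c. {c ! i, c ! (Suc i mod length c)} \<in># G) \<longleftrightarrow> cycle_edges c \<subseteq> set_mset G"
    if "set c = {1..n}" for c
    using that n by (subst cycle_edges_eq_nth) auto
  then show ?thesis
    unfolding has_hamiltonian_cycle_def hamiltonian_cycles_def using n by blast
qed

lemma hamiltonian_cycles_nonempty: "n \<ge> 3 \<Longrightarrow> hamiltonian_cycles n \<noteq> {}"
proof -
  assume "n \<ge> 3"
  then have "cycle_edges [1..<Suc n] \<in> hamiltonian_cycles n"
    unfolding hamiltonian_cycles_def by (intro CollectI exI[of _ "[1..<Suc n]"]) auto
  then show ?thesis by blast
qed

lemma hamiltonian_cycles_edges:
  assumes "H \<in> hamiltonian_cycles n" "e \<in> H"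
  shows "e \<subseteq> {1..n} \<and> card e = 2"
proof -
  obtain c where c: "n \<ge> 3" "distinct c" "set c = {1..n}" "length c = n" "c \<noteq> []" "H = cycle_edges c"
    using hamiltonian_cyclesD[OF assms(1)] .
  have "last c \<noteq> hd c" using c by (cases c) (auto simp: last_ConsR)
  then have "card {last c, hd c} = 2" by simp
  moreover have "{last c, hd c} \<subseteq> {1..n}" using c(3,5) last_in_set hd_in_set by blast
  moreover have "e = {last c, hd c} \<or> e \<in> path_edges c"
    using assms(2) unfolding c(6) cycle_edges_def by simp
  ultimately show ?thesis
    using path_edges_subset[of e c] card_path_edge[OF c(2), of e] c(3) by metis
qed

lemma finite_hamiltonian_cycle: "H \<in> hamiltonian_cycles n \<Longrightarrow> finite H"
  using hamiltonian_cycles_edges[of H n] by (intro finite_subset[of H "Pow {1..n}"]) auto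

text \<open>Each edge is charged to its first endpoint in the cyclic order, and distinct positions
  have distinct first endpoints.\<close>

lemma hamiltonian_cycles_spread:
  assumes "H \<in> hamiltonian_cycles n" "M \<subseteq> H"
  shows "card M \<le> card (\<Union>M)"
proof -
  obtain c where c: "n \<ge> 3" "distinct c" "set c = {1..n}" "length c = n" "c \<noteq> []" "H = cycle_edges c"
    using hamiltonian_cyclesD[OF assms(1)] .
  define f where "f i = {c ! i, c ! (Suc i mod length c)}" for i
  have "M \<subseteq> f ` {..<length c}" using assms(2) c cycle_edges_eq_nth[OF c(5)] by (simp add: f_def)
  then obtain J where J: "J \<subseteq> {..<length c}" "M = f ` J" by (auto elim: subset_imageE)
  then have finJ: "finite J" using finite_subset by blast
  have "card M \<le> card J" using J finJ by (simp add: card_image_le)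
  also have "card J = card ((!) c ` J)"
    using J c(2) by (intro card_image[symmetric] inj_on_nth) auto
  also have "\<dots> \<le> card (\<Union>M)" using J finJ by (intro card_mono) (auto simp: f_def)
  finally show ?thesis .
qed

text \<open>Every vertex lies on an edge, and every edge has two vertices; counting this way avoids
  showing that the edges at distinct positions differ.\<close>

lemma hamiltonian_cycles_size:
  assumes "H \<in> hamiltonian_cycles n"
  shows "n \<le> 2 * card H + 1"
proof -
  obtain c where c: "n \<ge> 3" "distinct c" "set c = {1..n}" "length c = n" "c \<noteq> []" "H = cycle_edges c"
    using hamiltonian_cyclesD[OF assms] .
  have "{1..n} \<subseteq> \<Union>H"
  proof
    fix v assume "v \<in> {1..n}"
    then obtain i where "i < length c" "v = c ! i" using c(3) by (metis in_set_conv_nth)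
    then show "v \<in> \<Union>H" unfolding c(6) cycle_edges_eq_nth[OF c(5)] by blast
  qed
  moreover have "\<Union>H \<subseteq> {1..n}" using hamiltonian_cycles_edges[OF assms] by blast
  ultimately have "n = card (\<Union>H)" by (metis card_atLeastAtMost diff_Suc_1 subset_antisym)
  also have "\<dots> \<le> sum card H" by (rule card_Union_le_sum_card)
  also have "\<dots> = 2 * card H" using hamiltonian_cycles_edges[OF assms] by simp
  finally show ?thesis by simp
qed

text \<open>Both cycles are opened at their closing edges and the resulting paths concatenated; only
  the two connecting edges are new.\<close>

lemma hamiltonian_cycles_glue:
  assumes "H\<^sub>1 \<in> hamiltonian_cycles n\<^sub>1" "H\<^sub>2 \<in> hamiltonian_cycles n\<^sub>2"
  shows "\<exists>H\<in>hamiltonian_cycles (n\<^sub>1 + n\<^sub>2).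
    card (H - (E\<^sub>1 \<union> (`) ((+) n\<^sub>1) ` E\<^sub>2)) \<le> card (H\<^sub>1 - E\<^sub>1) + card (H\<^sub>2 - E\<^sub>2) + 2"
proof -
  obtain c\<^sub>1 where c\<^sub>1: "n\<^sub>1 \<ge> 3" "distinct c\<^sub>1" "set c\<^sub>1 = {1..n\<^sub>1}" "length c\<^sub>1 = n\<^sub>1" "c\<^sub>1 \<noteq> []" "H\<^sub>1 = cycle_edges c\<^sub>1"
    using hamiltonian_cyclesD[OF assms(1)] .
  obtain c\<^sub>2 where c\<^sub>2: "n\<^sub>2 \<ge> 3" "distinct c\<^sub>2" "set c\<^sub>2 = {1..n\<^sub>2}" "length c\<^sub>2 = n\<^sub>2" "c\<^sub>2 \<noteq> []" "H\<^sub>2 = cycle_edges c\<^sub>2"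
    using hamiltonian_cyclesD[OF assms(2)] .
  define c where "c = c\<^sub>1 @ map ((+) n\<^sub>1) c\<^sub>2"
  let ?E = "E\<^sub>1 \<union> (`) ((+) n\<^sub>1) ` E\<^sub>2" and ?S = "(`) ((+) n\<^sub>1) ` (H\<^sub>2 - E\<^sub>2)"
  have "distinct c" using c\<^sub>1 c\<^sub>2 by (auto simp: c_def distinct_map)
  moreover have "set c = {1..n\<^sub>1 + n\<^sub>2}"
  proof -
    have "set c = {1..n\<^sub>1} \<union> (+) n\<^sub>1 ` {1..n\<^sub>2}" using c\<^sub>1 c\<^sub>2 by (simp add: c_def)
    also have "\<dots> = {1..n\<^sub>1 + n\<^sub>2}" by (auto simp: image_add_atLeastAtMost)
    finally show ?thesis .
  qed
  ultimately have "cycle_edges c \<in> hamiltonian_cycles (n\<^sub>1 + n\<^sub>2)"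
    using c\<^sub>1(1) unfolding hamiltonian_cycles_def by (intro CollectI exI[of _ c]) auto
  moreover have "card (cycle_edges c - ?E) \<le> card (H\<^sub>1 - E\<^sub>1) + card (H\<^sub>2 - E\<^sub>2) + 2"
  proof -
    define e f where "e = {last c, hd c}" and "f = {last c\<^sub>1, hd (map ((+) n\<^sub>1) c\<^sub>2)}"
    have "cycle_edges c = insert e (insert f (path_edges c\<^sub>1 \<union> (`) ((+) n\<^sub>1) ` path_edges c\<^sub>2))"
      using c\<^sub>1(5) c\<^sub>2(5) by (simp add: cycle_edges_def c_def e_def f_def path_edges_append path_edges_map)
    moreover have "path_edges c\<^sub>1 \<subseteq> H\<^sub>1" "path_edges c\<^sub>2 \<subseteq> H\<^sub>2" by (auto simp: c\<^sub>1(6) c\<^sub>2(6) cycle_edges_def)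
    ultimately have "cycle_edges c - ?E \<subseteq> insert e (insert f ((H\<^sub>1 - E\<^sub>1) \<union> ?S))" by auto
    then have "card (cycle_edges c - ?E) \<le> card (insert e (insert f ((H\<^sub>1 - E\<^sub>1) \<union> ?S)))"
      using assms by (intro card_mono) (auto simp: finite_hamiltonian_cycle)
    also have "\<dots> \<le> card ((H\<^sub>1 - E\<^sub>1) \<union> ?S) + 2"
      using assms by (auto simp: card_insert_if finite_hamiltonian_cycle)
    also have "card ((H\<^sub>1 - E\<^sub>1) \<union> ?S) \<le> card (H\<^sub>1 - E\<^sub>1) + card ?S" by (rule card_Un_le)
    also have "card ?S \<le> card (H\<^sub>2 - E\<^sub>2)"
      using assms by (intro card_image_le) (auto simp: finite_hamiltonian_cycle)
    finally show ?thesis by simp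
  qed
  ultimately show ?thesis by blast
qed

section \<open>Path covers and their slots\<close>

text \<open>The multiset equation says at once that the paths are simple, disjoint and cover all
  vertices. Single vertices count as paths.\<close>

definition path_cover :: "nat \<Rightarrow> nat set set \<Rightarrow> nat list multiset \<Rightarrow> bool" where
  "path_cover n E C \<longleftrightarrow> (\<forall>p\<in>#C. p \<noteq> [] \<and> path_edges p \<subseteq> E) \<and> (\<Sum>p\<in>#C. mset p) = mset_set {1..n}"

lemma sum_mset_mset: "(\<Sum>p\<in>#mset ps. mset p) = mset (concat ps)"
  by (induction ps) auto

lemma mset_eq_mset_setD:
  assumes "mset c = mset_set {1..n::nat}"
  shows "distinct c" "set c = {1..n}"
proof -
  have "mset c = mset [1..<Suc n]" unfolding assms mset_upt atLeastLessThanSuc_atLeastAtMost ..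
  then show "distinct c" "set c = {1..n}"
    using mset_eq_imp_distinct_iff[of c "[1..<Suc n]"] mset_eq_setD[of c "[1..<Suc n]"] by auto
qed

text \<open>Concatenating the paths in a circle gives a Hamiltonian cycle in which only the
  junctions, one per path, can be missing.\<close>

lemma edge_distance_le_path_cover:
  assumes n: "n \<ge> 3" and C: "path_cover n E C"
  shows "edge_distance (hamiltonian_cycles n) E \<le> size C"
proof -
  obtain ps where ps: "mset ps = C" using ex_mset by blast
  define c where "c = concat ps"
  have c: "mset c = mset_set {1..n}"
    using C unfolding path_cover_def c_def ps[symmetric] sum_mset_mset by simp
  note D = mset_eq_mset_setD[OF c]
  have good: "p \<noteq> [] \<and> path_edges p \<subseteq> E" if "p \<in> set ps" for p
    using C that unfolding path_cover_def ps[symmetric] by simp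
  have cne: "c \<noteq> []" using D n by auto
  have "ps \<noteq> []" using cne by (auto simp: c_def)
  then have "card (path_edges c - E) + 1 \<le> length ps"
    using good unfolding c_def
  proof (induction ps rule: list_nonempty_induct)
    case (single p)
    then have "path_edges p - E = {}" by auto
    then have "card (path_edges p - E) = 0" by (metis card.empty)
    then show ?case by simp
  next
    case (cons p ps)
    have "concat ps \<noteq> []" using cons by (cases ps) auto
    then have "path_edges (concat (p # ps)) - E \<subseteq> insert {last p, hd (concat ps)} (path_edges (concat ps) - E)"
      using cons.prems by (auto simp: path_edges_append)
    then have "card (path_edges (concat (p # ps)) - E) \<le> card (insert {last p, hd (concat ps)} (path_edges (concat ps) - E))"
      by (intro card_mono) (auto simp: finite_path_edges)
    also have "\<dots> \<le> card (path_edges (concat ps) - E) + 1"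
      by (auto simp: card_insert_if finite_path_edges)
    finally show ?case using cons by simp
  qed
  moreover have "card (cycle_edges c - E) \<le> card (insert {last c, hd c} (path_edges c - E))"
    by (intro card_mono) (auto simp: cycle_edges_def finite_path_edges)
  moreover have "\<dots> \<le> card (path_edges c - E) + 1" by (auto simp: card_insert_if finite_path_edges)
  moreover have "cycle_edges c \<in> hamiltonian_cycles n" using D n by (auto simp: hamiltonian_cycles_def)
  then have "edge_distance (hamiltonian_cycles n) E \<le> card (cycle_edges c - E)" by (rule edge_distance_le)
  ultimately show ?thesis using ps by auto
qed

text \<open>Cut at the missing edges. In the induction the new first vertex extends the first piece
  if its edge is present and forms a piece of its own otherwise.\<close>

lemma path_split:
  assumes "c \<noteq> []" "distinct c"
  shows "\<exists>ps. concat ps = c \<and> (\<forall>p\<in>set ps. p \<noteq> [] \<and> path_edges p \<subseteq> E) \<and> length ps \<le> card (path_edges c - E) + 1"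
  using assms
proof (induction c rule: path_edges.induct)
  case (1 a b xs)
  then obtain ps where ps: "concat ps = b # xs" "\<forall>p\<in>set ps. p \<noteq> [] \<and> path_edges p \<subseteq> E"
      "length ps \<le> card (path_edges (b # xs) - E) + 1" by auto
  then obtain p qs where pq: "ps = p # qs" by (cases ps) auto
  have p: "p \<noteq> []" "hd p = b" using ps(1,2) pq by (auto simp: hd_append dest: arg_cong[of _ _ hd])
  show ?case
  proof (cases "{a, b} \<in> E")
    case True
    then have "path_edges (a # b # xs) - E = path_edges (b # xs) - E" by auto
    moreover have "path_edges (a # p) \<subseteq> E" using True p ps(2) pq by (simp add: path_edges_Cons)
    ultimately show ?thesis using ps pq by (intro exI[of _ "(a # p) # qs"]) auto
  next
    case False
    have "{a, b} \<notin> path_edges (b # xs)" using path_edges_subset[of "{a, b}" "b # xs"] 1(3) by auto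
    then have "card (path_edges (a # b # xs) - E) = card (path_edges (b # xs) - E) + 1"
      using False by (simp add: insert_Diff_if finite_path_edges)
    then show ?thesis using ps by (intro exI[of _ "[a] # ps"]) auto
  qed
next
  case ("2_2" a)
  then show ?case by (intro exI[of _ "[[a]]"]) auto
qed simp

text \<open>Cutting a closest cycle at its D missing edges leaves at most D paths; that there are no
  fewer is the bound \<open>edge_distance_le_path_cover\<close>.\<close>

lemma path_cover_of_edge_distance:
  assumes n: "n \<ge> 3" and d: "edge_distance (hamiltonian_cycles n) E \<ge> 1"
  shows "\<exists>ps. length ps = edge_distance (hamiltonian_cycles n) E \<and> path_cover n E (mset ps)"
proof -
  obtain H where H: "H \<in> hamiltonian_cycles n" "edge_distance (hamiltonian_cycles n) E = card (H - E)"
    using edge_distance_attained[OF hamiltonian_cycles_nonempty[OF n]] .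
  obtain c\<^sub>0 where c\<^sub>0: "distinct c\<^sub>0" "set c\<^sub>0 = {1..n}" "c\<^sub>0 \<noteq> []" "H = cycle_edges c\<^sub>0"
    using hamiltonian_cyclesD[OF H(1)] by metis
  \<comment> \<open>Rotate the cycle so that a missing edge closes it; the remaining D - 1 missing
    edges then cut the path into at most D pieces.\<close>
  have "\<exists>c. distinct c \<and> set c = {1..n} \<and> H = cycle_edges c \<and> {last c, hd c} \<notin> E"
  proof (cases "{last c\<^sub>0, hd c\<^sub>0} \<in> E")
    case True
    have "H - E \<noteq> {}" using d H(2) by (metis card.empty not_one_le_zero)
    then obtain e where e: "e \<in> path_edges c\<^sub>0" "e \<notin> E" using c\<^sub>0(4) True by (auto simp: cycle_edges_def)
    then obtain i where i: "e = {c\<^sub>0 ! i, c\<^sub>0 ! Suc i}" "Suc i < length c\<^sub>0" by (auto simp: path_edges_eq_nth)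
    define xs ys where "xs = take (Suc i) c\<^sub>0" and "ys = drop (Suc i) c\<^sub>0"
    have xy: "xs \<noteq> []" "ys \<noteq> []" "c\<^sub>0 = xs @ ys" using i(2) by (auto simp: xs_def ys_def)
    have "last xs = c\<^sub>0 ! i" "hd ys = c\<^sub>0 ! Suc i"
      using i(2) by (auto simp: xs_def ys_def take_Suc_conv_app_nth hd_drop_conv_nth)
    then have "{last (ys @ xs), hd (ys @ xs)} = e" using xy i(1) by simp
    then show ?thesis
      using c\<^sub>0 xy e(2) cycle_edges_rotate[OF xy(1,2)] by (intro exI[of _ "ys @ xs"]) auto
  qed (use c\<^sub>0 in blast)
  then obtain c where c: "distinct c" "set c = {1..n}" "H = cycle_edges c" "{last c, hd c} \<notin> E" by blast
  have len: "length c = n" using distinct_card[OF c(1)] c(2) by simp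
  then obtain a b xs where abx: "c = a # b # xs" "xs \<noteq> []"
    using n by (cases c; cases "tl c"; cases "tl (tl c)") auto
  \<comment> \<open>With at least three vertices the closing edge is not also a path edge, so it
    counts separately among the missing ones.\<close>
  have "{last c, hd c} \<notin> path_edges c"
  proof -
    have "{last xs, a} \<noteq> {a, b}" using abx c(1) last_in_set[OF abx(2)] by (auto simp: doubleton_eq_iff)
    moreover have "{last xs, a} \<notin> path_edges (b # xs)"
      using path_edges_subset[of "{last xs, a}" "b # xs"] abx c(1) by auto
    ultimately show ?thesis using abx by simp
  qed
  then have card: "card (H - E) = card (path_edges c - E) + 1"
    using c(3,4) by (simp add: cycle_edges_def insert_Diff_if finite_path_edges)
  obtain ps where ps: "concat ps = c" "\<forall>p\<in>set ps. p \<noteq> [] \<and> path_edges p \<subseteq> E"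
      "length ps \<le> card (path_edges c - E) + 1"
    using path_split[of c E] c(1) abx by auto
  have "mset c = mset_set {1..n}" using c(1,2) mset_set_set[of c] by simp
  then have cover: "path_cover n E (mset ps)"
    using ps unfolding path_cover_def sum_mset_mset by simp
  then show ?thesis
    using edge_distance_le_path_cover[OF n cover] ps(3) card H(2) by (intro exI[of _ ps]) auto
qed

definition steps :: "nat list \<Rightarrow> (nat \<times> nat) list" where
  "steps p = zip (butlast p) (tl p)"

lemma steps_split: "(u, w) \<in> set (steps p) \<Longrightarrow> \<exists>as bs. p = as @ u # w # bs"
proof (induction p)
  case (Cons a p)
  show ?case
  proof (cases p)
    case (Cons b q)
    then consider "u = a" "w = b" | "(u, w) \<in> set (steps p)" using Cons.prems by (auto simp: steps_def)
    then show ?thesis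
    proof cases
      case 1
      then show ?thesis using \<open>p = b # q\<close> by (intro exI[of _ "[]"] exI[of _ q]) simp
    next
      case 2
      then obtain as bs where "p = as @ u # w # bs" using Cons.IH by blast
      then show ?thesis by (intro exI[of _ "a # as"] exI[of _ bs]) simp
    qed
  qed (use Cons.prems in \<open>simp add: steps_def\<close>)
qed (simp add: steps_def)

lemma map_steps: "map fst (steps p) = butlast p" "map snd (steps p) = tl p" "length (steps p) = length p - 1"
  by (simp_all add: steps_def)

lemma concat_map_sublists:
  assumes "distinct (concat ps)" "\<And>p. set (f p) \<subseteq> set p" "\<And>p. distinct p \<Longrightarrow> distinct (f p)"
  shows "distinct (concat (map f ps)) \<and> set (concat (map f ps)) \<subseteq> set (concat ps)"
  using assms(1)
proof (induction ps)
  case (Cons p ps)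
  then show ?case using assms(2)[of p] assms(3)[of p] by auto
qed simp

text \<open>The first components are the vertices not last on their path, the second components
  those not first; both lists are distinct because the paths are disjoint. A nonempty path has one
  slot fewer than vertices.\<close>

lemma slots_of_paths:
  assumes "distinct (concat ps)"
  defines "S \<equiv> set (concat (map steps ps))"
  shows "inj_on fst S" "inj_on snd S" "S \<subseteq> set (concat ps) \<times> set (concat ps)"
    "length (concat ps) \<le> card S + length ps"
proof -
  let ?L = "concat (map steps ps)"
  have L: "map fst ?L = concat (map butlast ps)" "map snd ?L = concat (map tl ps)"
    by (simp_all add: map_concat map_steps(1,2) comp_def)
  have bl: "distinct (concat (map butlast ps)) \<and> set (concat (map butlast ps)) \<subseteq> set (concat ps)"
    using assms(1) by (rule concat_map_sublists) (auto dest: in_set_butlastD intro: distinct_butlast)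
  have tl: "distinct (concat (map tl ps)) \<and> set (concat (map tl ps)) \<subseteq> set (concat ps)"
    using assms(1)
  proof (rule concat_map_sublists)
    show "set (tl p) \<subseteq> set p" for p :: "nat list" by (cases p) auto
  qed (rule distinct_tl)
  show inj: "inj_on fst S" "inj_on snd S"
    unfolding S_def using bl tl unfolding L[symmetric] distinct_map by auto
  have "distinct ?L" using bl unfolding L[symmetric] distinct_map by auto
  then have "card S = length ?L" unfolding S_def by (rule distinct_card)
  moreover have "length (concat ps) \<le> length ?L + length ps"
    by (induction ps) (auto simp: map_steps(3))
  ultimately show "length (concat ps) \<le> card S + length ps" by simp
  have "fst ` S \<subseteq> set (concat ps)" "snd ` S \<subseteq> set (concat ps)"
    using bl tl unfolding S_def set_map[symmetric] L by auto
  then show "S \<subseteq> set (concat ps) \<times> set (concat ps)" by force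
qed

text \<open>Inserting between \<open>u\<close> and \<open>w\<close> breaks only the pair that starts
  at \<open>u\<close>; any other consecutive pair survives before or after the insertion. The cases
  distinguish which of the two pairs comes first.\<close>

lemma step_survives_insertion:
  assumes "as @ u # w # bs = as' @ u' # w' # bs'" "u \<noteq> u'"
  shows "\<exists>cs ds. as @ u # g @ w # bs = cs @ u' # w' # ds"
proof -
  obtain us where "as = as' @ us \<and> us @ u # w # bs = u' # w' # bs' \<or> as @ us = as' \<and> u # w # bs = us @ u' # w' # bs'"
    using assms(1) unfolding append_eq_append_conv2 by blast
  then show ?thesis
  proof (elim disjE conjE)
    assume us: "as = as' @ us" "us @ u # w # bs = u' # w' # bs'"
    then obtain us' where us': "us = u' # us'" "us' @ u # w # bs = w' # bs'" using assms(2) by (cases us) auto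
    show ?thesis
    proof (cases us')
      case Nil
      then show ?thesis using us us' by (intro exI[of _ as'] exI[of _ "g @ w # bs"]) auto
    next
      case (Cons v vs)
      then show ?thesis using us us' by (intro exI[of _ as'] exI[of _ "vs @ u # g @ w # bs"]) auto
    qed
  next
    assume us: "as @ us = as'" "u # w # bs = us @ u' # w' # bs'"
    then obtain us' where "us = u # us'" "w # bs = us' @ u' # w' # bs'" using assms(2) by (cases us) auto
    then show ?thesis by (intro exI[of _ "as @ u # g @ us'"] exI[of _ bs']) auto
  qed
qed

lemma path_edges_insertion:
  assumes "g \<noteq> []"
  shows "path_edges (as @ u # g @ w # bs) \<subseteq>
    path_edges (as @ u # w # bs) \<union> path_edges g \<union> {{u, hd g}, {last g, w}}"
proof -
  have "path_edges ((as @ [u]) @ (g @ (w # bs))) =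
      path_edges (as @ [u]) \<union> path_edges (g @ (w # bs)) \<union> {{last (as @ [u]), hd (g @ (w # bs))}}"
    by (rule path_edges_append) auto
  moreover have "path_edges (g @ (w # bs)) = path_edges g \<union> path_edges (w # bs) \<union> {{last g, hd (w # bs)}}"
    using assms by (rule path_edges_append) simp
  moreover have "path_edges ((as @ [u]) @ (w # bs)) =
      path_edges (as @ [u]) \<union> path_edges (w # bs) \<union> {{last (as @ [u]), hd (w # bs)}}"
    by (rule path_edges_append) auto
  ultimately have "path_edges (as @ u # g @ w # bs) =
      path_edges (as @ [u]) \<union> path_edges g \<union> path_edges (w # bs) \<union> {{last g, w}} \<union> {{u, hd g}}"
    "path_edges (as @ [u]) \<union> path_edges (w # bs) \<subseteq> path_edges (as @ u # w # bs)"
    using assms by (simp add: Un_assoc, auto)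
  then show ?thesis by blast
qed

text \<open>The gadgets are guest paths, which are inserted between consecutive vertices of host paths.\<close>
lemma insert_guests:
  fixes gs :: "nat list list" and slots :: "(nat \<times> nat) set"
  assumes cover: "path_cover n E (mset gs + mset hs)"
    and slots: "slots = set (concat (map steps hs))" "inj_on fst slots"
    and I: "finite I" "I \<subseteq> {..<length gs}" "\<sigma> ` I \<subseteq> slots" "inj_on \<sigma> I"
  defines "E' \<equiv> \<lambda>I. E \<union> (\<lambda>i. {hd (gs ! i), fst (\<sigma> i)}) ` I \<union> (\<lambda>i. {last (gs ! i), snd (\<sigma> i)}) ` I"
  shows "\<exists>C. size C = length hs \<and> (\<forall>p\<in>#C. p \<noteq> [] \<and> path_edges p \<subseteq> E' I) \<and>
    (\<Sum>p\<in>#C. mset p) + (\<Sum>i\<in>{..<length gs} - I. mset (gs ! i)) = mset_set {1..n} \<and>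
    (\<forall>(u, w)\<in>slots - \<sigma> ` I. \<exists>p\<in>#C. \<exists>as bs. p = as @ u # w # bs)"
  using I
proof (induction I rule: finite_induct)
  case empty
  have "(\<Sum>i\<in>{..<length gs}. mset (gs ! i)) = mset (concat gs)"
    by (simp add: mset_concat sum_list_sum_nth atLeast0LessThan)
  then have "(\<Sum>p\<in>#mset hs. mset p) + (\<Sum>i\<in>{..<length gs} - {}. mset (gs ! i)) = mset_set {1..n}"
    using cover unfolding path_cover_def by (simp add: sum_mset_mset[symmetric] add.commute)
  moreover have "\<exists>p\<in>#mset hs. \<exists>as bs. p = as @ u # w # bs" if "(u, w) \<in> slots" for u w
    using that steps_split unfolding slots by fastforce
  ultimately show ?case
    using cover unfolding path_cover_def E'_def by (intro exI[of _ "mset hs"]) auto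
next
  case (insert i I)
  let ?k = "length gs"
  have "I \<subseteq> {..<?k}" "\<sigma> ` I \<subseteq> slots" "inj_on \<sigma> I" using insert.prems by auto
  from insert.IH[OF this] obtain C where C\<^sub>0: "size C = length hs \<and> (\<forall>p\<in>#C. p \<noteq> [] \<and> path_edges p \<subseteq> E' I) \<and>
    (\<Sum>p\<in>#C. mset p) + (\<Sum>i\<in>{..<?k} - I. mset (gs ! i)) = mset_set {1..n} \<and>
    (\<forall>(u, w)\<in>slots - \<sigma> ` I. \<exists>p\<in>#C. \<exists>as bs. p = as @ u # w # bs)"
    by (rule exE)
  have C: "size C = length hs" "\<And>p. p \<in># C \<Longrightarrow> p \<noteq> [] \<and> path_edges p \<subseteq> E' I"
    "(\<Sum>p\<in>#C. mset p) + (\<Sum>i\<in>{..<?k} - I. mset (gs ! i)) = mset_set {1..n}"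
    using C\<^sub>0 by simp_all
  have C_step: "\<exists>p\<in>#C. \<exists>as bs. p = as @ u # w # bs" if "(u, w) \<in> slots - \<sigma> ` I" for u w
  proof -
    have "\<forall>(u, w)\<in>slots - \<sigma> ` I. \<exists>p\<in>#C. \<exists>as bs. p = as @ u # w # bs" using C\<^sub>0 by (elim conjE)
    from bspec[OF this that] show ?thesis by (simp only: prod.case)
  qed
  obtain u w where uw: "\<sigma> i = (u, w)" by (cases "\<sigma> i")
  have "\<sigma> i \<in> slots" "\<sigma> i \<notin> \<sigma> ` I" using insert.prems insert.hyps(2) by auto
  then have uwS: "(u, w) \<in> slots - \<sigma> ` I" by (simp add: uw)
  then obtain as bs where h: "as @ u # w # bs \<in># C" using C_step by blast
  define h where "h = as @ u # w # bs"
  define g where "g = gs ! i"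
  define h' where "h' = as @ u # g @ w # bs"
  have i: "i < ?k" "i \<notin> I" using insert.prems(1) insert.hyps(2) by auto
  have g: "g \<noteq> []" "path_edges g \<subseteq> E"
    using cover i(1) unfolding path_cover_def g_def by (auto simp: nth_mem)
  define C' where "C' = add_mset h' (C - {#h#})"
  have C_eq: "C = add_mset h (C - {#h#})" using h by (simp add: h_def)
  have E'_ins: "E' (insert i I) = insert {hd g, u} (insert {last g, w} (E' I))"
    by (auto simp: E'_def g_def uw)
  have "size C' = length hs" using C(1) C_eq by (metis C'_def size_add_mset)
  moreover have "p \<noteq> [] \<and> path_edges p \<subseteq> E' (insert i I)" if "p \<in># C'" for p
  proof (cases "p = h'")
    case True
    have "path_edges h \<subseteq> E' I" using C(2) h by (simp add: h_def)
    moreover have "E \<subseteq> E' I" by (auto simp: E'_def)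
    ultimately have "path_edges h' \<subseteq> E' (insert i I)"
      using path_edges_insertion[OF g(1), of as u w bs] g(2)
      unfolding E'_ins h'_def h_def by (auto simp: insert_commute)
    then show ?thesis using True by (simp add: h'_def)
  next
    case False
    then have "p \<in># C" using that by (auto simp: C'_def dest: in_diffD)
    then show ?thesis using C(2) E'_ins by blast
  qed
  moreover have "(\<Sum>p\<in>#C'. mset p) + (\<Sum>i\<in>{..<?k} - insert i I. mset (gs ! i)) = mset_set {1..n}"
  proof -
    have eq: "{..<?k} - I = insert i ({..<?k} - insert i I)" using i by auto
    have "(\<Sum>i\<in>{..<?k} - I. mset (gs ! i)) = mset g + (\<Sum>i\<in>{..<?k} - insert i I. mset (gs ! i))"
      unfolding eq g_def by (rule sum.insert) auto
    moreover have "(\<Sum>p\<in>#C. mset p) = mset h + (\<Sum>p\<in>#C - {#h#}. mset p)"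
      by (subst C_eq) simp
    moreover have "mset h' = mset h + mset g" by (simp add: h_def h'_def)
    ultimately show ?thesis using C(3) by (simp add: C'_def ac_simps)
  qed
  moreover have "\<exists>p\<in>#C'. \<exists>as bs. p = as @ u' # w' # bs" if "(u', w') \<in> slots - \<sigma> ` insert i I" for u' w'
  proof -
    have "(u', w') \<noteq> (u, w)" using that uw by auto
    moreover have "(u', w') \<in> slots" "(u, w) \<in> slots" using that uwS by auto
    \<comment> \<open>Slots are determined by their first components, so distinct slots start at
      distinct vertices, as \<open>step_survives_insertion\<close> requires.\<close>
    ultimately have ne: "u \<noteq> u'" using inj_onD[OF slots(2), of "(u', w')" "(u, w)"] by auto
    have "(u', w') \<in> slots - \<sigma> ` I" using that by auto
    from C_step[OF this] obtain p as' bs' where p: "p \<in># C" "p = as' @ u' # w' # bs'" by blast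
    show ?thesis
    proof (cases "p = h")
      case True
      then show ?thesis
        using step_survives_insertion[of as u w bs as' u' w' bs' g] p(2) ne
        by (auto simp: C'_def h'_def h_def)
    next
      case False
      then have "p \<in># C'" using p(1) by (simp add: C'_def in_diff_count count_diff flip: count_greater_zero_iff)
      then show ?thesis using p(2) by blast
    qed
  qed
  ultimately show ?case by (intro exI[of _ C']) auto
qed

text \<open>Half of the paths become guests, but the hosts must hold at least half of the vertices
  to offer enough slots. If the first half of the list holds more vertices than the second, the
  roles are exchanged.\<close>

lemma split_guests_hosts:
  fixes ps :: "'a list list"
  shows "\<exists>gs hs. mset gs + mset hs = mset ps \<and> length gs = length ps div 2 \<and>
    length (concat ps) \<le> 2 * length (concat hs)"
proof -
  define k where "k = length ps div 2"
  define A B where "A = take k ps" and "B = drop k ps"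
  have ps: "ps = A @ B" by (simp add: A_def B_def)
  have len: "length A = k" "k \<le> length B" by (auto simp: A_def B_def k_def)
  show ?thesis
  proof (cases "length (concat A) \<le> length (concat B)")
    case True
    then show ?thesis using len ps by (intro exI[of _ A] exI[of _ B]) (auto simp: k_def)
  next
    case False
    have "mset (take k B) + mset (drop k B) = mset B" by (metis append_take_drop_id mset_append)
    \<comment> \<open>When the number of paths is odd, the path left over from \<open>B\<close>
      becomes a host.\<close>
    then have "mset (take k B) + mset (drop k B @ A) = mset ps" by (simp add: ps flip: add.assoc)
    moreover have "length (concat ps) \<le> 2 * length (concat (drop k B @ A))"
      using False by (simp add: ps)
    moreover have "length (take k B) = length ps div 2" using len by (simp add: k_def)
    ultimately show ?thesis by blast
  qed
qed

text \<open>Each guest placed into a slot lowers the number of paths by one, and this number bounds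
  the distance. Two paths provide at least one guest and one host.\<close>

lemma hamiltonian_cycles_gadgets_many:
  assumes n: "n \<ge> 3" and ps: "path_cover n E (mset ps)" "length ps = edge_distance (hamiltonian_cycles n) E"
    and d: "2 \<le> length ps" "100 * length ps \<le> n"
  shows "has_gadgets n (hamiltonian_cycles n) E"
proof -
  obtain gs hs where gh: "mset gs + mset hs = mset ps" "length gs = length ps div 2"
      "length (concat ps) \<le> 2 * length (concat hs)"
    using split_guests_hosts by blast
  define k where "k = length gs"
  define S where "S = set (concat (map steps hs))"
  have len: "length gs + length hs = length ps" using arg_cong[OF gh(1), of size] by simp
  have cover: "path_cover n E (mset gs + mset hs)" using ps(1) gh(1) by simp
  have msum: "mset (concat gs) + mset (concat hs) = mset_set {1..n}"
    using cover unfolding path_cover_def by (simp add: sum_mset_mset)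
  have "mset (concat (gs @ hs)) = mset_set {1..n}" using msum by simp
  note D = mset_eq_mset_setD[OF this]
  have dhs: "distinct (concat hs)" "set (concat hs) \<subseteq> {1..n}" "set (concat gs) \<subseteq> {1..n}"
    using D by auto
  have "mset (concat ps) = mset_set {1..n}"
    using ps(1) unfolding path_cover_def sum_mset_mset by simp
  then have "length (concat ps) = n" by (metis card_atLeastAtMost diff_Suc_1 size_mset size_mset_set)
  then have hosts: "n \<le> 2 * length (concat hs)" using gh(3) by simp
  note slots = slots_of_paths[OF dhs(1), folded S_def]
  have gne: "gs ! i \<noteq> []" if "i < k" for i
    using cover that unfolding path_cover_def k_def by (auto simp: nth_mem)
  have "gadget_family n (hamiltonian_cycles n) E k (\<lambda>i. hd (gs ! i)) (\<lambda>i. last (gs ! i)) S"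
    unfolding gadget_family_def ps(2)[symmetric]
  proof (intro conjI allI impI)
    \<comment> \<open>The floor of m/2 is at least m/3 for m >= 2, the origin of the factor 3 in
      \<open>gadget_family\<close>.\<close>
    show "1 \<le> k" "k \<le> length ps" "length ps \<le> 3 * k" using d gh(2) by (auto simp: k_def)
    have "hd (gs ! i) \<in> set (concat gs)" "last (gs ! i) \<in> set (concat gs)" if "i < k" for i
      using that gne[OF that] by (auto simp: k_def intro!: bexI[of _ "gs ! i"])
    then show "hd (gs ! i) \<in> {1..n}" "last (gs ! i) \<in> {1..n}" if "i < k" for i
      using dhs(3) that by blast+
    show "S \<subseteq> {1..n} \<times> {1..n}" using slots(3) dhs(2) by blast
    show "inj_on fst S" "inj_on snd S" by fact+
    \<comment> \<open>The hosts hold at least n/2 vertices and lose one slot each, and there are at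
      most n/100 of them.\<close>
    show "n \<le> 4 * card S" using hosts slots(4) len d(2) by linarith
    fix I \<sigma> assume I: "I \<subseteq> {..<k}" "\<sigma> ` I \<subseteq> S" "inj_on \<sigma> I"
    let ?E = "E \<union> (\<lambda>i. {hd (gs ! i), fst (\<sigma> i)}) ` I \<union> (\<lambda>i. {last (gs ! i), snd (\<sigma> i)}) ` I"
    have fin: "finite I" using I(1) finite_subset by blast
    obtain C where C: "size C = length hs" "\<And>p. p \<in># C \<Longrightarrow> p \<noteq> [] \<and> path_edges p \<subseteq> ?E"
      "(\<Sum>p\<in>#C. mset p) + (\<Sum>i\<in>{..<k} - I. mset (gs ! i)) = mset_set {1..n}"
      using insert_guests[OF cover S_def slots(1) fin I(1)[unfolded k_def] I(2,3)] unfolding k_def by blast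
    define C' where "C' = C + image_mset ((!) gs) (mset_set ({..<k} - I))"
    have "path_cover n ?E C'"
      unfolding path_cover_def
    proof (intro conjI ballI)
      show "(\<Sum>p\<in>#C'. mset p) = mset_set {1..n}"
        using C(3) by (simp add: C'_def sum_unfold_sum_mset image_mset.compositionality comp_def)
      fix p assume "p \<in># C'"
      then consider "p \<in># C" | i where "i < k" "p = gs ! i" by (auto simp: C'_def)
      then have "p \<noteq> [] \<and> path_edges p \<subseteq> ?E"
      proof cases
        case (2 i)
        then have "p \<in># mset gs + mset hs" by (simp add: k_def)
        then have "p \<noteq> [] \<and> path_edges p \<subseteq> E" using cover unfolding path_cover_def by blast
        then show ?thesis by blast
      qed (use C(2) in blast)
      then show "p \<noteq> []" "path_edges p \<subseteq> ?E" by blast+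
    qed
    then have "edge_distance (hamiltonian_cycles n) ?E \<le> size C'"
      by (rule edge_distance_le_path_cover[OF n])
    also have "size C' = length hs + (k - card I)"
      using C(1) I(1) fin by (simp add: C'_def card_Diff_subset)
    finally show "edge_distance (hamiltonian_cycles n) ?E + card I \<le> length ps"
      using len card_mono[OF _ I(1)] by (simp add: k_def)
  qed
  then show ?thesis unfolding has_gadgets_def by blast
qed

text \<open>A single path has no host; it is closed to a cycle by reversing the part after a slot.\<close>
lemma hamiltonian_cycles_gadgets_one:
  assumes n: "n \<ge> 3" and c: "path_cover n E {#c#}" "edge_distance (hamiltonian_cycles n) E = 1"
  shows "has_gadgets n (hamiltonian_cycles n) E"
proof -
  have mc: "mset c = mset_set {1..n}" and cE: "path_edges c \<subseteq> E" "c \<noteq> []"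
    using c(1) by (auto simp: path_cover_def)
  note D = mset_eq_mset_setD[OF mc]
  have len: "length c = n" using distinct_card[OF D(1)] D(2) by simp
  \<comment> \<open>Swapped because \<open>hd c\<close> is joined to the later vertex of a step and
    \<open>last c\<close> to the earlier one: the part from the later vertex on is traversed
    backwards in the new cycle.\<close>
  define S where "S = prod.swap ` set (steps c)"
  have slots: "inj_on fst (set (steps c))" "inj_on snd (set (steps c))" "set (steps c) \<subseteq> {1..n} \<times> {1..n}"
      "n \<le> card (set (steps c)) + 1"
    using slots_of_paths[of "[c]"] D len by simp_all
  have cycle: "edge_distance (hamiltonian_cycles n) E' = 0"
    if "(u, w) \<in> S" "path_edges c \<subseteq> E'" "{hd c, u} \<in> E'" "{last c, w} \<in> E'" for u w E'
  proof -
    have "(w, u) \<in> set (steps c)" using that(1) by (force simp: S_def)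
    then obtain as bs where s: "c = as @ w # u # bs" using steps_split by blast
    define c' where "c' = (as @ [w]) @ rev (u # bs)"
    have "mset c' = mset c" by (simp add: c'_def s)
    then have D': "distinct c'" "set c' = {1..n}" using mset_eq_mset_setD mc by metis+
    have pc: "path_edges c = path_edges (as @ [w]) \<union> path_edges (u # bs) \<union> {{w, u}}"
      using path_edges_append[of "as @ [w]" "u # bs"] by (simp add: s)
    have "path_edges c' = path_edges (as @ [w]) \<union> path_edges (u # bs) \<union> {{w, last (u # bs)}}"
      unfolding c'_def by (subst path_edges_append) (simp_all add: path_edges_rev hd_rev del: rev.simps)
    moreover have "last (u # bs) = last c" by (simp add: s)
    moreover have "last c' = u" by (simp add: c'_def)
    moreover have "hd c' = hd c" by (simp add: c'_def s hd_append)
    ultimately have "cycle_edges c' \<subseteq> E'"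
      using that pc unfolding cycle_edges_def by (auto simp: insert_commute)
    moreover have "cycle_edges c' \<in> hamiltonian_cycles n" using D' n by (auto simp: hamiltonian_cycles_def)
    ultimately show ?thesis
      using edge_distance_le[of "cycle_edges c'" "hamiltonian_cycles n" E']
      by (metis Diff_eq_empty_iff card.empty le_zero_eq)
  qed
  have "gadget_family n (hamiltonian_cycles n) E 1 (\<lambda>_. hd c) (\<lambda>_. last c) S"
    unfolding gadget_family_def c(2)
  proof (intro conjI allI impI)
    show "hd c \<in> {1..n}" "last c \<in> {1..n}" using cE(2) D(2) by (metis hd_in_set, metis last_in_set)
    show "S \<subseteq> {1..n} \<times> {1..n}" using slots(3) by (auto simp: S_def)
    show "inj_on fst S" "inj_on snd S"
      using slots(1,2) by (auto simp: S_def inj_on_def)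
    have "card S = card (set (steps c))" unfolding S_def by (rule card_image) simp
    then show "n \<le> 4 * card S" using slots(4) n by linarith
    fix I :: "nat set" and \<sigma> assume I: "I \<subseteq> {..<1}" "\<sigma> ` I \<subseteq> S" "inj_on \<sigma> I"
    let ?E = "E \<union> (\<lambda>i. {hd c, fst (\<sigma> i)}) ` I \<union> (\<lambda>i. {last c, snd (\<sigma> i)}) ` I"
    consider "I = {}" | "I = {0}" using I(1) by auto
    then show "edge_distance (hamiltonian_cycles n) ?E + card I \<le> 1"
    proof cases
      case 2
      obtain u w where uw: "\<sigma> 0 = (u, w)" by (cases "\<sigma> 0")
      have "edge_distance (hamiltonian_cycles n) ?E = 0"
        using cE(1) I(2) uw 2 by (intro cycle[of u w]) auto
      then show ?thesis using 2 by simp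
    qed (use c(2) in simp)
  qed auto
  then show ?thesis unfolding has_gadgets_def by blast
qed

lemma hamiltonian_cycles_gadgets:
  assumes n: "n \<ge> 3" and d: "1 \<le> edge_distance (hamiltonian_cycles n) E" "100 * edge_distance (hamiltonian_cycles n) E \<le> n"
  shows "has_gadgets n (hamiltonian_cycles n) E"
proof -
  obtain ps where ps: "length ps = edge_distance (hamiltonian_cycles n) E" "path_cover n E (mset ps)"
    using path_cover_of_edge_distance[OF n d(1)] by blast
  show ?thesis
  proof (cases "length ps = 1")
    case True
    then obtain c where "ps = [c]" by (auto simp: length_Suc_conv)
    then show ?thesis using ps hamiltonian_cycles_gadgets_one[OF n, of E c] by simp
  next
    case False
    then show ?thesis using hamiltonian_cycles_gadgets_many[OF n ps(2,1)] d ps(1) by simp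
  qed
qed

interpretation hamiltonian_cycle: target_property hamiltonian_cycles has_hamiltonian_cycle
  by unfold_locales
    (rule hamiltonian_cycles_nonempty hamiltonian_cycles_edges hamiltonian_cycles_spread hamiltonian_cycles_size
      hamiltonian_cycles_glue hamiltonian_cycles_gadgets has_hamiltonian_cycle_iff; assumption)+

theorem theorem1p3:
  fixes P :: graph_property
  assumes "P \<in> {has_perfect_matching, has_hamiltonian_cycle}"
  shows "sharp_threshold P (\<lambda>n. real (m_threshold P (1/2) n)) \<and>
         (\<exists>C>0. (\<lambda>n. real (m_threshold P (1/2) n) / real n) \<longlonglongrightarrow> C)"
  using assms perfect_matching.sharp_threshold_m_threshold perfect_matching.m_threshold_linear
    hamiltonian_cycle.sharp_threshold_m_threshold hamiltonian_cycle.m_threshold_linear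
  by blast

end
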